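(* Let $n\ge2$, $\nu\in(0,1]$, $\beta_1,\dots,\beta_n>0$, $\bar\beta=\sum_{j=1}^n\beta_j$, $i\in\{1,\dots,n-1\}$, and let $Q_i$ be the random variable on $(0,1)$ with probability density function \begin{align*} f_{Q_i}(q_i) = {}& q_i^{\nu\beta_i-1}(1-q_i)^{\nu(\bar\beta-\beta_i)-1}\\ &\times\int_0^\infty y^{\nu\bar\beta-1}\,E^{\beta_i}_{\nu,\nu\beta_i}\bigl(-(yq_i)^\nu\bigr)\,E^{\bar\beta-\beta_i}_{\nu,\nu(\bar\beta-\beta_i)}\bigl(-(y(1-q_i))^\nu\bigr)\,\mathrm dy . \end{align*} Then, for $q_i\in(0,1)$, \begin{align*} f_{Q_i}(q_i) = {}& \frac{1}{\nu\,\Gamma(\beta_i)\Gamma(\bar\beta-\beta_i)}\,q_i^{\nu\beta_i-1}(1-q_i)^{-(\nu\beta_i+1)}\\ &\times\lim_{\varepsilon\downarrow0}H_{3,3}^{2,2}\left[\left(\frac{q_i}{1-q_i}\right)^{\nu}\left|\begin{matrix}(1-\beta_i,1)&(1-\bar\beta+\varepsilon,1)&(\nu(\varepsilon-\beta_i),\nu)\\(0,1)&(\varepsilon-\beta_i,1)&(1-\nu\beta_i,\nu)\end{matrix}\right.\right]. \end{align*}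
   Context: The three-parameter Mittag-Leffler function is $E_{\alpha,\beta}^\delta(z) = \sum_{r=0}^\infty \frac{z^r}{\Gamma(\alpha r + \beta)}\frac{\Gamma(\delta+r)}{r!\,\Gamma(\delta)}$. The $H$-function is, in the standard (Kilbas–Saigo) convention, $$H_{p,r}^{m,n}\left[z\left|\begin{matrix}(a_i,A_i)_{1,p}\\(b_j,B_j)_{1,r}\end{matrix}\right.\right]=\frac1{2\pi \mathrm i}\int_{L}\frac{\prod_{j=1}^m\Gamma(b_j+B_js)\,\prod_{i=1}^n\Gamma(1-a_i-A_is)}{\prod_{i=n+1}^p\Gamma(a_i+A_is)\,\prod_{j=m+1}^r\Gamma(1-b_j-B_js)}\,z^{-s}\,\mathrm ds,$$ where $L$ is a contour going from $\gamma-\mathrm i\infty$ to $\gamma+\mathrm i\infty$ (for a suitable real $\gamma$) that leaves all poles of $\Gamma(b_j+B_js)$, $j=1,\dots,m$, to its left and all poles of $\Gamma(1-a_i-A_is)$, $i=1,\dots,n$, to its right. (In this definition $m,n,p,r$ are the orders of the $H$-function, and $n$ is unrelated to the number of parameters $\beta_j$.) In the claim the argument $(q_i/(1-q_i))^\nu$ is a positive real number and $\varepsilon>0$ is small. The density in the claim is the $i$-th one-dimensional marginal of the fractional Dirichlet distribution, i.e. of the law of $(Z_1/W,\dots,Z_{n-1}/W)$, where $Z_1,\dots,Z_n$ are independent, $Z_j$ has density $x^{\nu\beta_j-1}E_{\nu,\nu\beta_j}^{\beta_j}(-x^\nu)$ on $(0,\infty)$, and $W=Z_1+\dots+Z_n$.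 *)

theory Defs
  imports "HOL-Probability.Probability"
begin

definition mittag_leffler3 :: "'a::Gamma \<Rightarrow> 'a \<Rightarrow> 'a \<Rightarrow> 'a \<Rightarrow> 'a" where
  "mittag_leffler3 \<alpha> \<beta> \<delta> z =
     (\<Sum>r. z ^ r / Gamma (\<alpha> * of_nat r + \<beta>) * (Gamma (\<delta> + of_nat r) / (fact r * Gamma \<delta>)))"

text \<open>
  Parameters of the H-function are the lists \<open>as\<close> of the pairs \<open>(a\<^sub>i, A\<^sub>i)\<close> and \<open>bs\<close> of the
  pairs \<open>(b\<^sub>j, B\<^sub>j)\<close>, so \<open>p = length as\<close> and \<open>r = length bs\<close>; the orders \<open>m\<close> and \<open>n\<close> say how
  many leading entries of \<open>bs\<close> and \<open>as\<close> contribute to the numerator.  At a pole of a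
  denominator factor, \<open>Gamma\<close> is \<open>0\<close> and so is the quotient, in agreement with the entire
  function \<open>1/\<Gamma>\<close>.
\<close>

definition fox_H_kernel ::
    "nat \<Rightarrow> nat \<Rightarrow> (complex \<times> real) list \<Rightarrow> (complex \<times> real) list \<Rightarrow> complex \<Rightarrow> complex" where
  "fox_H_kernel m n as bs s =
     ((\<Prod>(b, B)\<leftarrow>take m bs. Gamma (b + of_real B * s)) *
      (\<Prod>(a, A)\<leftarrow>take n as. Gamma (1 - a - of_real A * s))) /
     ((\<Prod>(a, A)\<leftarrow>drop n as. Gamma (a + of_real A * s)) *
      (\<Prod>(b, B)\<leftarrow>drop m bs. Gamma (1 - b - of_real B * s)))"

definition fox_H_left_poles :: "nat \<Rightarrow> (complex \<times> real) list \<Rightarrow> complex set" where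
  "fox_H_left_poles m bs = {s. \<exists>(b, B)\<in>set (take m bs). b + of_real B * s \<in> \<int>\<^sub>\<le>\<^sub>0}"

definition fox_H_right_poles :: "nat \<Rightarrow> (complex \<times> real) list \<Rightarrow> complex set" where
  "fox_H_right_poles n as = {s. \<exists>(a, A)\<in>set (take n as). 1 - a - of_real A * s \<in> \<int>\<^sub>\<le>\<^sub>0}"

text \<open>
  A contour from \<open>\<gamma> - \<i>\<infinity>\<close> to \<open>\<gamma> + \<i>\<infinity>\<close>: it runs along the line \<open>Re s = \<gamma>\<close> near both ends and
  is an arbitrary piecewise \<open>C\<^sup>1\<close> path in between.
\<close>

definition vertical_contour :: "real \<Rightarrow> (real \<Rightarrow> complex) \<Rightarrow> bool" where
  "vertical_contour \<gamma> L \<longleftrightarrow>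
     (\<exists>T. L piecewise_C1_differentiable_on {-T..T} \<and> (\<forall>t. \<bar>t\<bar> \<ge> T \<longrightarrow> L t = Complex \<gamma> t))"

text \<open>
  A point lies to the left (right) of a contour if it is in the component of the complement
  that contains the far left (far right) part of the real axis.
\<close>

definition left_of_contour :: "(real \<Rightarrow> complex) \<Rightarrow> complex \<Rightarrow> bool" where
  "left_of_contour L s \<longleftrightarrow> (\<forall>\<^sub>F x in at_bot. connected_component (- range L) s (complex_of_real x))"

definition right_of_contour :: "(real \<Rightarrow> complex) \<Rightarrow> complex \<Rightarrow> bool" where
  "right_of_contour L s \<longleftrightarrow> (\<forall>\<^sub>F x in at_top. connected_component (- range L) s (complex_of_real x))"

definition fox_H_contour ::
    "nat \<Rightarrow> nat \<Rightarrow> (complex \<times> real) list \<Rightarrow> (complex \<times> real) list \<Rightarrow> (real \<Rightarrow> complex) \<Rightarrow> bool" where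
  "fox_H_contour m n as bs L \<longleftrightarrow>
     (\<exists>\<gamma>. vertical_contour \<gamma> L) \<and>
     (\<forall>s\<in>fox_H_left_poles m bs. left_of_contour L s) \<and>
     (\<forall>s\<in>fox_H_right_poles n as. right_of_contour L s)"

text \<open>
  The value does not depend on the choice of the separating contour, hence the definite
  description.  The power \<open>z\<^sup>-\<^sup>s\<close> uses the principal branch, and the Henstock-Kurzweil integral
  over the whole line is the (possibly improper) contour integral.
\<close>

definition fox_H ::
    "nat \<Rightarrow> nat \<Rightarrow> (complex \<times> real) list \<Rightarrow> (complex \<times> real) list \<Rightarrow> complex \<Rightarrow> complex" where
  "fox_H m n as bs z =
     (THE v. \<exists>L I. fox_H_contour m n as bs L \<and>
        ((\<lambda>t. fox_H_kernel m n as bs (L t) * z powr (- L t) * vector_derivative L (at t))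
           has_integral I) UNIV \<and>
        v = 1 / (2 * of_real pi * \<i>) * I)"

end

theory Submission
  imports Defs "HOL-Complex_Analysis.Complex_Analysis" "HOL-Real_Asymp.Real_Asymp"
begin

text \<open>
  Write \<open>a = \<beta>\<^sub>i\<close>, \<open>b = \<beta>bar - \<beta>\<^sub>i\<close> and let \<open>G(w)\<close> be the analytic continuation of
  \<open>\<Gamma>(w) / \<Gamma>(\<nu>w)\<close> to \<open>Re w > -1\<close>.  The Mittag-Leffler function has the Mellin-Barnes
  integral with kernel \<open>\<Gamma>(s) G(a - s) / \<Gamma>(a)\<close> on every line \<open>0 < Re s < a + 1\<close>, so its Mellin
  transform is this kernel, and Fubini turns the integral in \<open>f\<close> into an integral over the line
  \<open>Re s = a\<close>.  There the poles of \<open>\<Gamma>(a - s)\<close> and \<open>\<Gamma>(s - a)\<close> collide, but they are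
  removable because of the factors \<open>1 / \<Gamma>(\<nu>(a - s))\<close> and \<open>1 / \<Gamma>(\<nu>(s - a))\<close>.  For
  \<open>\<epsilon> > 0\<close> the H-function is the integral over the separating line \<open>Re s = a - \<epsilon>/2\<close>, and
  \<open>\<epsilon> \<rightarrow> 0\<close> is a case of dominated convergence.  All bounds come from comparing the Euler products
  of two Gamma values factor by factor.
\<close>

section \<open>Bounds for the Gamma function\<close>

text \<open>The continued quotient \<open>gamma_quot\<close> is merely bounded on vertical strips,
  and for \<nu> = 1 it is constant, so integrability along a line has to come from the other Gamma
  factors; the functional equation gives them decay 1 / (1 + t^2), which suffices. The continuation
  cannot be avoided: on Re s = a Fubini calls for the Mellin transform of the second Mittag-Leffler
  function at Re p = b, where \<Gamma>(b - p) meets its first pole, and its evaluation uses lines on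
  both sides of p. Cauchy's formula on an infinite strip serves twice: for p a pole of \<Gamma> it
  moves a line across p and yields a term of the series; for other p it inverts the Mellin-Barnes
  integral, since 1 / (s - p) is, up to constants, the integral of a power of y over (0,1) or
  (1,\<infinity>). The definite description in \<open>fox_H\<close> makes uniqueness part of the
  evaluation: all admissible contours, even self-intersecting ones with conditionally convergent
  integrals, must give one value. Sides of a contour are defined by connected components, so these
  have to be translated into winding numbers before Cauchy's theorem applies.\<close>

text \<open>Euler's limit n! n^z / (z (z+1) ... (z+n)) has a numerator whose modulus depends only on
  Re z and n, so |\<Gamma>(z)| / \<Gamma>(Re z) is the limit of the products of (Re z + k) / |z +
  k|. The hypothesis orders these factors one by one; the cross-multiplied form avoids
  quotients.\<close>

lemma norm_Gamma_ratio_le: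
  fixes z1 z2 :: complex
  assumes "Re z1 > 0" "Re z2 > 0"
    and le: "\<And>k::nat. norm (z2 + of_nat k) * (Re z1 + k) \<le> norm (z1 + of_nat k) * (Re z2 + k)"
  shows "norm (Gamma z1) * Gamma (Re z2) \<le> norm (Gamma z2) * Gamma (Re z1)"
proof -
  have ns: "norm (Gamma_series z n) = fact n * exp (Re z * ln (real n)) / (\<Prod>k\<in>{0..n}. norm (z + of_nat k))"
    for z :: complex and n
    unfolding Gamma_series_def
    by (simp add: norm_divide norm_mult pochhammer_prod prod_norm atLeastLessThanSuc_atLeastAtMost)
  have rs: "Gamma_series x n = fact n * exp (x * ln (real n)) / (\<Prod>k\<in>{0..n}. (x + of_nat k))"
    for x :: real and n
    unfolding Gamma_series_def
    by (simp add: pochhammer_prod atLeastLessThanSuc_atLeastAtMost)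
  have "norm (Gamma_series z1 n) * Gamma_series (Re z2) n \<le> norm (Gamma_series z2 n) * Gamma_series (Re z1) n" for n
  proof -
    have p1: "0 < norm (z1 + of_nat k)" for k :: nat
      using assms(1) by (metis Re_complex_of_real add_pos_nonneg complex_Re_of_nat of_nat_0_le_iff
          order_less_irrefl plus_complex.sel(1) zero_complex.sel(1) zero_less_norm_iff)
    have p2: "0 < norm (z2 + of_nat k)" for k :: nat
      using assms(2) by (metis Re_complex_of_real add_pos_nonneg complex_Re_of_nat of_nat_0_le_iff
          order_less_irrefl plus_complex.sel(1) zero_complex.sel(1) zero_less_norm_iff)
    have "(\<Prod>k\<in>{0..n}. norm (z2 + of_nat k) * (Re z1 + of_nat k))
        \<le> (\<Prod>k\<in>{0..n}. norm (z1 + of_nat k) * (Re z2 + of_nat k))"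
      by (rule prod_mono) (use assms in auto)
    hence D: "(\<Prod>k\<in>{0..n}. norm (z2 + of_nat k)) * (\<Prod>k\<in>{0..n}. (Re z1 + of_nat k))
        \<le> (\<Prod>k\<in>{0..n}. norm (z1 + of_nat k)) * (\<Prod>k\<in>{0..n}. (Re z2 + of_nat k))"
      by (simp add: prod.distrib)
    have "(\<Prod>k\<in>{0..n}. norm (z1 + of_nat k)) > 0" "(\<Prod>k\<in>{0..n}. norm (z2 + of_nat k)) > 0"
         "(\<Prod>k\<in>{0..n}. (Re z1 + of_nat k)) > 0" "(\<Prod>k\<in>{0..n}. (Re z2 + of_nat k)) > 0"
      using p1 p2 assms by (auto intro!: prod_pos add_pos_nonneg)
    with D show ?thesis unfolding ns rs
      by (simp add: field_simps) 
  qed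
  moreover have "(\<lambda>n. norm (Gamma_series z1 n) * Gamma_series (Re z2) n) \<longlonglongrightarrow> norm (Gamma z1) * Gamma (Re z2)"
    "(\<lambda>n. norm (Gamma_series z2 n) * Gamma_series (Re z1) n) \<longlonglongrightarrow> norm (Gamma z2) * Gamma (Re z1)"
    by (intro tendsto_intros Gamma_series_LIMSEQ)+
  ultimately show ?thesis
    by (intro LIMSEQ_le) auto
qed

lemma norm_Gamma_le_Gamma_Re:
  assumes "Re z > 0"
  shows "norm (Gamma z) \<le> Gamma (Re z)"
proof -
  have "norm (Gamma z) * Gamma (Re (of_real (Re z) :: complex)) \<le> norm (Gamma (of_real (Re z) :: complex)) * Gamma (Re z)"
  proof (rule norm_Gamma_ratio_le)
    fix k :: nat
    have "norm (complex_of_real (Re z) + of_nat k) = \<bar>Re z + k\<bar>"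
      by (metis norm_of_real of_real_add of_real_of_nat_eq)
    also have "\<dots> \<le> norm (z + of_nat k)"
      using abs_Re_le_cmod[of "z + of_nat k"] by simp
    finally show "norm (complex_of_real (Re z) + of_nat k) * (Re z + k)
        \<le> norm (z + of_nat k) * (Re (complex_of_real (Re z)) + k)"
      using assms by (simp add: mult_right_mono)
  qed (use assms in auto)
  moreover have "Gamma (Re z) > 0" using assms by (rule Gamma_real_pos)
  ultimately show ?thesis by (simp add: Gamma_complex_of_real)
qed

text \<open>Geometrically, for m \<ge> 0 and \<nu> \<le> 1 the argument of \<nu> w + m is at most
  that of w + m in absolute value, which is the required order of the Euler factors. For real w
  equality holds, so the bound is the value at Re w. The shift \<open>u\<close> admits negative Re
  w.\<close>

lemma norm_Gamma_scaled_le: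
  assumes "0 < \<nu>" "\<nu> \<le> 1" "u \<ge> 0" "Re w + u > 0"
  shows "norm (Gamma (w + of_real u)) * norm (rGamma (of_real \<nu> * w + of_real u))
       \<le> Gamma (Re w + u) * rGamma (\<nu> * Re w + u)"
proof -
  have pos: "\<nu> * Re w + u > 0"
  proof -
    have "\<nu> * Re w + u \<ge> \<nu> * (Re w + u)"
      using assms by (simp add: distrib_left mult_left_le_one_le)
    moreover have "\<nu> * (Re w + u) > 0" using assms by simp
    ultimately show ?thesis by linarith
  qed
  have "norm (Gamma (w + of_real u)) * Gamma (Re (of_real \<nu> * w + of_real u))
      \<le> norm (Gamma (of_real \<nu> * w + of_real u)) * Gamma (Re (w + of_real u))"
  proof (rule norm_Gamma_ratio_le)
    fix k :: nat
    define m where "m = u + k"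
    have m: "m \<ge> 0" using assms by (simp add: m_def)
    have 1: "Re w + m > 0" using assms by (simp add: m_def)
    have 2: "\<nu> * Re w + m > 0" using pos by (simp add: m_def)
    have 3: "\<nu> * (Re w + m) \<le> \<nu> * Re w + m"
      using assms m by (simp add: distrib_left mult_left_le_one_le)
    have 4: "0 \<le> \<nu> * (Re w + m)" using assms 1 by simp
    have e1: "norm (of_real \<nu> * w + of_real u + of_nat k) = sqrt ((\<nu> * Re w + m)\<^sup>2 + (\<nu> * Im w)\<^sup>2)"
      by (simp add: cmod_def m_def add.assoc)
    have e2: "norm (w + of_real u + of_nat k) = sqrt ((Re w + m)\<^sup>2 + (Im w)\<^sup>2)"
      by (simp add: cmod_def m_def add.assoc)
    have "(\<nu> * (Re w + m))\<^sup>2 \<le> (\<nu> * Re w + m)\<^sup>2"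
      by (rule power_mono[OF 3 4])
    hence "(\<nu> * (Re w + m))\<^sup>2 * (Im w)\<^sup>2 \<le> (\<nu> * Re w + m)\<^sup>2 * (Im w)\<^sup>2"
      by (rule mult_right_mono) simp
    \<comment> \<open>Both sides gain the common summand (\<nu> Re w + m)^2 (Re w + m)^2.\<close>
    hence "((\<nu> * Re w + m)\<^sup>2 + (\<nu> * Im w)\<^sup>2) * (Re w + m)\<^sup>2 \<le> ((Re w + m)\<^sup>2 + (Im w)\<^sup>2) * (\<nu> * Re w + m)\<^sup>2"
      unfolding power_mult_distrib distrib_right[of "_ ^ 2"] by (simp only: mult_ac add_left_mono)
    hence "sqrt (((\<nu> * Re w + m)\<^sup>2 + (\<nu> * Im w)\<^sup>2) * (Re w + m)\<^sup>2) \<le> sqrt (((Re w + m)\<^sup>2 + (Im w)\<^sup>2) * (\<nu> * Re w + m)\<^sup>2)"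
      by (rule real_sqrt_le_mono)
    hence "sqrt ((\<nu> * Re w + m)\<^sup>2 + (\<nu> * Im w)\<^sup>2) * (Re w + m) \<le> sqrt ((Re w + m)\<^sup>2 + (Im w)\<^sup>2) * (\<nu> * Re w + m)"
      using 1 2 by (simp add: real_sqrt_mult)
    thus "norm (of_real \<nu> * w + of_real u + of_nat k) * (Re (w + of_real u) + k)
        \<le> norm (w + of_real u + of_nat k) * (Re (of_real \<nu> * w + of_real u) + k)"
      unfolding e1 e2 by (simp add: m_def add.assoc)
  qed (use assms pos in auto)
  hence le: "norm (Gamma (w + of_real u)) * Gamma (\<nu> * Re w + u)
      \<le> norm (Gamma (of_real \<nu> * w + of_real u)) * Gamma (Re w + u)" by simp
  have nz: "of_real \<nu> * w + of_real u \<notin> \<int>\<^sub>\<le>\<^sub>0"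
    using pos by (auto elim!: nonpos_Ints_cases simp: complex_eq_iff)
  have "Gamma (of_real \<nu> * w + of_real u) \<noteq> 0" using nz by (simp add: Gamma_eq_zero_iff)
  moreover have "Gamma (\<nu> * Re w + u) > 0" using pos by (rule Gamma_real_pos)
  ultimately show ?thesis using le
    by (simp add: rGamma_inverse_Gamma norm_inverse norm_divide field_simps)
qed

lemma norm_Gamma_strip_le:
  fixes x1 x2 :: real
  assumes "0 < x1"
  obtains C where "C > 0" "\<And>z. x1 \<le> Re z \<Longrightarrow> Re z \<le> x2 \<Longrightarrow> norm (Gamma z) \<le> C"
proof -
  have "continuous_on {x1..x2} (Gamma :: real \<Rightarrow> real)"
    using assms by (intro continuous_on_Gamma) (auto elim!: nonpos_Ints_cases)
  then obtain C where C: "\<And>x. x \<in> {x1..x2} \<Longrightarrow> norm (Gamma x) \<le> C"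
    by (metis compact_Icc compact_continuous_image compact_imp_bounded bounded_iff imageI)
  have "norm (Gamma z) \<le> max C 1" if "x1 \<le> Re z" "Re z \<le> x2" for z
  proof -
    have "norm (Gamma z) \<le> Gamma (Re z)" using that assms by (intro norm_Gamma_le_Gamma_Re) auto
    also have "\<dots> \<le> C" using C[of "Re z"] that by auto
    finally show ?thesis by simp
  qed
  thus ?thesis using that[of "max C 1"] by auto
qed

text \<open>Since \<Gamma>(z+2) = (z+1) z \<Gamma>(z), boundedness two units further right turns
  into quadratic decay. This crude rate is already integrable along vertical lines.\<close>

lemma norm_Gamma_decay:
  fixes x1 x2 :: real
  assumes "0 < x1"
  obtains C where "C > 0" "\<And>z. x1 \<le> Re z \<Longrightarrow> Re z \<le> x2 \<Longrightarrow> norm (Gamma z) \<le> C / (1 + (Im z)\<^sup>2)"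
proof -
  obtain C where C: "C > 0" "\<And>z. x1 + 2 \<le> Re z \<Longrightarrow> Re z \<le> x2 + 2 \<Longrightarrow> norm (Gamma z) \<le> C"
    using norm_Gamma_strip_le[of "x1 + 2" "x2 + 2"] assms by auto
  \<comment> \<open>Makes m (1 + y^2) \<le> x1^2 + y^2 \<le> |z|^2 for y = Im z, uniformly in the
    strip.\<close>
  define m where "m = min 1 (x1\<^sup>2)"
  have m: "m > 0" using assms by (simp add: m_def)
  have "norm (Gamma z) \<le> (C / m) / (1 + (Im z)\<^sup>2)" if z: "x1 \<le> Re z" "Re z \<le> x2" for z
  proof -
    have nz: "z \<notin> \<int>\<^sub>\<le>\<^sub>0" "z + 1 \<notin> \<int>\<^sub>\<le>\<^sub>0"
      using z assms by (auto elim!: nonpos_Ints_cases simp: complex_eq_iff)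
    have "Gamma (z + 2) = (z + 1) * (z * Gamma z)"
      using Gamma_plus1[OF nz(2)] Gamma_plus1[OF nz(1)] by (simp add: add.assoc)
    hence e: "norm (Gamma (z+2)) = (norm (z + 1) * norm z) * norm (Gamma z)"
      by (simp add: norm_mult)
    have "norm z \<le> norm (z + 1)"
      using z assms by (simp add: cmod_def power2_eq_square algebra_simps)
    hence "norm z * norm z \<le> norm (z + 1) * norm z" by (rule mult_right_mono) simp
    moreover have "norm z * norm z = (Re z)\<^sup>2 + (Im z)\<^sup>2" by (simp add: cmod_def)
    moreover have "x1\<^sup>2 \<le> (Re z)\<^sup>2" using z assms by (intro power_mono) auto
    moreover have "m * (1 + (Im z)\<^sup>2) \<le> x1\<^sup>2 + (Im z)\<^sup>2"
      unfolding m_def by (simp add: distrib_left add_mono mult_left_le_one_le)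
    ultimately have "m * (1 + (Im z)\<^sup>2) \<le> norm (z + 1) * norm z" by linarith
    hence "m * (1 + (Im z)\<^sup>2) * norm (Gamma z) \<le> norm (Gamma (z+2))"
      unfolding e by (rule mult_right_mono) simp
    also have "\<dots> \<le> C" using C(2)[of "z+2"] z by auto
    finally show ?thesis using m
      by (simp add: field_simps add_pos_nonneg)
  qed
  thus ?thesis using that[of "C / m"] C(1) m by auto
qed

section \<open>The continued quotient of \<Gamma>(w) and \<Gamma>(\<nu> w)\<close>

text \<open>The \<open>G\<close> of the overview. Functional equations in numerator and denominator
  lead from \<Gamma>(w) / \<Gamma>(\<nu> w) to this form: the factors w and \<nu> w cancel up to
  \<nu>, and with them the pole at w = 0.\<close>

definition gamma_quot :: "real \<Rightarrow> complex \<Rightarrow> complex" where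
  "gamma_quot \<nu> w = of_real \<nu> * Gamma (w + 1) * rGamma (of_real \<nu> * w + 1)"

lemma gamma_quot_eq:
  assumes "Re w > 0"
  shows "gamma_quot \<nu> w = Gamma w * rGamma (of_real \<nu> * w)"
proof -
  have "w \<notin> \<int>\<^sub>\<le>\<^sub>0" using assms by (auto elim!: nonpos_Ints_cases simp: complex_eq_iff)
  thus ?thesis
    using rGamma_plus1[of "of_real \<nu> * w"] Gamma_plus1[of w]
    by (simp add: gamma_quot_def mult_ac)
qed

lemma holomorphic_gamma_quot:
  "gamma_quot \<nu> holomorphic_on {w. Re w > -1}"
  unfolding gamma_quot_def
  by (intro holomorphic_intros) (auto elim!: nonpos_Ints_cases simp: complex_eq_iff)

lemma holomorphic_gamma_quot' [holomorphic_intros]: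
  assumes "f holomorphic_on A" "\<And>z. z \<in> A \<Longrightarrow> Re (f z) > -1"
  shows "(\<lambda>z. gamma_quot \<nu> (f z)) holomorphic_on A"
  using holomorphic_on_compose_gen[OF assms(1) holomorphic_gamma_quot[of \<nu>]] assms(2)
  by (auto simp: o_def image_subset_iff)

lemma norm_gamma_quot_le:
  assumes "0 < \<nu>" "\<nu> \<le> 1" "Re w > -1"
  shows "norm (gamma_quot \<nu> w) \<le> \<nu> * Gamma (Re w + 1) * rGamma (\<nu> * Re w + 1)"
  using norm_Gamma_scaled_le[of \<nu> 1 w] assms
  by (simp add: gamma_quot_def norm_mult mult.assoc)

text \<open>The majorant of \<open>norm_gamma_quot_le\<close> depends on Re w alone and is
  continuous on the compact interval of real parts.\<close>

lemma norm_gamma_quot_strip_le: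
  assumes "0 < \<nu>" "\<nu> \<le> 1" "x1 > -1"
  obtains C where "C > 0" "\<And>w. x1 \<le> Re w \<Longrightarrow> Re w \<le> x2 \<Longrightarrow> norm (gamma_quot \<nu> w) \<le> C"
proof -
  have "continuous_on {x1..x2} (\<lambda>x::real. \<nu> * Gamma (x + 1) * rGamma (\<nu> * x + 1))"
    using assms
    by (intro continuous_intros continuous_on_compose2[OF continuous_on_Gamma[of "{0<..}"]]
          continuous_on_compose2[OF continuous_on_rGamma[of UNIV]]) (auto elim!: nonpos_Ints_cases)
  then obtain C where C: "\<And>x. x \<in> {x1..x2} \<Longrightarrow> norm (\<nu> * Gamma (x + 1) * rGamma (\<nu> * x + 1)) \<le> C"
    by (metis (no_types, lifting) compact_Icc compact_continuous_image compact_imp_bounded bounded_iff imageI)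
  have "norm (gamma_quot \<nu> w) \<le> max C 1" if "x1 \<le> Re w" "Re w \<le> x2" for w
  proof -
    have "norm (gamma_quot \<nu> w) \<le> \<nu> * Gamma (Re w + 1) * rGamma (\<nu> * Re w + 1)"
      using that assms by (intro norm_gamma_quot_le) auto
    also have "\<dots> \<le> C" using C[of "Re w"] that by auto
    finally show ?thesis by simp
  qed
  thus ?thesis using that[of "max C 1"] by auto
qed

section \<open>Cauchy's integral formula on a vertical strip\<close>

lemma integrable_inverse_1_plus_square': "integrable lborel (\<lambda>t::real. C / (1 + t\<^sup>2))"
proof -
  have "integrable lborel (\<lambda>t::real. C * inverse (1 + t\<^sup>2))"
    using integrable_inverse_1_plus_square by (intro integrable_mult_right) (auto simp: set_integrable_def)
  thus ?thesis by (simp add: divide_inverse)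
qed

lemma integrable_lborel_inverse_square_bound:
  fixes f :: "real \<Rightarrow> complex"
  assumes "f \<in> borel_measurable borel" "\<And>t. norm (f t) \<le> C / (1 + t\<^sup>2)"
  shows "integrable lborel f"
proof (rule Bochner_Integration.integrable_bound)
  show "integrable lborel (\<lambda>t::real. C / (1 + t\<^sup>2))" by (rule integrable_inverse_1_plus_square')
  show "AE t in lborel. norm (f t) \<le> norm (C / (1 + t\<^sup>2))"
  proof (rule AE_I2)
    fix t :: real
    show "norm (f t) \<le> norm (C / (1 + t\<^sup>2))"
      by (rule order.trans[OF assms(2)]) (simp add: divide_right_mono)
  qed
qed (use assms in auto)

text \<open>Lets rectangles and loops of height R approximate integrals over the whole line, also
  when these converge only conditionally.\<close>

lemma has_integral_UNIV_tendsto: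
  fixes f :: "real \<Rightarrow> 'a::banach"
  assumes "(f has_integral I) UNIV"
  shows "((\<lambda>R. integral {-R..R} f) \<longlongrightarrow> I) at_top"
proof (rule tendstoI)
  fix e :: real assume "e > 0"
  then obtain B where B: "B > 0" "\<And>a b. ball 0 B \<subseteq> cbox a b \<Longrightarrow> norm (integral (cbox a b) f - I) < e"
    using assms unfolding has_integral_alt'[of f I UNIV] by auto
  have "dist (integral {-R..R} f) I < e" if "R \<ge> B" for R
  proof -
    have "ball 0 B \<subseteq> cbox (-R) R" using that by (auto simp: abs_less_iff)
    from B(2)[OF this] show ?thesis by (simp add: dist_norm)
  qed
  thus "\<forall>\<^sub>F R in at_top. dist (integral {-R..R} f) I < e"
    by (auto simp: eventually_at_top_linorder)
qed

lemma integrable_vertical_line: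
  fixes H :: "complex \<Rightarrow> complex"
  assumes "continuous_on {s. Re s = g} H" "\<And>s. Re s = g \<Longrightarrow> norm (H s) \<le> C / (1 + (Im s)\<^sup>2)"
  shows "integrable lborel (\<lambda>t. H (Complex g t))"
proof (rule integrable_lborel_inverse_square_bound)
  have "continuous_on UNIV (\<lambda>t. H (Complex g t))"
    by (intro continuous_on_compose2[OF assms(1)] continuous_intros) auto
  thus "(\<lambda>t. H (Complex g t)) \<in> borel_measurable borel"
    by (rule borel_measurable_continuous_onI)
  show "norm (H (Complex g t)) \<le> C / (1 + t\<^sup>2)" for t
    using assms(2)[of "Complex g t"] by simp
qed

lemma norm_divide_vertical_le:
  assumes "\<And>s. Re s = g \<Longrightarrow> norm (H s) \<le> C / (1 + (Im s)\<^sup>2)" "g \<noteq> Re p" "Re s = g"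
  shows "norm (H s / (s - p)) \<le> (C / \<bar>g - Re p\<bar>) / (1 + (Im s)\<^sup>2)"
proof -
  have "\<bar>g - Re p\<bar> \<le> norm (s - p)" using abs_Re_le_cmod[of "s - p"] assms by simp
  hence "norm (H s) / norm (s - p) \<le> (C / (1 + (Im s)\<^sup>2)) / \<bar>g - Re p\<bar>"
    using assms by (intro frac_le order.trans[OF norm_ge_zero assms(1)]) auto
  thus ?thesis by (simp add: norm_divide field_simps)
qed

lemma integrable_vertical_line_divide:
  fixes H :: "complex \<Rightarrow> complex"
  assumes "continuous_on {s. Re s = g} H" "\<And>s. Re s = g \<Longrightarrow> norm (H s) \<le> C / (1 + (Im s)\<^sup>2)"
    and "g \<noteq> Re p"
  shows "integrable lborel (\<lambda>t. H (Complex g t) / (Complex g t - p))"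
proof (rule integrable_vertical_line[of g "\<lambda>s. H s / (s - p)"])
  show "continuous_on {s. Re s = g} (\<lambda>s. H s / (s - p))"
    using assms by (intro continuous_intros) auto
qed (rule norm_divide_vertical_le[OF assms(2,3)])

text \<open>Cauchy's formula on the rectangle with sides Re s = g1, Re s = g2 and |Im s| = R. The
  horizontal sides contribute O(1/R), because there H is bounded by C and |s - p| \<ge> R - |Im p|.
  The factor \<i> of ds = \<i> dt cancels.\<close>

lemma Cauchy_integral_formula_strip:
  fixes H :: "complex \<Rightarrow> complex"
  assumes hol: "H holomorphic_on {s. g1 \<le> Re s \<and> Re s \<le> g2}"
    and p: "g1 < Re p" "Re p < g2"
    and bound: "\<And>s. g1 \<le> Re s \<Longrightarrow> Re s \<le> g2 \<Longrightarrow> norm (H s) \<le> C / (1 + (Im s)\<^sup>2)"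
  shows "(\<integral>t. H (Complex g2 t) / (Complex g2 t - p) \<partial>lborel)
       - (\<integral>t. H (Complex g1 t) / (Complex g1 t - p) \<partial>lborel) = 2 * pi * H p"
proof -
  define S where "S = {s. g1 \<le> Re s \<and> Re s \<le> g2}"
  define F where "F = (\<lambda>s. H s / (s - p))"
  have cont: "continuous_on S H"
    using hol unfolding S_def by (rule holomorphic_on_imp_continuous_on)
  have contF: "continuous_on A F" if "A \<subseteq> S - {p}" for A
    unfolding F_def using that by (intro continuous_intros continuous_on_subset[OF cont]) auto
  have "convex S"
    unfolding S_def Collect_conj_eq by (intro convex_Int convex_halfspace_Re_ge convex_halfspace_Re_le)
  have "{s. g1 < Re s} \<inter> {s. Re s < g2} \<subseteq> interior S"
    by (intro interior_maximal open_Int open_halfspace_Re_gt open_halfspace_Re_lt) (auto simp: S_def)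
  hence pint: "p \<in> interior S" using p by auto
  have "C \<ge> 0"
    using order.trans[OF norm_ge_zero bound[of p]] p
    by (simp add: zero_le_divide_iff) (smt (verit) zero_le_power2)
  have lim: "((\<lambda>R. integral {-R..R} (\<lambda>t. F (Complex g t))) \<longlongrightarrow> (\<integral>t. F (Complex g t) \<partial>lborel)) at_top"
    if "g = g1 \<or> g = g2" for g
    unfolding F_def
    by (intro has_integral_UNIV_tendsto has_integral_integral_lborel
              integrable_vertical_line_divide[where C = C] continuous_on_subset[OF cont] bound)
       (use that p in \<open>auto simp: S_def\<close>)
  \<comment> \<open>The two horizontal sides, oriented as in the counterclockwise rectangle.\<close>
  define h where "h = (\<lambda>R. contour_integral (linepath (Complex g1 (-R)) (Complex g2 (-R))) F
                         + contour_integral (linepath (Complex g2 R) (Complex g1 R)) F)"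
  have main: "\<i> * (integral {-R..R} (\<lambda>t. F (Complex g2 t)) - integral {-R..R} (\<lambda>t. F (Complex g1 t))) + h R
      = 2 * pi * \<i> * H p" if R: "R > \<bar>Im p\<bar>" for R
  proof -
    let ?a = "Complex g1 (-R)" and ?b = "Complex g2 (-R)" and ?c = "Complex g2 R" and ?d = "Complex g1 R"
    have rp: "rectpath ?a ?c = linepath ?a ?b +++ linepath ?b ?c +++ linepath ?c ?d +++ linepath ?d ?a"
      by (simp add: rectpath_def Let_def)
    have pbox: "p \<in> box ?a ?c" using p R by (auto simp: in_box_complex_iff)
    have pi: "path_image (rectpath ?a ?c) \<subseteq> S - {p}"
    proof -
      have "path_image (rectpath ?a ?c) \<subseteq> cbox ?a ?c"
        by (rule path_image_rectpath_subset_cbox) (use p R in auto)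
      moreover have "path_image (rectpath ?a ?c) \<inter> box ?a ?c = {}"
        by (rule path_image_rectpath_inter_box) (use p R in auto)
      moreover have "cbox ?a ?c \<subseteq> S" by (auto simp: S_def in_cbox_complex_iff)
      ultimately show ?thesis using pbox by blast
    qed
    have sub: "closed_segment ?a ?b \<subseteq> S - {p}" "closed_segment ?b ?c \<subseteq> S - {p}"
        "closed_segment ?c ?d \<subseteq> S - {p}" "closed_segment ?d ?a \<subseteq> S - {p}"
      using pi by (auto simp: rp path_image_join)
    have int: "F contour_integrable_on linepath ?a ?b" "F contour_integrable_on linepath ?b ?c"
        "F contour_integrable_on linepath ?c ?d" "F contour_integrable_on linepath ?d ?a"
      by (intro contour_integrable_continuous_linepath contF sub)+
    have "(F has_contour_integral (2*pi * \<i> * winding_number (rectpath ?a ?c) p * H p)) (rectpath ?a ?c)"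
      unfolding F_def
      by (rule Cauchy_integral_formula_convex_simple[OF \<open>convex S\<close> _ pint _ pi]) (use hol in \<open>auto simp: S_def\<close>)
    hence "contour_integral (rectpath ?a ?c) F = 2*pi * \<i> * H p"
      using winding_number_rectpath[OF pbox] by (simp add: contour_integral_unique)
    moreover have "contour_integral (rectpath ?a ?c) F =
        contour_integral (linepath ?a ?b) F + contour_integral (linepath ?b ?c) F
         + contour_integral (linepath ?c ?d) F + contour_integral (linepath ?d ?a) F"
      unfolding rp using int by simp
    moreover have "contour_integral (linepath ?b ?c) F = \<i> * integral {-R..R} (\<lambda>t. F (Complex g2 t))"
      using R by (intro contour_integral_linepath_same_Re) auto
    moreover have "contour_integral (linepath ?d ?a) F = - (\<i> * integral {-R..R} (\<lambda>t. F (Complex g1 t)))"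
    proof -
      have "contour_integral (linepath ?a ?d) F = \<i> * integral {-R..R} (\<lambda>t. F (Complex g1 t))"
        using R by (intro contour_integral_linepath_same_Re) auto
      moreover have "contour_integral (linepath ?d ?a) F = - contour_integral (linepath ?a ?d) F"
        by (intro contour_integral_reverse_linepath contF sub)
      ultimately show ?thesis by simp
    qed
    ultimately show ?thesis by (simp add: h_def algebra_simps)
  qed
  \<comment> \<open>The unordered pair \<open>{a, b}\<close> covers both orientations and both
    heights; only the length g2 - g1 enters.\<close>
  have hb: "norm (contour_integral (linepath a b) F) \<le> C / (R - \<bar>Im p\<bar>) * (g2 - g1)"
    if R: "R > \<bar>Im p\<bar>" and ab: "{a, b} = {Complex g1 y, Complex g2 y}" and y: "\<bar>y\<bar> = R" for a b y R
  proof -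
    have seg: "closed_segment a b = closed_segment (Complex g1 y) (Complex g2 y)"
      using ab by (auto simp: doubleton_eq_iff closed_segment_commute)
    have xs: "Im x = y \<and> g1 \<le> Re x \<and> Re x \<le> g2" if "x \<in> closed_segment a b" for x
      using that p unfolding seg by (auto simp: closed_segment_same_Im closed_segment_eq_real_ivl)
    have "norm (contour_integral (linepath a b) F) \<le> C / (R - \<bar>Im p\<bar>) * norm (b - a)"
    proof (rule contour_integral_bound_linepath)
      show "F contour_integrable_on linepath a b"
        using xs R y by (intro contour_integrable_continuous_linepath contF) (force simp: S_def)
      show "0 \<le> C / (R - \<bar>Im p\<bar>)" using \<open>C \<ge> 0\<close> R by simp
      fix x assume "x \<in> closed_segment a b"
      note x = xs[OF this]
      have "norm (H x) \<le> C / (1 + (Im x)\<^sup>2)" using bound x by auto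
      also have "\<dots> \<le> C / 1" using \<open>C \<ge> 0\<close> by (intro divide_left_mono) (auto simp: add_pos_nonneg)
      finally have "norm (H x) \<le> C" by simp
      moreover have "R - \<bar>Im p\<bar> \<le> norm (x - p)"
        using abs_Im_le_cmod[of "x - p"] x y by auto
      ultimately show "norm (F x) \<le> C / (R - \<bar>Im p\<bar>)"
        unfolding F_def norm_divide using R \<open>C \<ge> 0\<close> by (intro frac_le) auto
    qed
    also have "norm (b - a) = g2 - g1"
      using ab p by (auto simp: doubleton_eq_iff cmod_def)
    finally show ?thesis .
  qed
  have "(h \<longlongrightarrow> 0) at_top"
  proof (rule Lim_null_comparison)
    show "((\<lambda>R. 2 * (C * (g2 - g1)) / (R - \<bar>Im p\<bar>)) \<longlongrightarrow> 0) at_top"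
      by real_asymp
    show "\<forall>\<^sub>F R in at_top. norm (h R) \<le> 2 * (C * (g2 - g1)) / (R - \<bar>Im p\<bar>)"
      using eventually_gt_at_top[of "\<bar>Im p\<bar>"]
    proof eventually_elim
      case (elim R)
      define B where "B = C / (R - \<bar>Im p\<bar>) * (g2 - g1)"
      have R: "R > 0" using elim by linarith
      have "norm (contour_integral (linepath (Complex g1 (-R)) (Complex g2 (-R))) F) \<le> B"
        unfolding B_def by (rule hb[OF elim refl]) (use R in simp)
      moreover have "norm (contour_integral (linepath (Complex g2 R) (Complex g1 R)) F) \<le> B"
        unfolding B_def by (rule hb[OF elim insert_commute]) (use R in simp)
      ultimately have "norm (h R) \<le> 2 * B"
        unfolding h_def using norm_triangle_le[of _ _ "2 * B"] by force
      thus ?case by (simp add: B_def mult.assoc)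
    qed
  qed
  with lim[of g1] lim[of g2]
  have "((\<lambda>R. \<i> * (integral {-R..R} (\<lambda>t. F (Complex g2 t)) - integral {-R..R} (\<lambda>t. F (Complex g1 t))) + h R)
      \<longlongrightarrow> \<i> * ((\<integral>t. F (Complex g2 t) \<partial>lborel) - (\<integral>t. F (Complex g1 t) \<partial>lborel)) + 0) at_top"
    by (intro tendsto_intros) auto
  moreover have "((\<lambda>R. \<i> * (integral {-R..R} (\<lambda>t. F (Complex g2 t)) - integral {-R..R} (\<lambda>t. F (Complex g1 t))) + h R)
      \<longlongrightarrow> 2 * pi * \<i> * H p) at_top"
    by (rule tendsto_eventually, rule eventually_mono[OF eventually_gt_at_top[of "\<bar>Im p\<bar>"]], rule main)
  ultimately have "\<i> * ((\<integral>t. F (Complex g2 t) \<partial>lborel) - (\<integral>t. F (Complex g1 t) \<partial>lborel)) + 0 = 2 * pi * \<i> * H p"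
    by (intro tendsto_unique) auto
  hence "\<i> * ((\<integral>t. F (Complex g2 t) \<partial>lborel) - (\<integral>t. F (Complex g1 t) \<partial>lborel)) = \<i> * (2 * pi * H p)"
    by (simp add: mult_ac)
  thus ?thesis unfolding F_def by simp
qed

section \<open>The Mellin-Barnes integral of the three-parameter Mittag-Leffler function\<close>

text \<open>Keep the part [K, \<infinity>) of Euler's integral and bound t^(u-1) from below by
  K^(u-1) there. As K is free, 1 / \<Gamma>(u) beats every geometric sequence, a substitute for
  Stirling's formula.\<close>

lemma Gamma_real_lower_bound:
  fixes u K :: real
  assumes "u \<ge> 1" "K > 0"
  shows "K powr (u - 1) * exp (-K) \<le> Gamma u"
proof -
  have "((\<lambda>t. exp (- 1 * t)) has_integral exp (- 1 * K) / 1) {K..}"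
    by (rule has_integral_exp_minus_to_infinity) simp
  from has_integral_mult_right[OF this, of "K powr (u - 1)"]
  have "((\<lambda>t. K powr (u - 1) * exp (-t)) has_integral K powr (u - 1) * exp (-K)) {K..}" by simp
  hence "((\<lambda>t. if t \<in> {K..} then K powr (u - 1) * exp (-t) else 0) has_integral K powr (u - 1) * exp (-K)) {0..}"
    using assms by (subst has_integral_restrict) auto
  moreover have "((\<lambda>t. t powr (u - 1) / exp t) has_integral Gamma u) {0..}"
    using assms by (intro Gamma_integral_real) auto
  moreover have "(if t \<in> {K..} then K powr (u - 1) * exp (-t) else 0) \<le> t powr (u - 1) / exp t" for t
    using assms by (auto simp: exp_minus divide_inverse intro!: mult_right_mono powr_mono2)
  ultimately show ?thesis by (rule has_integral_le)
qed

text \<open>The constant 1 / \<Gamma>(a) of the Mellin-Barnes integrand is left out. In Re s < a + 1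
  the only possible poles are those of \<Gamma>(s).\<close>

definition mb_kernel :: "real \<Rightarrow> real \<Rightarrow> complex \<Rightarrow> complex" where
  "mb_kernel \<nu> a s = Gamma s * gamma_quot \<nu> (of_real a - s)"

lemma holomorphic_mb_kernel:
  assumes "\<And>s. s \<in> A \<Longrightarrow> 0 < Re s \<and> Re s < a + 1"
  shows "mb_kernel \<nu> a holomorphic_on A"
  unfolding mb_kernel_def
  by (intro holomorphic_intros) (use assms in \<open>force elim!: nonpos_Ints_cases simp: complex_eq_iff\<close>)+

lemma mb_kernel_decay:
  assumes "0 < \<nu>" "\<nu> \<le> 1" "0 < g1" "g2 < a + 1"
  obtains C where "C > 0" "\<And>s. g1 \<le> Re s \<Longrightarrow> Re s \<le> g2 \<Longrightarrow> norm (mb_kernel \<nu> a s) \<le> C / (1 + (Im s)\<^sup>2)"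
proof -
  obtain C1 where C1: "C1 > 0" "\<And>z. g1 \<le> Re z \<Longrightarrow> Re z \<le> g2 \<Longrightarrow> norm (Gamma z) \<le> C1 / (1 + (Im z)\<^sup>2)"
    using norm_Gamma_decay[OF assms(3), of g2] by blast
  obtain C2 where C2: "C2 > 0" "\<And>w. a - g2 \<le> Re w \<Longrightarrow> Re w \<le> a - g1 \<Longrightarrow> norm (gamma_quot \<nu> w) \<le> C2"
    using norm_gamma_quot_strip_le[OF assms(1,2), of "a - g2" "a - g1"] assms by auto
  have "norm (mb_kernel \<nu> a s) \<le> (C1 * C2) / (1 + (Im s)\<^sup>2)" if "g1 \<le> Re s" "Re s \<le> g2" for s
  proof -
    have "norm (mb_kernel \<nu> a s) \<le> C1 / (1 + (Im s)\<^sup>2) * C2"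
      unfolding mb_kernel_def norm_mult using that C1 C2
      by (intro mult_mono) (auto intro!: divide_nonneg_nonneg less_imp_le)
    thus ?thesis by simp
  qed
  thus ?thesis using that[of "C1 * C2"] C1(1) C2(1) by auto
qed

lemma norm_of_real_powr: "x > 0 \<Longrightarrow> norm (of_real x powr s :: complex) = x powr Re s"
  by (simp add: norm_powr_real_powr)

lemma pochhammer_Gamma_shift:
  fixes s :: complex
  assumes "s \<notin> \<int>\<^sub>\<le>\<^sub>0"
  shows "Gamma s = Gamma (s + of_nat n) / pochhammer s n"
proof -
  have "Gamma s \<noteq> 0" using assms by (simp add: Gamma_eq_zero_iff)
  moreover have "s + of_nat n \<notin> \<int>\<^sub>\<le>\<^sub>0"
  proof
    assume "s + of_nat n \<in> \<int>\<^sub>\<le>\<^sub>0"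
    then obtain m where "s + of_nat n = - of_nat m" by (auto elim!: nonpos_Ints_cases')
    hence "s = - of_nat (m + n)" by (simp add: algebra_simps eq_neg_iff_add_eq_0)
    with assms show False by blast
  qed
  hence "Gamma (s + of_nat n) \<noteq> 0" by (simp add: Gamma_eq_zero_iff)
  ultimately show ?thesis
    using pochhammer_Gamma[OF assms, of n] by simp
qed

lemma norm_pochhammer_lower:
  assumes "Re s + of_nat k - 1 \<le> - d" "d > 0"
  shows "norm (pochhammer s k) \<ge> d ^ k"
proof -
  have "d ^ k = (\<Prod>j\<in>{0..<k}. d)" by simp
  also have "\<dots> \<le> (\<Prod>j\<in>{0..<k}. norm (s + of_nat j))"
  proof (rule prod_mono)
    fix j assume "j \<in> {0..<k}"
    hence "d \<le> \<bar>Re (s + of_nat j)\<bar>" using assms by auto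
    thus "0 \<le> d \<and> d \<le> norm (s + of_nat j)"
      using assms abs_Re_le_cmod[of "s + of_nat j"] by linarith
  qed
  also have "\<dots> = norm (pochhammer s k)" by (simp add: pochhammer_prod prod_norm)
  finally show ?thesis .
qed

text \<open>By \<Gamma>(s) = \<Gamma>(s+k+1) / ((s)_k (s+k)) the integrand is H(s) / (s - p) with p
  = -k and \<open>H\<close> regular on the strip, so the strip formula yields 2 \<pi> times the
  residue H(p), where (-k)_k = (-1)^k k!. For k \<ge> 1 the right line must stay left of the next
  pole 1 - k; for k = 0 there is none up to a + 1.\<close>

lemma mb_kernel_cross_pole:
  fixes k :: nat
  assumes \<nu>: "0 < \<nu>" "\<nu> \<le> 1" and "a > 0" "x > 0"
    and g1: "- real k - 1 < g1" "g1 < - real k" and g2: "- real k < g2" "g2 < a + 1" "k = 0 \<or> g2 < 1 - real k"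
  shows "(\<integral>t. mb_kernel \<nu> a (Complex g2 t) * of_real x powr (- Complex g2 t) \<partial>lborel)
       - (\<integral>t. mb_kernel \<nu> a (Complex g1 t) * of_real x powr (- Complex g1 t) \<partial>lborel)
       = 2 * pi * ((-1) ^ k / fact k * gamma_quot \<nu> (of_real a + of_nat k) * of_real x ^ k)"
proof -
  define H where "H = (\<lambda>s. Gamma (s + of_nat (Suc k)) / pochhammer s k * gamma_quot \<nu> (of_real a - s) * of_real x powr (-s))"
  define p :: complex where "p = - of_nat k"
  \<comment> \<open>Distance from the strip to 1 - k, the nearest zero of
    \<open>pochhammer s k\<close>; for k = 0 the product is empty and any positive value
    works.\<close>
  define d where "d = (if k = 0 then 1 else 1 - real k - g2)"
  have d: "d > 0" using g2 by (auto simp: d_def)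
  have poch: "norm (pochhammer s k) \<ge> d ^ k" if "Re s \<le> g2" for s
  proof (cases "k = 0")
    case False
    thus ?thesis using d that by (intro norm_pochhammer_lower) (auto simp: d_def)
  qed auto
  hence poch0: "pochhammer s k \<noteq> 0" if "Re s \<le> g2" for s
    using that d by (metis norm_zero not_less zero_less_power)
  have nI: "s + of_nat (Suc k) \<notin> \<int>\<^sub>\<le>\<^sub>0" if "g1 \<le> Re s" for s
  proof
    assume "s + of_nat (Suc k) \<in> \<int>\<^sub>\<le>\<^sub>0"
    then obtain m where "s + of_nat (Suc k) = - of_nat m" by (auto elim!: nonpos_Ints_cases')
    hence "Re (s + of_nat (Suc k)) = - real m" by simp
    thus False using that g1 by auto
  qed
  have hol: "H holomorphic_on {s. g1 \<le> Re s \<and> Re s \<le> g2}"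
    unfolding H_def pochhammer_prod
    by (intro holomorphic_intros)
       (use nI poch0 g2 \<open>x > 0\<close> in \<open>auto simp: pochhammer_prod\<close>)
  obtain C1 where C1: "C1 > 0" "\<And>z. g1 + real (Suc k) \<le> Re z \<Longrightarrow> Re z \<le> g2 + real (Suc k) \<Longrightarrow> norm (Gamma z) \<le> C1 / (1 + (Im z)\<^sup>2)"
    using norm_Gamma_decay[of "g1 + real (Suc k)" "g2 + real (Suc k)"] g1 by auto
  obtain C2 where C2: "C2 > 0" "\<And>w. a - g2 \<le> Re w \<Longrightarrow> Re w \<le> a - g1 \<Longrightarrow> norm (gamma_quot \<nu> w) \<le> C2"
    using norm_gamma_quot_strip_le[OF \<nu>, of "a - g2" "a - g1"] g2 by auto
  \<comment> \<open>x^(-y) is monotone in y, in a direction that depends on whether x \<ge> 1, so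
    one endpoint of the strip dominates.\<close>
  define C3 where "C3 = max (x powr (-g1)) (x powr (-g2))"
  have C3: "x powr (-y) \<le> C3" if "g1 \<le> y" "y \<le> g2" for y
  proof (cases "x \<ge> 1")
    case True
    thus ?thesis using that by (auto simp: C3_def le_max_iff_disj intro!: disjI1 powr_mono)
  next
    case False
    thus ?thesis using that \<open>x > 0\<close> by (auto simp: C3_def le_max_iff_disj intro!: disjI2 powr_mono')
  qed
  have bound: "norm (H s) \<le> (C1 / d ^ k * C2 * C3) / (1 + (Im s)\<^sup>2)" if s: "g1 \<le> Re s" "Re s \<le> g2" for s
  proof -
    have "norm (Gamma (s + of_nat (Suc k))) \<le> C1 / (1 + (Im s)\<^sup>2)"
      using C1(2)[of "s + of_nat (Suc k)"] s by simp
    hence "norm (H s) \<le> (C1 / (1 + (Im s)\<^sup>2)) / d ^ k * C2 * C3"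
      unfolding H_def norm_mult norm_divide norm_of_real_powr[OF \<open>x > 0\<close>]
      using C1 C2 C3[of "Re s"] s poch[of s] d
      by (intro mult_mono frac_le) (auto intro!: divide_nonneg_nonneg mult_nonneg_nonneg less_imp_le)
    thus ?thesis by (simp add: field_simps)
  qed
  have eq: "mb_kernel \<nu> a s * of_real x powr (-s) = H s / (s - p)"
    if s: "g1 \<le> Re s" "Re s \<le> g2" "Re s \<noteq> - real k" for s
  proof -
    have "s \<notin> \<int>\<^sub>\<le>\<^sub>0"
    proof
      assume "s \<in> \<int>\<^sub>\<le>\<^sub>0"
      then obtain m where m: "s = - of_nat m" by (auto elim!: nonpos_Ints_cases')
      have "m < Suc k" using m s g1 by simp
      moreover have "m \<noteq> k" using s m by auto
      ultimately have "m < k" by simp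
      hence "pochhammer s k = 0" unfolding m by (auto simp: pochhammer_of_nat_eq_0_iff)
      thus False using poch0 s by auto
    qed
    hence "Gamma s = Gamma (s + of_nat (Suc k)) / pochhammer s (Suc k)"
      by (rule pochhammer_Gamma_shift)
    also have "pochhammer s (Suc k) = pochhammer s k * (s - p)"
      by (simp add: pochhammer_Suc p_def)
    finally show ?thesis unfolding mb_kernel_def H_def by (simp add: field_simps)
  qed
  have "(\<integral>t. H (Complex g2 t) / (Complex g2 t - p) \<partial>lborel)
       - (\<integral>t. H (Complex g1 t) / (Complex g1 t - p) \<partial>lborel) = 2 * pi * H p"
    by (rule Cauchy_integral_formula_strip[OF hol _ _ bound]) (use g1 g2 in \<open>auto simp: p_def\<close>)
  moreover have "H p = (-1) ^ k / fact k * gamma_quot \<nu> (of_real a + of_nat k) * of_real x ^ k"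
  proof -
    have "of_real x powr of_nat k = (of_real x ^ k :: complex)"
      using \<open>x > 0\<close> by (simp add: powr_nat' )
    moreover have "pochhammer (- of_nat k :: complex) k = (-1) ^ k * fact k"
      by (simp add: pochhammer_same)
    ultimately show ?thesis
      by (simp add: H_def p_def field_simps) 
  qed
  ultimately show ?thesis using g1 g2 by (simp add: eq)
qed

text \<open>Factor by factor, a + 3/2 + j \<le> (1 + a) (3/2 + j). Hence the Pochhammer quotient in
  the remainder grows at most geometrically.\<close>

lemma pochhammer_ratio_le:
  fixes a :: real
  assumes "a \<ge> 0"
  shows "pochhammer (a + 3/2) N \<le> (1 + a) ^ N * pochhammer (3/2) N"
proof (induction N)
  case (Suc N)
  have "a + 3/2 + real N \<le> (1 + a) * (3/2 + real N)"
  proof -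
    have "0 \<le> a * real N" using assms by simp
    moreover have "(1 + a) * (3/2 + real N) = 3/2 + real N + 3/2 * a + a * real N"
      by (simp add: algebra_simps add_divide_distrib)
    ultimately show ?thesis using assms by linarith
  qed
  hence "pochhammer (a + 3/2) N * (a + 3/2 + real N)
      \<le> ((1 + a) ^ N * pochhammer (3/2) N) * ((1 + a) * (3/2 + real N))"
    using Suc assms by (intro mult_mono) (auto intro!: mult_nonneg_nonneg pochhammer_nonneg)
  thus ?case by (simp add: pochhammer_Suc mult_ac)
qed auto

text \<open>Up to a constant this bounds the integral over Re s = -N - 1/2. x^N and the Pochhammer
  quotient grow at most like (x (1+a))^N, and the reciprocal Gamma value outweighs any geometric
  growth, so x may be arbitrarily large.\<close>

lemma mb_remainder_tendsto_0:
  assumes "0 < \<nu>" "a > 0" "x > 0"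
  shows "(\<lambda>N. x powr (real N + 1/2) * (\<nu> * Gamma (a + real N + 3/2) * rGamma (\<nu> * (a + real N + 1/2) + 1))
            / pochhammer (1/2) (Suc N)) \<longlonglongrightarrow> 0"
proof (rule Lim_null_comparison)
  \<comment> \<open>Chosen so that K^(-\<nu> N) = (2 x (1+a))^(-N), which cancels the growth and
    leaves (1/2)^N.\<close>
  define K where "K = (2 * x * (1 + a)) powr (1 / \<nu>)"
  define B where "B = 2 * \<nu> * x powr (1/2) * Gamma (a + 3/2) * exp K * K powr (- (\<nu> * (a + 1/2)))"
  have K: "K > 0" using assms by (simp add: K_def)
  show "(\<lambda>N. B * (1/2) ^ N) \<longlonglongrightarrow> 0"
    by (intro tendsto_mult_right_zero LIMSEQ_power_zero) auto
  show "\<forall>\<^sub>F N in sequentially. norm (x powr (real N + 1/2) * (\<nu> * Gamma (a + real N + 3/2) * rGamma (\<nu> * (a + real N + 1/2) + 1))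
            / pochhammer (1/2) (Suc N)) \<le> B * (1/2) ^ N"
  proof (rule always_eventually, rule allI)
    fix N
    define u where "u = \<nu> * (a + real N + 1/2) + 1"
    have u: "u \<ge> 1" using assms by (simp add: u_def)
    have G: "Gamma (a + real N + 3/2) = pochhammer (a + 3/2) N * Gamma (a + 3/2)"
    proof -
      have "a + 3/2 \<notin> \<int>\<^sub>\<le>\<^sub>0" using assms by (auto elim!: nonpos_Ints_cases)
      hence "pochhammer (a + 3/2) N = Gamma (a + 3/2 + real N) / Gamma (a + 3/2)"
        by (rule pochhammer_Gamma)
      moreover have "Gamma (a + 3/2) > 0" using assms by (intro Gamma_real_pos) auto
      ultimately show ?thesis by (simp add: algebra_simps)
    qed
    have "K powr (u - 1) * exp (-K) \<le> Gamma u" by (rule Gamma_real_lower_bound[OF u K])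
    hence "inverse (Gamma u) \<le> inverse (K powr (u - 1) * exp (-K))"
      using K by (intro le_imp_inverse_le) auto
    also have "\<dots> = exp K * K powr (- (u - 1))"
      using powr_minus[of K "u - 1"] by (simp add: exp_minus)
    also have "- (u - 1) = - (\<nu> * (a + 1/2)) + (- \<nu> * real N)"
      by (simp add: u_def algebra_simps)
    also have "K powr \<dots> = K powr (- (\<nu> * (a + 1/2))) * K powr (- \<nu> * real N)"
      by (rule powr_add)
    also have "K powr (- \<nu> * real N) = (2 * x * (1 + a)) powr (- real N)"
      unfolding K_def powr_powr using assms by simp
    also have "\<dots> = 1 / (2 * x * (1 + a)) ^ N"
      using assms by (simp add: powr_minus powr_realpow inverse_eq_divide)
    finally have rG: "rGamma u \<le> exp K * (K powr (- (\<nu> * (a + 1/2))) * (1 / (2 * x * (1 + a)) ^ N))"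
      by (simp add: rGamma_inverse_Gamma)
    have rG0: "rGamma u \<ge> 0"
      using u Gamma_real_pos[of u] by (simp add: rGamma_inverse_Gamma)
    have G0: "Gamma (a + 3/2) > 0" using assms by (intro Gamma_real_pos) auto
    have P0: "pochhammer (3/2 :: real) N > 0" by (intro pochhammer_pos) auto
    \<comment> \<open>The factor 1/2 split off here is the origin of the 2 in
      \<open>B\<close>.\<close>
    have P1: "pochhammer (1/2) (Suc N) = 1/2 * pochhammer (3/2 :: real) N"
      by (simp add: pochhammer_rec)
    have Q0: "pochhammer (a + 3/2) N \<ge> 0" using assms by (intro pochhammer_nonneg) auto
    have "x powr (real N + 1/2) * (\<nu> * Gamma (a + real N + 3/2) * rGamma u) / pochhammer (1/2) (Suc N)
        = (2 * \<nu> * x powr (1/2) * Gamma (a + 3/2)) * x ^ N * (pochhammer (a + 3/2) N / pochhammer (3/2) N) * rGamma u"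
      unfolding G P1 using assms by (simp add: powr_add powr_realpow)
    also have "\<dots> \<le> (2 * \<nu> * x powr (1/2) * Gamma (a + 3/2)) * x ^ N * (1 + a) ^ N *
        (exp K * (K powr (- (\<nu> * (a + 1/2))) * (1 / (2 * x * (1 + a)) ^ N)))"
      using pochhammer_ratio_le[of a N] assms P0 Q0 G0 rG0
      by (intro mult_mono rG mult_left_mono) (auto simp: divide_le_eq intro!: mult_nonneg_nonneg)
    also have "\<dots> = B * (1/2) ^ N"
      unfolding B_def using assms by (simp add: power_mult_distrib power_divide)
    finally have "x powr (real N + 1/2) * (\<nu> * Gamma (a + real N + 3/2) * rGamma u) / pochhammer (1/2) (Suc N) \<le> B * (1/2) ^ N" .
    moreover have "x powr (real N + 1/2) * (\<nu> * Gamma (a + real N + 3/2) * rGamma u) / pochhammer (1/2) (Suc N) \<ge> 0"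
      unfolding G P1 using assms P0 Q0 G0 rG0 by (intro divide_nonneg_nonneg mult_nonneg_nonneg) auto
    ultimately show "norm (x powr (real N + 1/2) * (\<nu> * Gamma (a + real N + 3/2) * rGamma (\<nu> * (a + real N + 1/2) + 1))
            / pochhammer (1/2) (Suc N)) \<le> B * (1/2) ^ N"
      unfolding u_def by simp
  qed
qed

text \<open>Moving the line to the left past s = 0, -1, ..., 1 - N collects the first N terms of the
  series, and the remaining integral tends to 0. Convergence of the series is a by-product, so the
  infinite sum in \<open>mittag_leffler3\<close> is a genuine limit.\<close>

lemma mittag_leffler3_Mellin_Barnes:
  assumes \<nu>: "0 < \<nu>" "\<nu> \<le> 1" and "a > 0" "x > 0" and g: "0 < g" "g < a + 1"
  shows "complex_of_real (mittag_leffler3 \<nu> (\<nu> * a) a (-x)) =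
           1 / (2 * pi * Gamma a) * (\<integral>t. mb_kernel \<nu> a (Complex g t) * of_real x powr (- Complex g t) \<partial>lborel)"
proof -
  define J where "J = (\<lambda>h. \<integral>t. mb_kernel \<nu> a (Complex h t) * of_real x powr (- Complex h t) \<partial>lborel)"
  \<comment> \<open>Start on Re s = g, then continue halfway between consecutive poles:
    \<open>h (Suc m)\<close> lies between -m-1 and -m.\<close>
  define h :: "nat \<Rightarrow> real" where "h = (\<lambda>k. case k of 0 \<Rightarrow> g | Suc m \<Rightarrow> - real m - 1/2)"
  define u :: "nat \<Rightarrow> complex" where "u = (\<lambda>k. (-1) ^ k / fact k * gamma_quot \<nu> (of_real a + of_nat k) * of_real x ^ k)"
  have step: "J (h k) - J (h (Suc k)) = 2 * pi * u k" for k
    unfolding J_def u_def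
    by (rule mb_kernel_cross_pole[OF \<nu> \<open>a > 0\<close> \<open>x > 0\<close>])
       (use g \<open>a > 0\<close> in \<open>auto simp: h_def split: nat.splits\<close>)
  have sum: "(\<Sum>k<N. 2 * pi * u k) = J g - J (h N)" for N
  proof -
    have "(\<Sum>k<N. 2 * pi * u k) = (\<Sum>k<N. J (h k) - J (h (Suc k)))" by (simp add: step)
    also have "\<dots> = J (h 0) - J (h N)" by (rule sum_lessThan_telescope')
    finally show ?thesis by (simp add: h_def)
  qed
  \<comment> \<open>The shift by N + 1 takes Re s = -N - 1/2 to Re s = 1/2 for every N, so one
    constant serves all remainders.\<close>
  obtain C where C: "C > 0" "\<And>z. 1/2 \<le> Re z \<Longrightarrow> Re z \<le> 1/2 \<Longrightarrow> norm (Gamma z) \<le> C / (1 + (Im z)\<^sup>2)"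
    using norm_Gamma_decay[of "1/2" "1/2"] by auto
  define D where "D = (\<integral>t. C / (1 + t\<^sup>2) \<partial>lborel)"
  define R where "R = (\<lambda>N. x powr (real N + 1/2) * (\<nu> * Gamma (a + real N + 3/2) * rGamma (\<nu> * (a + real N + 1/2) + 1))
            / pochhammer (1/2) (Suc N))"
  have JR: "norm (J (h (Suc N))) \<le> D * R N" for N
  proof -
    have P0: "pochhammer (1/2 :: real) (Suc N) > 0" by (intro pochhammer_pos) auto
    have b: "norm (mb_kernel \<nu> a (Complex (h (Suc N)) t) * of_real x powr (- Complex (h (Suc N)) t)) \<le> C / (1 + t\<^sup>2) * R N" for t
    proof -
      define s where "s = Complex (h (Suc N)) t"
      have Re: "Re s = - real N - 1/2" and Im: "Im s = t" by (simp_all add: s_def h_def)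
      have "s \<notin> \<int>\<^sub>\<le>\<^sub>0"
      proof
        assume "s \<in> \<int>\<^sub>\<le>\<^sub>0"
        then obtain m where "s = - of_nat m" by (auto elim!: nonpos_Ints_cases')
        hence "2 * real m = 2 * real N + 1" using Re by simp
        hence "2 * m = 2 * N + 1" by linarith
        thus False by presburger
      qed
      hence "norm (Gamma s) = norm (Gamma (s + of_nat (Suc N))) / norm (pochhammer s (Suc N))"
        by (subst pochhammer_Gamma_shift[of s "Suc N"]) (auto simp: norm_divide)
      also have "\<dots> \<le> (C / (1 + t\<^sup>2)) / pochhammer (1/2) (Suc N)"
      proof (rule frac_le)
        show "norm (Gamma (s + of_nat (Suc N))) \<le> C / (1 + t\<^sup>2)"
          using C(2)[of "s + of_nat (Suc N)"] Re Im by simp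
        \<comment> \<open>On this line |Re (s + j)| = N - j + 1/2, so the product is read backwards
          to match the factors of the Pochhammer symbol of 1/2.\<close>
        have "pochhammer (1/2 :: real) (Suc N) = (\<Prod>j\<in>{0..N}. 1/2 + real (N - j))"
          by (subst prod.atLeastAtMost_rev) (simp add: pochhammer_prod atLeastLessThanSuc_atLeastAtMost)
        also have "\<dots> \<le> (\<Prod>j\<in>{0..N}. norm (s + of_nat j))"
        proof (rule prod_mono)
          fix j assume "j \<in> {0..N}"
          hence "1/2 + real (N - j) = \<bar>Re (s + of_nat j)\<bar>" using Re by (auto simp: of_nat_diff)
          thus "0 \<le> 1/2 + real (N - j) \<and> 1/2 + real (N - j) \<le> norm (s + of_nat j)"
            using abs_Re_le_cmod[of "s + of_nat j"] by linarith
        qed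
        also have "\<dots> = norm (pochhammer s (Suc N))"
          by (simp add: pochhammer_prod prod_norm atLeastLessThanSuc_atLeastAtMost)
        finally show "pochhammer (1/2) (Suc N) \<le> norm (pochhammer s (Suc N))" .
      qed (use C P0 in \<open>auto intro: divide_nonneg_nonneg\<close>)
      finally have 1: "norm (Gamma s) \<le> (C / (1 + t\<^sup>2)) / pochhammer (1/2) (Suc N)" .
      have "norm (gamma_quot \<nu> (of_real a - s)) \<le>
          \<nu> * Gamma (Re (of_real a - s) + 1) * rGamma (\<nu> * Re (of_real a - s) + 1)"
        using \<nu> Re \<open>a > 0\<close> by (intro norm_gamma_quot_le) auto
      also have "Re (of_real a - s) = a + real N + 1/2" using Re by simp
      also have "a + real N + 1/2 + 1 = a + real N + 3/2" by simp
      finally have 2: "norm (gamma_quot \<nu> (of_real a - s)) \<le> \<nu> * Gamma (a + real N + 3/2) * rGamma (\<nu> * (a + real N + 1/2) + 1)" .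
      have 3: "norm (of_real x powr (-s) :: complex) = x powr (real N + 1/2)"
        using Re \<open>x > 0\<close> by (simp add: norm_of_real_powr add.commute)
      have "norm (mb_kernel \<nu> a s * of_real x powr (-s)) \<le>
          (C / (1 + t\<^sup>2)) / pochhammer (1/2) (Suc N) * (\<nu> * Gamma (a + real N + 3/2) * rGamma (\<nu> * (a + real N + 1/2) + 1))
          * x powr (real N + 1/2)"
        unfolding mb_kernel_def norm_mult 3 using C P0
        by (intro mult_right_mono mult_mono 1 2) (auto intro!: divide_nonneg_nonneg)
      also have "\<dots> = C / (1 + t\<^sup>2) * R N" by (simp add: R_def)
      finally show ?thesis by (simp add: s_def)
    qed
    have "norm (J (h (Suc N))) \<le> (\<integral>t. C / (1 + t\<^sup>2) * R N \<partial>lborel)"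
      unfolding J_def
    proof (rule order.trans[OF integral_norm_bound integral_mono'])
      show "integrable lborel (\<lambda>t::real. C / (1 + t\<^sup>2) * R N)"
        by (intro integrable_mult_left integrable_inverse_1_plus_square')
    qed (use b in \<open>auto intro: order.trans[OF norm_ge_zero]\<close>)
    thus ?thesis by (simp only: D_def integral_mult_left_zero)
  qed
  have "(\<lambda>N. J (h (Suc N))) \<longlonglongrightarrow> 0"
  proof (rule Lim_null_comparison)
    show "(\<lambda>N. D * R N) \<longlonglongrightarrow> 0"
      unfolding R_def using mb_remainder_tendsto_0[OF \<nu>(1) \<open>a > 0\<close> \<open>x > 0\<close>]
      by (rule tendsto_mult_right_zero)
  qed (rule always_eventually, use JR in blast)
  hence "(\<lambda>N. J (h N)) \<longlonglongrightarrow> 0" by (rule LIMSEQ_imp_Suc)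
  hence "(\<lambda>N. J g - J (h N)) \<longlonglongrightarrow> J g - 0" by (intro tendsto_intros)
  hence sums: "(\<lambda>k. 2 * pi * u k) sums J g" unfolding sums_def sum by simp
  define v where "v = (\<lambda>r. (-x) ^ r / Gamma (\<nu> * real r + \<nu> * a) * (Gamma (a + real r) / (fact r * Gamma a)))"
  have Ga: "Gamma a > 0" using \<open>a > 0\<close> by (rule Gamma_real_pos)
  have uv: "u k = Gamma a * v k" for k
  proof -
    have "u k = (-1) ^ k / fact k * (Gamma (of_real (a + real k)) * rGamma (of_real (\<nu> * (a + real k)))) * of_real x ^ k"
      unfolding u_def using gamma_quot_eq[of "of_real a + of_nat k" \<nu>] \<open>a > 0\<close>
      by simp
    also have "\<dots> = of_real ((-1) ^ k / fact k * (Gamma (a + real k) * inverse (Gamma (\<nu> * (a + real k)))) * x ^ k)"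
      unfolding rGamma_inverse_Gamma Gamma_complex_of_real by simp
    also have "\<dots> = of_real (Gamma a * v k)"
      using Ga by (simp add: v_def field_simps power_minus[of x])
    finally show ?thesis by simp
  qed
  have "(\<lambda>k. complex_of_real (2 * pi * Gamma a * v k)) sums J g"
    using sums by (simp add: uv mult.assoc)
  hence "(\<lambda>k. complex_of_real (2 * pi * Gamma a * v k) / of_real (2 * pi * Gamma a)) sums (J g / of_real (2 * pi * Gamma a))"
    by (rule sums_divide)
  moreover have "complex_of_real (2 * pi * Gamma a * v k) / of_real (2 * pi * Gamma a) = of_real (v k)" for k
    using Ga by simp
  ultimately have S: "(\<lambda>k. complex_of_real (v k)) sums (J g / of_real (2 * pi * Gamma a))" by simp
  \<comment> \<open>\<open>J g\<close> is a complex integral while the series has real terms, so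
    real and imaginary parts are compared separately.\<close>
  have "v sums Re (J g / of_real (2 * pi * Gamma a))"
    using sums_Re[OF S] by (simp only: Re_complex_of_real)
  hence "Re (J g / of_real (2 * pi * Gamma a)) = suminf v" by (rule sums_unique)
  moreover have "(\<lambda>k. 0) sums Im (J g / of_real (2 * pi * Gamma a))"
    using sums_Im[OF S] by (simp only: Im_complex_of_real)
  hence "Im (J g / of_real (2 * pi * Gamma a)) = 0" by (rule sums_unique2[OF _ sums_zero])
  ultimately have "J g / of_real (2 * pi * Gamma a) = of_real (suminf v)"
    by (intro complex_eqI) (simp_all only: Re_complex_of_real Im_complex_of_real)
  moreover have "suminf v = mittag_leffler3 \<nu> (\<nu> * a) a (-x)"
    unfolding v_def mittag_leffler3_def ..
  ultimately have "complex_of_real (mittag_leffler3 \<nu> (\<nu> * a) a (-x)) = J g / of_real (2 * pi * Gamma a)"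
    by simp
  thus ?thesis unfolding J_def by simp
qed

section \<open>Mellin transforms\<close>

lemma of_real_powr_exp:
  assumes "y > 0"
  shows "of_real y powr (w :: complex) = exp (w * of_real (ln y))"
  using assms by (simp add: powr_def Ln_of_real)

lemma of_real_powr_has_vector_derivative:
  assumes "y > 0" "w \<noteq> 0"
  shows "((\<lambda>y. of_real y powr w / w) has_vector_derivative (of_real y powr (w - 1) :: complex)) (at y)"
proof -
  have "((\<lambda>z. z powr w) has_field_derivative w * of_real y powr (w - 1)) (at (of_real y))"
    by (rule has_field_derivative_powr) (use assms in \<open>simp add: complex_nonpos_Reals_iff\<close>)
  hence "((\<lambda>z. z powr w / w) has_field_derivative w * of_real y powr (w - 1) / w) (at (of_real y))"
    by (rule DERIV_cdivide)
  hence "((\<lambda>z. z powr w / w) has_field_derivative of_real y powr (w - 1)) (at (of_real y))"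
    using assms by simp
  thus ?thesis by (rule has_vector_derivative_real_field)
qed

lemma isCont_of_real_powr: "y > 0 \<Longrightarrow> isCont (\<lambda>y. of_real y powr w :: complex) y"
  by (intro continuous_intros) (auto simp: complex_nonpos_Reals_iff)

lemma borel_measurable_of_real_powr:
  assumes "D \<in> sets borel" "D \<subseteq> {0<..}"
  shows "set_borel_measurable lborel D (\<lambda>y. of_real y powr w :: complex)"
proof -
  have "(\<lambda>y. indicator D y *\<^sub>R exp (w * of_real (ln y))) \<in> borel_measurable lborel"
    using assms by measurable
  also have "(\<lambda>y. indicator D y *\<^sub>R exp (w * of_real (ln y))) = (\<lambda>y. indicator D y *\<^sub>R (of_real y powr w :: complex))"
    using assms by (auto simp: fun_eq_iff of_real_powr_exp indicator_def)
  finally show ?thesis by (simp add: set_borel_measurable_def)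
qed

lemma powr_tendsto_0_at_right:
  assumes "x > 0" shows "((\<lambda>y::real. y powr x) \<longlongrightarrow> 0) (at_right 0)"
  using assms by real_asymp

lemma powr_tendsto_0_at_top:
  assumes "x < 0" shows "((\<lambda>y::real. y powr x) \<longlongrightarrow> 0) at_top"
  using assms by real_asymp

text \<open>The antiderivative is y^w / w. The fundamental theorem for complex values presupposes
  absolute integrability, which is first obtained for the real exponent, since |y^(w-1)| = y^(Re w -
  1).\<close>

lemma powr_integral_0_1:
  assumes "Re w > 0"
  shows "set_integrable lborel {0<..<1} (\<lambda>y. of_real y powr (w - 1) :: complex)"
    and "(LINT y:{0<..<1}|lborel. (of_real y powr (w - 1) :: complex)) = 1 / w"
proof -
  have w: "w \<noteq> 0" using assms by auto
  have lim0: "((\<lambda>y. y powr Re w / c) \<longlongrightarrow> 0) (at_right 0)" for c :: real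
    using powr_tendsto_0_at_right[OF assms] by (rule tendsto_divide_zero)
  have "set_integrable lborel (einterval 0 1) (\<lambda>y. y powr (Re w - 1))"
    unfolding zero_ereal_def one_ereal_def
  proof (rule interval_integral_FTC_nonneg(1))
    show "(((\<lambda>y. y powr Re w / Re w) \<circ> real_of_ereal) \<longlongrightarrow> 0) (at_right (ereal 0))"
      unfolding ereal_tendsto_simps by (rule lim0)
    have "((\<lambda>y. y powr Re w / Re w) \<longlongrightarrow> 1 powr Re w / Re w) (at_left 1)"
      by (intro tendsto_intros) (use assms in auto)
    thus "(((\<lambda>y. y powr Re w / Re w) \<circ> real_of_ereal) \<longlongrightarrow> 1 / Re w) (at_left (ereal 1))"
      unfolding ereal_tendsto_simps by simp
  qed (use assms in \<open>auto intro!: derivative_eq_intros continuous_intros simp: powr_diff\<close>)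
  hence R: "set_integrable lborel {0<..<1} (\<lambda>y. y powr (Re w - 1))"
    by (simp add: zero_ereal_def one_ereal_def)
  show I: "set_integrable lborel {0<..<1} (\<lambda>y. of_real y powr (w - 1) :: complex)"
    by (rule set_integrable_bound[OF R borel_measurable_of_real_powr])
       (auto intro!: AE_I2 simp: norm_of_real_powr)
  have "(LBINT y=ereal 0..ereal 1. (of_real y powr (w - 1) :: complex)) = 1 / w - 0"
  proof (rule interval_integral_FTC_integrable)
    show "((\<lambda>y. of_real y powr w / w) has_vector_derivative (of_real x powr (w - 1) :: complex)) (at x)"
      if "ereal 0 < ereal x" for x using that w by (intro of_real_powr_has_vector_derivative) auto
    show "isCont (\<lambda>y. of_real y powr (w - 1) :: complex) x" if "ereal 0 < ereal x" for x
      using that by (intro isCont_of_real_powr) auto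
    show "set_integrable lborel (einterval (ereal 0) (ereal 1)) (\<lambda>y. of_real y powr (w - 1) :: complex)"
      using I by simp
    have "((\<lambda>y. of_real y powr w / w :: complex) \<longlongrightarrow> 0) (at_right 0)"
    proof (rule Lim_null_comparison[OF _ lim0])
      show "\<forall>\<^sub>F y in at_right 0. norm (of_real y powr w / w :: complex) \<le> y powr Re w / norm w"
        by (rule eventually_mono[OF eventually_at_right_less]) (simp add: norm_divide norm_of_real_powr)
    qed
    thus "(((\<lambda>y. of_real y powr w / w :: complex) \<circ> real_of_ereal) \<longlongrightarrow> 0) (at_right (ereal 0))"
      unfolding ereal_tendsto_simps .
    have "isCont (\<lambda>y. of_real y powr w / w :: complex) 1"
      using w by (intro continuous_intros) (auto simp: complex_nonpos_Reals_iff)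
    hence "((\<lambda>y. of_real y powr w / w :: complex) \<longlongrightarrow> 1 / w) (at_left 1)"
      unfolding isCont_def by (auto intro: filterlim_at_split[THEN iffD1, THEN conjunct1])
    thus "(((\<lambda>y. of_real y powr w / w :: complex) \<circ> real_of_ereal) \<longlongrightarrow> 1 / w) (at_left (ereal 1))"
      unfolding ereal_tendsto_simps .
  qed simp
  thus "(LINT y:{0<..<1}|lborel. (of_real y powr (w - 1) :: complex)) = 1 / w"
    by (simp add: interval_lebesgue_integral_def)
qed

text \<open>Same antiderivative, but y = 1 is now the lower limit, hence the minus sign.\<close>

lemma powr_integral_1_inf:
  assumes "Re w < 0"
  shows "set_integrable lborel {1<..} (\<lambda>y. of_real y powr (w - 1) :: complex)"
    and "(LINT y:{1<..}|lborel. (of_real y powr (w - 1) :: complex)) = - 1 / w"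
proof -
  have w: "w \<noteq> 0" using assms by auto
  have lim0: "((\<lambda>y. y powr Re w / c) \<longlongrightarrow> 0) at_top" for c :: real
    using powr_tendsto_0_at_top[OF assms] by (rule tendsto_divide_zero)
  have "set_integrable lborel (einterval (ereal 1) \<infinity>) (\<lambda>y. y powr (Re w - 1))"
  proof (rule interval_integral_FTC_nonneg(1))
    show "(((\<lambda>y. y powr Re w / Re w) \<circ> real_of_ereal) \<longlongrightarrow> 0) (at_left \<infinity>)"
      unfolding ereal_tendsto_simps by (rule lim0)
    have "((\<lambda>y. y powr Re w / Re w) \<longlongrightarrow> 1 powr Re w / Re w) (at_right 1)"
      by (intro tendsto_intros) (use assms in auto)
    thus "(((\<lambda>y. y powr Re w / Re w) \<circ> real_of_ereal) \<longlongrightarrow> 1 / Re w) (at_right (ereal 1))"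
      unfolding ereal_tendsto_simps by simp
  qed (use assms in \<open>auto intro!: derivative_eq_intros continuous_intros simp: powr_diff\<close>)
  hence R: "set_integrable lborel {1<..} (\<lambda>y. y powr (Re w - 1))" by simp
  show I: "set_integrable lborel {1<..} (\<lambda>y. of_real y powr (w - 1) :: complex)"
    by (rule set_integrable_bound[OF R borel_measurable_of_real_powr])
       (auto intro!: AE_I2 simp: norm_of_real_powr)
  have "(LBINT y=ereal 1..\<infinity>. (of_real y powr (w - 1) :: complex)) = 0 - 1 / w"
  proof (rule interval_integral_FTC_integrable)
    show "((\<lambda>y. of_real y powr w / w) has_vector_derivative (of_real x powr (w - 1) :: complex)) (at x)"
      if "ereal 1 < ereal x" for x using that w by (intro of_real_powr_has_vector_derivative) auto
    show "isCont (\<lambda>y. of_real y powr (w - 1) :: complex) x" if "ereal 1 < ereal x" for x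
      using that by (intro isCont_of_real_powr) auto
    show "set_integrable lborel (einterval (ereal 1) \<infinity>) (\<lambda>y. of_real y powr (w - 1) :: complex)"
      using I by simp
    have "((\<lambda>y. of_real y powr w / w :: complex) \<longlongrightarrow> 0) at_top"
    proof (rule Lim_null_comparison[OF _ lim0])
      show "\<forall>\<^sub>F y in at_top. norm (of_real y powr w / w :: complex) \<le> y powr Re w / norm w"
        by (rule eventually_mono[OF eventually_gt_at_top[of 0]]) (simp add: norm_divide norm_of_real_powr)
    qed
    thus "(((\<lambda>y. of_real y powr w / w :: complex) \<circ> real_of_ereal) \<longlongrightarrow> 0) (at_left \<infinity>)"
      unfolding ereal_tendsto_simps .
    have "isCont (\<lambda>y. of_real y powr w / w :: complex) 1"
      using w by (intro continuous_intros) (auto simp: complex_nonpos_Reals_iff)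
    hence "((\<lambda>y. of_real y powr w / w :: complex) \<longlongrightarrow> 1 / w) (at_right 1)"
      unfolding isCont_def by (auto intro: filterlim_at_split[THEN iffD1, THEN conjunct2])
    thus "(((\<lambda>y. of_real y powr w / w :: complex) \<circ> real_of_ereal) \<longlongrightarrow> 1 / w) (at_right (ereal 1))"
      unfolding ereal_tendsto_simps .
  qed simp
  thus "(LINT y:{1<..}|lborel. (of_real y powr (w - 1) :: complex)) = - 1 / w"
    by (simp add: interval_lebesgue_integral_def)
qed

section \<open>Interchange of the y-integral with the Mellin-Barnes integral, and inversion\<close>

lemma integrable_lborel_product:
  fixes A B :: "real \<Rightarrow> complex"
  assumes A: "integrable lborel A" and B: "integrable lborel B"
    and E: "E \<in> borel_measurable (lborel \<Otimes>\<^sub>M lborel)" "\<And>p. norm (E p :: complex) \<le> 1"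
  shows "integrable (lborel \<Otimes>\<^sub>M lborel) (\<lambda>p. A (fst p) * B (snd p) * E p)"
proof -
  have [measurable]: "A \<in> borel_measurable lborel" "B \<in> borel_measurable lborel"
    using A B by auto
  note E(1)[measurable]
  have m: "(\<lambda>p. A (fst p) * B (snd p)) \<in> borel_measurable (lborel \<Otimes>\<^sub>M lborel)" by measurable
  have "integrable (lborel \<Otimes>\<^sub>M lborel) (\<lambda>p. A (fst p) * B (snd p))"
  proof (rule lborel_pair.Fubini_integrable[OF m])
    show "integrable lborel (\<lambda>x. \<integral>y. norm (A (fst (x, y)) * B (snd (x, y))) \<partial>lborel)"
      using A by (simp add: norm_mult)
    show "AE x in lborel. integrable lborel (\<lambda>y. A (fst (x, y)) * B (snd (x, y)))"
      using B by simp
  qed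
  thus ?thesis
  proof (rule Bochner_Integration.integrable_bound)
    show "(\<lambda>p. A (fst p) * B (snd p) * E p) \<in> borel_measurable (lborel \<Otimes>\<^sub>M lborel)" by measurable
    show "AE p in lborel \<Otimes>\<^sub>M lborel. norm (A (fst p) * B (snd p) * E p) \<le> norm (A (fst p) * B (snd p))"
      using E(2) by (intro AE_I2) (simp add: norm_mult mult_left_le)
  qed
qed

text \<open>On a vertical line the modulus of y^(-\<nu> s) depends on y alone, so the double
  integrand is A(y) H(s) times a factor of modulus 1, and Fubini needs only the two one-dimensional
  integrability assumptions.\<close>

lemma Fubini_Mellin:
  fixes W \<phi> :: "real \<Rightarrow> complex" and H :: "complex \<Rightarrow> complex" and \<nu> g :: real
  assumes D: "D \<in> sets borel" "D \<subseteq> {0<..}"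
    and H: "integrable lborel (\<lambda>t. H (Complex g t))"
    and W: "set_integrable lborel D (\<lambda>y. W y * of_real y powr (- (of_real \<nu> * of_real g)))"
    and \<phi>: "\<And>y. y \<in> D \<Longrightarrow> \<phi> y = (\<integral>t. H (Complex g t) * of_real y powr (- (of_real \<nu> * Complex g t)) \<partial>lborel)"
  shows "set_integrable lborel D (\<lambda>y. W y * \<phi> y)"
    and "(LINT y:D|lborel. W y * \<phi> y) =
      (\<integral>t. H (Complex g t) * (LINT y:D|lborel. W y * of_real y powr (- (of_real \<nu> * Complex g t))) \<partial>lborel)"
proof -
  define A where "A = (\<lambda>y. indicator D y *\<^sub>R (W y * of_real y powr (- (of_real \<nu> * of_real g) :: complex)))"
  \<comment> \<open>The unimodular part y^(-\<i> \<nu> t), written with \<open>exp\<close> and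
    \<open>ln\<close> so that it is measurable in both variables; outside \<open>D\<close> the
    factor \<open>A\<close> vanishes.\<close>
  define E where "E = (\<lambda>(y, t). exp (- \<i> * of_real (\<nu> * t * ln y)))"
  define K where "K = (\<lambda>y t. A y * H (Complex g t) * E (y, t))"
  have A: "integrable lborel A" using W by (simp add: set_integrable_def A_def)
  have split: "of_real y powr (- (of_real \<nu> * of_real g)) * E (y, t) = of_real y powr (- (of_real \<nu> * Complex g t))"
    if "y \<in> D" for y t
  proof -
    have "y > 0" using that D by auto
    thus ?thesis
      by (simp add: of_real_powr_exp E_def exp_add[symmetric] Complex_eq algebra_simps)
  qed
  have "integrable (lborel \<Otimes>\<^sub>M lborel) (\<lambda>p. A (fst p) * H (Complex g (snd p)) * E p)"
  proof (rule integrable_lborel_product[OF A H])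
    show "E \<in> borel_measurable (lborel \<Otimes>\<^sub>M lborel)" unfolding E_def by measurable
    show "norm (E p) \<le> 1" for p by (cases p) (simp add: E_def norm_exp_eq_Re)
  qed
  hence K: "integrable (lborel \<Otimes>\<^sub>M lborel) (case_prod K)"
    by (simp add: K_def case_prod_beta')
  have inner1: "(\<integral>t. K y t \<partial>lborel) = indicator D y *\<^sub>R (W y * \<phi> y)" for y
  proof (cases "y \<in> D")
    case True
    have "(\<integral>t. K y t \<partial>lborel) = (\<integral>t. W y * (H (Complex g t) * of_real y powr (- (of_real \<nu> * Complex g t))) \<partial>lborel)"
      by (intro Bochner_Integration.integral_cong) (use True in \<open>simp_all add: K_def A_def split[symmetric] mult_ac\<close>)
    also have "\<dots> = W y * \<phi> y" using \<phi>[OF True] by simp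
    finally show ?thesis using True by simp
  qed (simp add: K_def A_def)
  have inner2: "(\<integral>y. K y t \<partial>lborel) = H (Complex g t) * (LINT y:D|lborel. W y * of_real y powr (- (of_real \<nu> * Complex g t)))" for t
  proof -
    have "(\<integral>y. K y t \<partial>lborel) = (\<integral>y. H (Complex g t) * (indicator D y *\<^sub>R (W y * of_real y powr (- (of_real \<nu> * Complex g t)))) \<partial>lborel)"
    proof (intro Bochner_Integration.integral_cong refl)
      fix y show "K y t = H (Complex g t) * (indicator D y *\<^sub>R (W y * of_real y powr (- (of_real \<nu> * Complex g t))))"
        by (cases "y \<in> D") (simp_all add: K_def A_def split[symmetric] mult_ac)
    qed
    thus ?thesis by (simp only: set_lebesgue_integral_def integral_mult_right_zero)
  qed
  have "integrable lborel (\<lambda>y. \<integral>t. K y t \<partial>lborel)"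
    using lborel_pair.integrable_fst'[OF K] by simp
  thus "set_integrable lborel D (\<lambda>y. W y * \<phi> y)"
    by (simp add: inner1 set_integrable_def)
  have "(\<integral>y. (\<integral>t. K y t \<partial>lborel) \<partial>lborel) = (\<integral>t. (\<integral>y. K y t \<partial>lborel) \<partial>lborel)"
    using lborel_pair.Fubini_integral[OF K] by simp
  thus "(LINT y:D|lborel. W y * \<phi> y) =
      (\<integral>t. H (Complex g t) * (LINT y:D|lborel. W y * of_real y powr (- (of_real \<nu> * Complex g t))) \<partial>lborel)"
    by (simp add: inner1 inner2 set_lebesgue_integral_def)
qed

text \<open>No single line serves all y: convergence at 0 needs Re s < Re p, at infinity Re s > Re
  p. So the line g1 is used on (0,1) and g2 on (1,\<infinity>), which is possible because both
  represent the same \<phi>. The inner integrals are -1 and +1 divided by \<nu> (s - p), and their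
  sum is the strip formula.\<close>

lemma Mellin_inversion_strip:
  fixes H :: "complex \<Rightarrow> complex" and \<phi> :: "real \<Rightarrow> complex"
  assumes hol: "H holomorphic_on {s. g1 \<le> Re s \<and> Re s \<le> g2}"
    and p: "g1 < Re p" "Re p < g2" and "\<nu> > 0"
    and bound: "\<And>s. g1 \<le> Re s \<Longrightarrow> Re s \<le> g2 \<Longrightarrow> norm (H s) \<le> C / (1 + (Im s)\<^sup>2)"
    and \<phi>: "\<And>y g. y > 0 \<Longrightarrow> g = g1 \<or> g = g2 \<Longrightarrow>
               \<phi> y = (\<integral>t. H (Complex g t) * of_real y powr (- (of_real \<nu> * Complex g t)) \<partial>lborel)"
  shows "set_integrable lborel {0<..} (\<lambda>y. of_real y powr (of_real \<nu> * p - 1) * \<phi> y)"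
    and "(LINT y:{0<..}|lborel. of_real y powr (of_real \<nu> * p - 1) * \<phi> y) = 2 * pi * H p / \<nu>"
proof -
  let ?f = "\<lambda>y. of_real y powr (of_real \<nu> * p - 1) * \<phi> y"
  have cont: "continuous_on {s. g1 \<le> Re s \<and> Re s \<le> g2} H"
    using hol by (rule holomorphic_on_imp_continuous_on)
  have int: "integrable lborel (\<lambda>t. H (Complex g t))" if "g = g1 \<or> g = g2" for g
    by (rule integrable_vertical_line[where C = C], rule continuous_on_subset[OF cont])
       (use that p bound in auto)
  have comb: "of_real y powr (of_real \<nu> * p - 1) * of_real y powr (- (of_real \<nu> * s))
      = of_real y powr (of_real \<nu> * (p - s) - 1)" if "y > 0" for y s
    using that by (simp add: of_real_powr_exp exp_add[symmetric] algebra_simps)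
  have Re1: "Re (of_real \<nu> * (p - Complex g1 t)) > 0" for t
    using p \<open>\<nu> > 0\<close> by simp
  have Re2: "Re (of_real \<nu> * (p - Complex g2 t)) < 0" for t
    using p \<open>\<nu> > 0\<close> by (simp add: mult_pos_neg)
  have cR: "of_real g = Complex g 0" for g by (simp add: complex_eq_iff)
  have i1: "set_integrable lborel {0<..<1} ?f"
    "(LINT y:{0<..<1}|lborel. ?f y) = (\<integral>t. H (Complex g1 t) * (LINT y:{0<..<1}|lborel. of_real y powr (of_real \<nu> * p - 1) * of_real y powr (- (of_real \<nu> * Complex g1 t))) \<partial>lborel)"
  proof -
    \<comment> \<open>Absolute convergence depends on moduli only, so the point t = 0 represents the
      whole line.\<close>
    have "set_integrable lborel {0<..<1} (\<lambda>y. of_real y powr (of_real \<nu> * p - 1) * of_real y powr (- (of_real \<nu> * of_real g1)) :: complex)"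
      using powr_integral_0_1(1)[OF Re1[of 0]]
      by (rule set_integrable_cong[THEN iffD1, rotated -1]) (auto simp: comb cR[of g1])
    note F = Fubini_Mellin[OF _ _ int this \<phi>]
    show "set_integrable lborel {0<..<1} ?f" by (rule F(1)) auto
    show "(LINT y:{0<..<1}|lborel. ?f y) = (\<integral>t. H (Complex g1 t) * (LINT y:{0<..<1}|lborel. of_real y powr (of_real \<nu> * p - 1) * of_real y powr (- (of_real \<nu> * Complex g1 t))) \<partial>lborel)"
      by (rule F(2)) auto
  qed
  have i2: "set_integrable lborel {1<..} ?f"
    "(LINT y:{1<..}|lborel. ?f y) = (\<integral>t. H (Complex g2 t) * (LINT y:{1<..}|lborel. of_real y powr (of_real \<nu> * p - 1) * of_real y powr (- (of_real \<nu> * Complex g2 t))) \<partial>lborel)"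
  proof -
    have "set_integrable lborel {1<..} (\<lambda>y. of_real y powr (of_real \<nu> * p - 1) * of_real y powr (- (of_real \<nu> * of_real g2)) :: complex)"
      using powr_integral_1_inf(1)[OF Re2[of 0]]
      by (rule set_integrable_cong[THEN iffD1, rotated -1]) (auto simp: comb cR[of g2])
    note F = Fubini_Mellin[OF _ _ int this \<phi>]
    show "set_integrable lborel {1<..} ?f" by (rule F(1)) auto
    show "(LINT y:{1<..}|lborel. ?f y) = (\<integral>t. H (Complex g2 t) * (LINT y:{1<..}|lborel. of_real y powr (of_real \<nu> * p - 1) * of_real y powr (- (of_real \<nu> * Complex g2 t))) \<partial>lborel)"
      by (rule F(2)) auto
  qed
  have e1: "(LINT y:{0<..<1}|lborel. of_real y powr (of_real \<nu> * p - 1) * of_real y powr (- (of_real \<nu> * Complex g1 t)))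
      = - 1 / (of_real \<nu> * (Complex g1 t - p))" for t
  proof -
    have "(LINT y:{0<..<1}|lborel. of_real y powr (of_real \<nu> * p - 1) * of_real y powr (- (of_real \<nu> * Complex g1 t)) :: complex)
      = (LINT y:{0<..<1}|lborel. of_real y powr (of_real \<nu> * (p - Complex g1 t) - 1))"
      by (rule set_lebesgue_integral_cong) (auto simp: comb)
    also have "\<dots> = 1 / (of_real \<nu> * (p - Complex g1 t))" by (rule powr_integral_0_1(2)[OF Re1])
    also have "\<dots> = - 1 / (of_real \<nu> * (Complex g1 t - p))"
      by (metis (no_types, lifting) minus_diff_eq minus_divide_divide minus_mult_right)
    finally show ?thesis .
  qed
  have e2: "(LINT y:{1<..}|lborel. of_real y powr (of_real \<nu> * p - 1) * of_real y powr (- (of_real \<nu> * Complex g2 t)))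
      = 1 / (of_real \<nu> * (Complex g2 t - p))" for t
  proof -
    have "(LINT y:{1<..}|lborel. of_real y powr (of_real \<nu> * p - 1) * of_real y powr (- (of_real \<nu> * Complex g2 t)) :: complex)
      = (LINT y:{1<..}|lborel. of_real y powr (of_real \<nu> * (p - Complex g2 t) - 1))"
      by (rule set_lebesgue_integral_cong) (auto simp: comb)
    also have "\<dots> = - 1 / (of_real \<nu> * (p - Complex g2 t))" by (rule powr_integral_1_inf(2)[OF Re2])
    also have "\<dots> = 1 / (of_real \<nu> * (Complex g2 t - p))"
      by (metis (no_types, lifting) minus_diff_eq minus_divide_divide minus_mult_right)
    finally show ?thesis .
  qed
  have v1: "(LINT y:{0<..<1}|lborel. ?f y) = - (\<integral>t. H (Complex g1 t) / (Complex g1 t - p) \<partial>lborel) / \<nu>"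
  proof -
    have "(LINT y:{0<..<1}|lborel. ?f y) = (\<integral>t. (H (Complex g1 t) / (Complex g1 t - p)) * (- 1 / of_real \<nu>) \<partial>lborel)"
      unfolding i1 e1 by (intro Bochner_Integration.integral_cong) auto
    also have "\<dots> = (\<integral>t. H (Complex g1 t) / (Complex g1 t - p) \<partial>lborel) * (- 1 / of_real \<nu>)"
      by (rule integral_mult_left_zero)
    finally show ?thesis by simp
  qed
  have v2: "(LINT y:{1<..}|lborel. ?f y) = (\<integral>t. H (Complex g2 t) / (Complex g2 t - p) \<partial>lborel) / \<nu>"
  proof -
    have "(LINT y:{1<..}|lborel. ?f y) = (\<integral>t. (H (Complex g2 t) / (Complex g2 t - p)) * (1 / of_real \<nu>) \<partial>lborel)"
      unfolding i2 e2 by (intro Bochner_Integration.integral_cong) auto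
    also have "\<dots> = (\<integral>t. H (Complex g2 t) / (Complex g2 t - p) \<partial>lborel) * (1 / of_real \<nu>)"
      by (rule integral_mult_left_zero)
    finally show ?thesis by simp
  qed
  have un: "set_integrable lborel ({0<..<1} \<union> {1<..}) ?f"
    using i1(1) i2(1) by (rule set_integrable_Un) auto
  show "set_integrable lborel {0<..} ?f"
    by (rule set_integrable_discrete_difference[of "{1}" "{0<..<1} \<union> {1<..}", THEN iffD1, OF _ _ _ _ un]) auto
  have "(LINT y:{0<..}|lborel. ?f y) = (LINT y:{0<..<1} \<union> {1<..}|lborel. ?f y)"
    by (rule set_integral_discrete_difference[of "{1}"]) auto
  also have "\<dots> = (LINT y:{0<..<1}|lborel. ?f y) + (LINT y:{1<..}|lborel. ?f y)"
    using i1(1) i2(1) by (intro set_integral_Un) auto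
  also have "\<dots> = ((\<integral>t. H (Complex g2 t) / (Complex g2 t - p) \<partial>lborel) - (\<integral>t. H (Complex g1 t) / (Complex g1 t - p) \<partial>lborel)) / \<nu>"
    unfolding v1 v2 by (simp add: diff_divide_distrib)
  also have "\<dots> = 2 * pi * H p / \<nu>"
    by (simp add: Cauchy_integral_formula_strip[OF hol p bound])
  finally show "(LINT y:{0<..}|lborel. ?f y) = 2 * pi * H p / \<nu>" .
qed

section \<open>Mellin transform of the Mittag-Leffler function and the product integral\<close>

lemma of_real_mult_powr_powr:
  assumes "y > 0" "r > 0"
  shows "of_real ((y * r) powr \<nu>) powr (- s :: complex)
       = of_real y powr (- (of_real \<nu> * s)) * of_real r powr (- (of_real \<nu> * s))"
proof -
  have "ln ((y * r) powr \<nu>) = \<nu> * (ln y + ln r)" using assms by (simp add: ln_powr ln_mult)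
  thus ?thesis
    using assms by (simp add: of_real_powr_exp exp_add[symmetric] algebra_simps)
qed

text \<open>r^(-\<nu> s) and the constant move into the kernel, so that y^(-\<nu> s) carries all
  dependence on y, as \<open>Fubini_Mellin\<close> requires.\<close>

lemma mittag_leffler3_Mellin_Barnes_scaled:
  assumes "0 < \<nu>" "\<nu> \<le> 1" "a > 0" "r > 0" "0 < g" "g < a + 1" "y > 0"
  shows "complex_of_real (mittag_leffler3 \<nu> (\<nu> * a) a (- ((y * r) powr \<nu>))) =
      (\<integral>t. (mb_kernel \<nu> a (Complex g t) * of_real r powr (- (of_real \<nu> * Complex g t)) / (2 * pi * Gamma a))
           * of_real y powr (- (of_real \<nu> * Complex g t)) \<partial>lborel)"
proof -
  have "complex_of_real (mittag_leffler3 \<nu> (\<nu> * a) a (- ((y * r) powr \<nu>))) =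
      1 / (2 * pi * Gamma a) * (\<integral>t. mb_kernel \<nu> a (Complex g t) * of_real ((y * r) powr \<nu>) powr (- Complex g t) \<partial>lborel)"
    using assms by (intro mittag_leffler3_Mellin_Barnes) auto
  also have "\<dots> = (\<integral>t. 1 / (2 * pi * Gamma a) * (mb_kernel \<nu> a (Complex g t) * of_real ((y * r) powr \<nu>) powr (- Complex g t)) \<partial>lborel)"
    by (rule integral_mult_right_zero[symmetric])
  also have "\<dots> = (\<integral>t. (mb_kernel \<nu> a (Complex g t) * of_real r powr (- (of_real \<nu> * Complex g t)) / (2 * pi * Gamma a))
           * of_real y powr (- (of_real \<nu> * Complex g t)) \<partial>lborel)"
    using assms by (intro Bochner_Integration.integral_cong refl)
      (simp add: of_real_mult_powr_powr del: of_real_mult)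
  finally show ?thesis .
qed

lemma mb_kernel_scaled_decay:
  assumes "0 < \<nu>" "\<nu> \<le> 1" "0 < g1" "g2 < a + 1" "r > 0"
  obtains C where "\<And>s. g1 \<le> Re s \<Longrightarrow> Re s \<le> g2 \<Longrightarrow>
      norm (mb_kernel \<nu> a s * of_real r powr (- (of_real \<nu> * s)) / c) \<le> C / (1 + (Im s)\<^sup>2)"
proof -
  obtain C where C: "C > 0" "\<And>s. g1 \<le> Re s \<Longrightarrow> Re s \<le> g2 \<Longrightarrow> norm (mb_kernel \<nu> a s) \<le> C / (1 + (Im s)\<^sup>2)"
    using mb_kernel_decay[OF assms(1-4)] by blast
  have "continuous_on {g1..g2} (\<lambda>x. r powr (- (\<nu> * x)))"
    using \<open>r > 0\<close> by (intro continuous_intros) auto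
  hence "bounded ((\<lambda>x. r powr (- (\<nu> * x))) ` {g1..g2})"
    by (intro compact_imp_bounded compact_continuous_image) auto
  then obtain B where B: "\<And>x. x \<in> {g1..g2} \<Longrightarrow> norm (r powr (- (\<nu> * x))) \<le> B"
    unfolding bounded_iff by (metis (no_types, lifting) imageI)
  have "norm (mb_kernel \<nu> a s * of_real r powr (- (of_real \<nu> * s)) / c) \<le> (C * B / norm c) / (1 + (Im s)\<^sup>2)"
    if s: "g1 \<le> Re s" "Re s \<le> g2" for s
  proof -
    have "norm (mb_kernel \<nu> a s * of_real r powr (- (of_real \<nu> * s)) / c) \<le> (C / (1 + (Im s)\<^sup>2) * B) / norm c"
      unfolding norm_divide norm_mult norm_of_real_powr[OF \<open>r > 0\<close>]
      using C(1) C(2)[OF s] B[of "Re s"] s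
      by (intro divide_right_mono mult_mono) (auto intro!: divide_nonneg_nonneg)
    thus ?thesis by (simp add: mult_ac)
  qed
  thus ?thesis using that by blast
qed

text \<open>The Mellin-Barnes integral is valid on a line on either side of p, so the inversion
  lemma applies to its kernel. The upper limit b + 1 instead of b makes Re p = b an interior
  case.\<close>

lemma mittag_leffler3_Mellin_transform:
  assumes \<nu>: "0 < \<nu>" "\<nu> \<le> 1" and "b > 0" "r > 0" and p: "0 < Re p" "Re p < b + 1"
  shows "set_integrable lborel {0<..} (\<lambda>y. of_real y powr (of_real \<nu> * p - 1)
            * complex_of_real (mittag_leffler3 \<nu> (\<nu> * b) b (- ((y * r) powr \<nu>))))"
    and "(LINT y:{0<..}|lborel. of_real y powr (of_real \<nu> * p - 1)
            * complex_of_real (mittag_leffler3 \<nu> (\<nu> * b) b (- ((y * r) powr \<nu>))))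
         = mb_kernel \<nu> b p * of_real r powr (- (of_real \<nu> * p)) / (\<nu> * Gamma b)"
proof -
  \<comment> \<open>Halfway from Re p to the two edges 0 and b + 1 of the strip.\<close>
  define g1 where "g1 = Re p / 2"
  define g2 where "g2 = (Re p + (b + 1)) / 2"
  have g: "0 < g1" "g1 < Re p" "Re p < g2" "g2 < b + 1" "g1 < b + 1" "0 < g2"
    using p by (auto simp: g1_def g2_def)
  define H where "H = (\<lambda>s. mb_kernel \<nu> b s * of_real r powr (- (of_real \<nu> * s)) / (2 * pi * Gamma b))"
  obtain C where C: "\<And>s. g1 \<le> Re s \<Longrightarrow> Re s \<le> g2 \<Longrightarrow> norm (H s) \<le> C / (1 + (Im s)\<^sup>2)"
    using mb_kernel_scaled_decay[OF \<nu> g(1,4) \<open>r > 0\<close>, of "2 * pi * Gamma b"] unfolding H_def by blast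
  have Gb: "Gamma b > 0" using \<open>b > 0\<close> by (rule Gamma_real_pos)
  have hol: "H holomorphic_on {s. g1 \<le> Re s \<and> Re s \<le> g2}"
    unfolding H_def using g \<open>r > 0\<close> Gb
    by (intro holomorphic_intros holomorphic_mb_kernel) auto
  have \<phi>: "complex_of_real (mittag_leffler3 \<nu> (\<nu> * b) b (- ((y * r) powr \<nu>))) =
      (\<integral>t. H (Complex g t) * of_real y powr (- (of_real \<nu> * Complex g t)) \<partial>lborel)"
    if "y > 0" "g = g1 \<or> g = g2" for y g
    unfolding H_def using that g \<nu> \<open>b > 0\<close> \<open>r > 0\<close>
    by (intro mittag_leffler3_Mellin_Barnes_scaled) auto
  note M = Mellin_inversion_strip[OF hol g(2,3) \<nu>(1) C \<phi>]
  show "set_integrable lborel {0<..} (\<lambda>y. of_real y powr (of_real \<nu> * p - 1)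
            * complex_of_real (mittag_leffler3 \<nu> (\<nu> * b) b (- ((y * r) powr \<nu>))))"
    by (rule M(1))
  have "(LINT y:{0<..}|lborel. of_real y powr (of_real \<nu> * p - 1)
            * complex_of_real (mittag_leffler3 \<nu> (\<nu> * b) b (- ((y * r) powr \<nu>)))) = 2 * pi * H p / \<nu>"
    by (rule M(2))
  thus "(LINT y:{0<..}|lborel. of_real y powr (of_real \<nu> * p - 1)
            * complex_of_real (mittag_leffler3 \<nu> (\<nu> * b) b (- ((y * r) powr \<nu>))))
         = mb_kernel \<nu> b p * of_real r powr (- (of_real \<nu> * p)) / (\<nu> * Gamma b)"
    by (simp add: H_def)
qed

text \<open>A Parseval formula. Only the first function is expanded, on s = a + \<i> t; then \<nu>
  (a+b) - 1 - \<nu> s = \<nu> p - 1 with p = a + b - s = b - \<i> t, and the y-integral is the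
  Mellin transform of the second function at p.\<close>

lemma mittag_leffler3_product_integral:
  assumes \<nu>: "0 < \<nu>" "\<nu> \<le> 1" and ab: "a > 0" "b > 0" and qr: "q > 0" "r > 0"
  shows "complex_of_real (LINT y:{0<..}|lborel. y powr (\<nu> * (a + b) - 1)
            * mittag_leffler3 \<nu> (\<nu> * a) a (- ((y * q) powr \<nu>))
            * mittag_leffler3 \<nu> (\<nu> * b) b (- ((y * r) powr \<nu>)))
      = 1 / (2 * pi * \<nu> * Gamma a * Gamma b) *
        (\<integral>t. mb_kernel \<nu> a (Complex a t) * mb_kernel \<nu> b (Complex b (-t)) *
          (of_real q powr (- (of_real \<nu> * Complex a t)) * of_real r powr (- (of_real \<nu> * Complex b (-t)))) \<partial>lborel)"
proof -
  define \<phi> where "\<phi> = (\<lambda>y. complex_of_real (mittag_leffler3 \<nu> (\<nu> * a) a (- ((y * q) powr \<nu>))))"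
  define W where "W = (\<lambda>y. of_real (y powr (\<nu> * (a + b) - 1)) * complex_of_real (mittag_leffler3 \<nu> (\<nu> * b) b (- ((y * r) powr \<nu>))))"
  define H where "H = (\<lambda>s. mb_kernel \<nu> a s * of_real q powr (- (of_real \<nu> * s)) / (2 * pi * Gamma a))"
  have G: "Gamma a > 0" "Gamma b > 0" using ab by (auto intro: Gamma_real_pos)
  obtain C where C: "\<And>s. a \<le> Re s \<Longrightarrow> Re s \<le> a \<Longrightarrow> norm (H s) \<le> C / (1 + (Im s)\<^sup>2)"
    using mb_kernel_scaled_decay[OF \<nu> ab(1) _ qr(1), of a a "2 * pi * Gamma a"] unfolding H_def by auto
  have "H holomorphic_on {s. Re s = a}"
    unfolding H_def using ab qr G
    by (intro holomorphic_intros holomorphic_mb_kernel) auto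
  hence int: "integrable lborel (\<lambda>t. H (Complex a t))"
    by (intro integrable_vertical_line[where C = C] holomorphic_on_imp_continuous_on) (auto intro: C)
  have W: "W y * of_real y powr (- (of_real \<nu> * Complex a t)) = of_real y powr (of_real \<nu> * Complex b (-t) - 1)
       * complex_of_real (mittag_leffler3 \<nu> (\<nu> * b) b (- ((y * r) powr \<nu>)))" if "y > 0" for y t
  proof -
    have e: "of_real \<nu> * Complex b (-t) - 1 = of_real (\<nu> * (a + b) - 1) + (- (of_real \<nu> * Complex a t))"
      by (simp add: complex_eq_iff algebra_simps)
    have "of_real y powr (of_real \<nu> * Complex b (-t) - 1) =
        of_real y powr of_real (\<nu> * (a + b) - 1) * of_real y powr (- (of_real \<nu> * Complex a t))"
      unfolding e by (rule powr_add)
    also have "of_real y powr of_real (\<nu> * (a + b) - 1) = complex_of_real (y powr (\<nu> * (a + b) - 1))"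
      using that by (intro powr_of_real) auto
    finally show ?thesis by (simp add: W_def)
  qed
  have Wint: "set_integrable lborel {0<..} (\<lambda>y. W y * of_real y powr (- (of_real \<nu> * of_real a)))"
  proof -
    have "set_integrable lborel {0<..} (\<lambda>y. of_real y powr (of_real \<nu> * Complex b (-0) - 1)
            * complex_of_real (mittag_leffler3 \<nu> (\<nu> * b) b (- ((y * r) powr \<nu>))))"
      using ab by (intro mittag_leffler3_Mellin_transform(1) \<nu> qr) auto
    moreover have "complex_of_real a = Complex a 0" by (simp add: complex_eq_iff)
    ultimately show ?thesis
      by (subst set_integrable_cong[OF refl refl]) (use W[of _ 0] in auto)
  qed
  have \<phi>: "\<phi> y = (\<integral>t. H (Complex a t) * of_real y powr (- (of_real \<nu> * Complex a t)) \<partial>lborel)" if "y \<in> {0<..}" for y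
    unfolding \<phi>_def H_def using that ab
    by (intro mittag_leffler3_Mellin_Barnes_scaled \<nu> qr) auto
  have "complex_of_real (LINT y:{0<..}|lborel. y powr (\<nu> * (a + b) - 1)
            * mittag_leffler3 \<nu> (\<nu> * a) a (- ((y * q) powr \<nu>))
            * mittag_leffler3 \<nu> (\<nu> * b) b (- ((y * r) powr \<nu>)))
      = (LINT y:{0<..}|lborel. W y * \<phi> y)"
    unfolding set_integral_complex_of_real[symmetric]
    by (intro set_lebesgue_integral_cong) (auto simp: W_def \<phi>_def)
  also have "\<dots> = (\<integral>t. H (Complex a t) * (LINT y:{0<..}|lborel. W y * of_real y powr (- (of_real \<nu> * Complex a t))) \<partial>lborel)"
    by (rule Fubini_Mellin(2)[OF _ _ int Wint \<phi>]) auto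
  also have "\<dots> = (\<integral>t. 1 / (2 * pi * \<nu> * Gamma a * Gamma b) *
         (mb_kernel \<nu> a (Complex a t) * mb_kernel \<nu> b (Complex b (-t)) *
          (of_real q powr (- (of_real \<nu> * Complex a t)) * of_real r powr (- (of_real \<nu> * Complex b (-t))))) \<partial>lborel)"
  proof (intro Bochner_Integration.integral_cong refl)
    fix t
    have "(LINT y:{0<..}|lborel. W y * of_real y powr (- (of_real \<nu> * Complex a t))) =
        (LINT y:{0<..}|lborel. of_real y powr (of_real \<nu> * Complex b (-t) - 1)
            * complex_of_real (mittag_leffler3 \<nu> (\<nu> * b) b (- ((y * r) powr \<nu>))))"
      by (intro set_lebesgue_integral_cong) (auto simp: W)
    also have "\<dots> = mb_kernel \<nu> b (Complex b (-t)) * of_real r powr (- (of_real \<nu> * Complex b (-t))) / (\<nu> * Gamma b)"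
      using ab by (intro mittag_leffler3_Mellin_transform(2) \<nu> qr) auto
    finally show "H (Complex a t) * (LINT y:{0<..}|lborel. W y * of_real y powr (- (of_real \<nu> * Complex a t))) =
        1 / (2 * pi * \<nu> * Gamma a * Gamma b) *
         (mb_kernel \<nu> a (Complex a t) * mb_kernel \<nu> b (Complex b (-t)) *
          (of_real q powr (- (of_real \<nu> * Complex a t)) * of_real r powr (- (of_real \<nu> * Complex b (-t)))))"
      by (simp add: H_def mult_ac)
  qed
  also have "\<dots> = 1 / (2 * pi * \<nu> * Gamma a * Gamma b) *
        (\<integral>t. mb_kernel \<nu> a (Complex a t) * mb_kernel \<nu> b (Complex b (-t)) *
          (of_real q powr (- (of_real \<nu> * Complex a t)) * of_real r powr (- (of_real \<nu> * Complex b (-t)))) \<partial>lborel)"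
    by (rule integral_mult_right_zero)
  finally show ?thesis .
qed

section \<open>Independence of the contour\<close>

lemma vertical_line_C1: "(\<lambda>t. Complex g t) C1_differentiable_on S"
  unfolding C1_differentiable_on_def
proof (intro exI[of _ "\<lambda>_. \<i>"] conjI ballI)
  fix t :: real
  have "((\<lambda>t. of_real g + \<i> * of_real t) has_vector_derivative \<i>) (at t)"
    by (auto intro!: derivative_eq_intros)
  thus "((\<lambda>t. Complex g t) has_vector_derivative \<i>) (at t)"
    by (simp add: Complex_eq)
qed auto

text \<open>The \<open>T\<close> in \<open>vertical_contour\<close> may be negative, and then the
  contour is a full line; hence the absolute value in the proof. Larger intervals are reached by
  gluing pieces of the line on at -T and T.\<close>

lemma vertical_contourE:
  assumes "vertical_contour \<gamma> L"
  obtains T where "T \<ge> 0" "\<And>t. \<bar>t\<bar> \<ge> T \<Longrightarrow> L t = Complex \<gamma> t"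
    "\<And>R. R \<ge> T \<Longrightarrow> L piecewise_C1_differentiable_on {-R..R}"
proof -
  obtain T0 where T0: "L piecewise_C1_differentiable_on {-T0..T0}" "\<And>t. \<bar>t\<bar> \<ge> T0 \<Longrightarrow> L t = Complex \<gamma> t"
    using assms unfolding vertical_contour_def by auto
  define T where "T = \<bar>T0\<bar>"
  have L: "L t = Complex \<gamma> t" if "\<bar>t\<bar> \<ge> T" for t
    using T0(2) that by (simp add: T_def)
  have pT: "L piecewise_C1_differentiable_on {-T..T}"
  proof (cases "T0 \<ge> 0")
    case True
    thus ?thesis using T0(1) by (simp add: T_def)
  next
    case False
    hence "L = (\<lambda>t. Complex \<gamma> t)" using T0(2) by (intro ext) auto
    thus ?thesis using vertical_line_C1 C1_differentiable_imp_piecewise by blast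
  qed
  have "L piecewise_C1_differentiable_on {-R..R}" if "R \<ge> T" for R
  proof -
    have T: "T \<ge> 0" by (simp add: T_def)
    have line: "(\<lambda>t. Complex \<gamma> t) piecewise_C1_differentiable_on S" for S
      using vertical_line_C1 C1_differentiable_imp_piecewise by blast
    have 1: "(\<lambda>t. if t \<le> T then L t else Complex \<gamma> t) piecewise_C1_differentiable_on {-T..R}"
      using pT line that L[of T] T by (intro piecewise_C1_differentiable_cases) auto
    have "(\<lambda>t. if t \<le> -T then Complex \<gamma> t else if t \<le> T then L t else Complex \<gamma> t) piecewise_C1_differentiable_on {-R..R}"
      by (rule piecewise_C1_differentiable_cases[where g = "\<lambda>t. if t \<le> T then L t else Complex \<gamma> t"])
         (use 1 line that L[of "-T"] T in auto)
    also have "(\<lambda>t. if t \<le> -T then Complex \<gamma> t else if t \<le> T then L t else Complex \<gamma> t) = L"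
      using L by (auto simp: fun_eq_iff)
    finally show ?thesis .
  qed
  thus ?thesis using that[of T] L by (auto simp: T_def)
qed

lemma vertical_contour_bounded_Re:
  assumes "vertical_contour \<gamma> L"
  obtains K where "K > 0" "\<And>t. \<bar>Re (L t)\<bar> \<le> K"
proof -
  obtain T where T: "T \<ge> 0" "\<And>t. \<bar>t\<bar> \<ge> T \<Longrightarrow> L t = Complex \<gamma> t" "L piecewise_C1_differentiable_on {-T..T}"
    using vertical_contourE[OF assms] by (metis order_refl)
  have "continuous_on {-T..T} L" using T(3) by (simp add: piecewise_C1_differentiable_on_def)
  hence "bounded (L ` {-T..T})" by (intro compact_imp_bounded compact_continuous_image) auto
  then obtain B where B: "\<And>t. t \<in> {-T..T} \<Longrightarrow> norm (L t) \<le> B"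
    unfolding bounded_iff by (metis imageI)
  have "\<bar>Re (L t)\<bar> \<le> max 1 (max B \<bar>\<gamma>\<bar>)" for t
  proof (cases "\<bar>t\<bar> \<ge> T")
    case False
    hence "norm (L t) \<le> B" by (intro B) auto
    thus ?thesis using abs_Re_le_cmod[of "L t"] by linarith
  qed (simp add: T(2))
  thus ?thesis using that[of "max 1 (max B \<bar>\<gamma>\<bar>)"] by auto
qed

text \<open>The range is a compact middle part with two closed rays. Openness of the complement
  later turns connected components into path components.\<close>

lemma closed_range_vertical_contour:
  assumes "vertical_contour \<gamma> L"
  shows "closed (range L)"
proof -
  obtain T where T: "T \<ge> 0" "\<And>t. \<bar>t\<bar> \<ge> T \<Longrightarrow> L t = Complex \<gamma> t" "L piecewise_C1_differentiable_on {-T..T}"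
    using vertical_contourE[OF assms] by (metis order_refl)
  have "range L = L ` {-T..T} \<union> ({z. Re z = \<gamma>} \<inter> {z. \<bar>Im z\<bar> \<ge> T})"
  proof (intro equalityI subsetI)
    fix z assume "z \<in> range L"
    then obtain t where t: "z = L t" by auto
    thus "z \<in> L ` {-T..T} \<union> ({z. Re z = \<gamma>} \<inter> {z. \<bar>Im z\<bar> \<ge> T})"
    proof (cases "\<bar>t\<bar> \<ge> T")
      case False
      hence "t \<in> {-T..T}" by auto
      thus ?thesis unfolding t by blast
    qed (simp add: t T(2))
  next
    fix z assume "z \<in> L ` {-T..T} \<union> ({z. Re z = \<gamma>} \<inter> {z. \<bar>Im z\<bar> \<ge> T})"
    thus "z \<in> range L"
    proof
      assume "z \<in> {z. Re z = \<gamma>} \<inter> {z. \<bar>Im z\<bar> \<ge> T}"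
      hence "z = L (Im z)" using T(2)[of "Im z"] by (simp add: complex_eq_iff)
      thus ?thesis by (metis rangeI)
    qed auto
  qed
  moreover have "compact (L ` {-T..T})"
    using T(3) by (intro compact_continuous_image) (auto simp: piecewise_C1_differentiable_on_def)
  moreover have "closed ({z. Re z = \<gamma>} \<inter> {z. \<bar>Im z\<bar> \<ge> T})"
    by (intro closed_Int closed_Collect_eq closed_Collect_le continuous_intros)
  ultimately show ?thesis by (simp add: compact_imp_closed closed_Un)
qed

text \<open>Contour integrals and winding numbers live on paths over [0,1], whereas a contour is
  parametrised by the whole line; hence this affine transport of its truncation.\<close>

definition contour_segment :: "(real \<Rightarrow> complex) \<Rightarrow> real \<Rightarrow> real \<Rightarrow> complex" where
  "contour_segment L R = L \<circ> (\<lambda>u. (2 * R) *\<^sub>R u + (- R))"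

lemma path_image_contour_segment:
  assumes "R > 0"
  shows "path_image (contour_segment L R) = L ` {-R..R}"
proof -
  have "(\<lambda>u. (2 * R) *\<^sub>R u + (- R)) ` {0..1} = {-R..R}"
    using assms by (simp add: image_affinity_atLeastAtMost_diff)
  thus ?thesis unfolding path_image_def contour_segment_def by (simp only: image_comp[symmetric])
qed

lemma valid_path_contour_segment:
  assumes "L piecewise_C1_differentiable_on {-R..R}" "R > 0"
  shows "valid_path (contour_segment L R)"
proof -
  have "(\<lambda>u. (2 * R) * u + (- R)) ` {0..1} = {-R..R}"
    using assms by (simp add: image_affinity_atLeastAtMost_diff)
  thus ?thesis
    unfolding valid_path_def contour_segment_def
    using assms by (intro piecewise_C1_differentiable_affine) simp
qed

lemma has_contour_integral_contour_segment:
  assumes L: "L piecewise_C1_differentiable_on {-R..R}" and "R > 0"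
    and I: "((\<lambda>t. F (L t) * vector_derivative L (at t)) has_integral I) {-R..R}"
  shows "(F has_contour_integral I) (contour_segment L R)"
proof -
  obtain S where S: "finite S" "L C1_differentiable_on ({-R..R} - S)"
    using L by (auto simp: piecewise_C1_differentiable_on_def)
  \<comment> \<open>Preimages of the corners of \<open>L\<close> under the affine map; off this
    finite set the chain rule gives the derivative.\<close>
  define S' where "S' = (\<lambda>t. (t + R) / (2 * R)) ` S"
  have "((\<lambda>u. F (L ((2 * R) *\<^sub>R u + (- R))) * vector_derivative L (at ((2 * R) *\<^sub>R u + (- R))))
      has_integral I /\<^sub>R (2 * R)) (cbox ((- R - - R) /\<^sub>R (2 * R)) ((R - - R) /\<^sub>R (2 * R)))"
    using has_integral_affinity'[of "\<lambda>t. F (L t) * vector_derivative L (at t)" I "-R" R "2 * R" "-R"] I \<open>R > 0\<close>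
    by simp
  hence "((\<lambda>u. F (L ((2 * R) *\<^sub>R u + (- R))) * vector_derivative L (at ((2 * R) *\<^sub>R u + (- R))))
      has_integral I /\<^sub>R (2 * R)) {0..1}"
    using \<open>R > 0\<close> by simp
  from has_integral_cmul[OF this, of "2 * R"]
  have int: "((\<lambda>u. (2 * R) *\<^sub>R (F (L ((2 * R) *\<^sub>R u + (- R))) * vector_derivative L (at ((2 * R) *\<^sub>R u + (- R)))))
      has_integral I) {0..1}"
    using \<open>R > 0\<close> by simp
  have eq: "F (contour_segment L R u) * vector_derivative (contour_segment L R) (at u within {0..1})
      = (2 * R) *\<^sub>R (F (L ((2 * R) *\<^sub>R u + (- R))) * vector_derivative L (at ((2 * R) *\<^sub>R u + (- R))))"
    if u: "u \<in> {0..1} - S'" for u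
  proof -
    define t where "t = (2 * R) *\<^sub>R u + (- R)"
    have "u = (t + R) / (2 * R)" using \<open>R > 0\<close> by (simp add: t_def)
    hence "t \<notin> S" using u by (auto simp: S'_def)
    moreover have "t \<in> {-R..R}"
    proof -
      have "0 \<le> 2 * R * u" "2 * R * u \<le> 2 * R * 1"
        using u \<open>R > 0\<close> by (auto intro!: mult_left_mono)
      thus ?thesis by (simp add: t_def)
    qed
    ultimately have "t \<in> {-R..R} - S" by simp
    then obtain D where D: "(L has_vector_derivative D) (at t)"
      using S(2) unfolding C1_differentiable_on_def by blast
    have "((\<lambda>u. (2 * R) *\<^sub>R u + (- R)) has_vector_derivative 2 * R) (at u)"
      by (auto intro!: derivative_eq_intros)
    from vector_diff_chain_at[OF this D[unfolded t_def]]
    have "(contour_segment L R has_vector_derivative (2 * R) *\<^sub>R D) (at u)"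
      by (simp add: contour_segment_def)
    hence "vector_derivative (contour_segment L R) (at u within {0..1}) = (2 * R) *\<^sub>R D"
      using u by (intro vector_derivative_at_within_ivl) auto
    moreover have "vector_derivative L (at t) = D" using D by (rule vector_derivative_at)
    moreover have "contour_segment L R u = L t" by (simp add: contour_segment_def t_def)
    ultimately show ?thesis unfolding t_def[symmetric] by simp
  qed
  have "finite S'" using S(1) by (simp add: S'_def)
  thus ?thesis
    unfolding has_contour_integral_def by (rule has_integral_spike_finite[OF _ eq int])
qed

text \<open>Closing the truncated contour far to the right makes the winding number vanish at every point to its
  left, and vice versa.\<close>

definition closing_path :: "real \<Rightarrow> real \<Rightarrow> real \<Rightarrow> real \<Rightarrow> complex" where
  "closing_path \<gamma> R X = linepath (Complex \<gamma> R) (Complex X R) +++ linepath (Complex X R) (Complex X (-R))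
     +++ linepath (Complex X (-R)) (Complex \<gamma> (-R))"

lemma closing_path_props [simp]:
  "path (closing_path \<gamma> R X)" "pathstart (closing_path \<gamma> R X) = Complex \<gamma> R"
  "pathfinish (closing_path \<gamma> R X) = Complex \<gamma> (-R)"
  by (simp_all add: closing_path_def)

lemma path_image_closing_path:
  "path_image (closing_path \<gamma> R X) =
     closed_segment (Complex \<gamma> R) (Complex X R) \<union> closed_segment (Complex X R) (Complex X (-R))
     \<union> closed_segment (Complex X (-R)) (Complex \<gamma> (-R))"
  by (simp add: closing_path_def path_image_join Un_assoc)

text \<open>A path h joins p to x in the complement of the contour. Being bounded, it also avoids
  the closing path for large R, so p and x have the same winding number, and x lies outside a
  half-plane that contains the closed curve. The sign \<open>\<sigma>\<close> treats both directions
  of closing at once: 1 to the right, -1 to the left.\<close>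

lemma winding_number_closed_contour:
  assumes L: "vertical_contour \<gamma> L" and \<sigma>: "\<sigma> = 1 \<or> \<sigma> = -1"
    and K: "\<And>t. \<bar>Re (L t)\<bar> \<le> K"
    and x: "\<sigma> * x < - K" and cc: "connected_component (- range L) p (of_real x)"
  shows "\<forall>\<^sub>F R in at_top. p \<notin> path_image (closing_path \<gamma> R (\<sigma> * R)) \<and>
           winding_number (contour_segment L R +++ closing_path \<gamma> R (\<sigma> * R)) p = 0"
proof -
  obtain T where T: "T \<ge> 0" "\<And>t. \<bar>t\<bar> \<ge> T \<Longrightarrow> L t = Complex \<gamma> t"
      "\<And>R. R \<ge> T \<Longrightarrow> L piecewise_C1_differentiable_on {-R..R}"
    using vertical_contourE[OF L] by blast
  have "open (- range L)" using closed_range_vertical_contour[OF L] by (rule open_Compl)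
  hence "path_component (- range L) p (of_real x)"
    using cc by (simp add: path_component_eq_connected_component open_imp_locally_path_connected)
  then obtain h where h: "path h" "path_image h \<subseteq> - range L" "pathstart h = p" "pathfinish h = of_real x"
    unfolding path_component_def by auto
  have "bounded (path_image h)" using h(1) by (rule bounded_path_image)
  then obtain B where B: "\<And>z. z \<in> path_image h \<Longrightarrow> norm z \<le> B" unfolding bounded_iff by auto
  have ends: "p \<in> path_image h" "of_real x \<in> path_image h"
    using h(3,4) by (metis pathstart_in_path_image, metis pathfinish_in_path_image)
  have \<gamma>: "\<bar>\<gamma>\<bar> \<le> K" using K[of T] T(1) by (simp add: T(2))
  have "p \<notin> path_image (closing_path \<gamma> R (\<sigma> * R)) \<and>
        winding_number (contour_segment L R +++ closing_path \<gamma> R (\<sigma> * R)) p = 0"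
    if R: "R > max (max T B) (max K 0)" for R
  proof -
    have R': "R > 0" "R > T" "R > B" "R > K" using R by auto
    have pL: "L piecewise_C1_differentiable_on {-R..R}" using R' T by auto
    note vp = valid_path_contour_segment[OF pL R'(1)]
    let ?C = "contour_segment L R +++ closing_path \<gamma> R (\<sigma> * R)"
    have st: "pathstart (contour_segment L R) = Complex \<gamma> (-R)" "pathfinish (contour_segment L R) = Complex \<gamma> R"
      using T(2)[of R] T(2)[of "-R"] R' by (simp_all add: contour_segment_def pathstart_def pathfinish_def)
    have pC: "path ?C" "pathfinish ?C = pathstart ?C"
      using vp st by (simp_all add: valid_path_imp_path)
    \<comment> \<open>Each point of the closing path has height R or -R or real part \<sigma> R, out
      of reach of h, and stays in the half-plane.\<close>
    have cl: "(\<bar>Im z\<bar> = R \<or> Re z = \<sigma> * R) \<and> - K \<le> \<sigma> * Re z" if "z \<in> path_image (closing_path \<gamma> R (\<sigma> * R))" for z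
      using that R' \<gamma> \<sigma> unfolding path_image_closing_path
      by (auto simp: closed_segment_same_Im closed_segment_same_Re closed_segment_eq_real_ivl split: if_splits)
    have dis: "path_image h \<inter> path_image (closing_path \<gamma> R (\<sigma> * R)) = {}"
    proof (rule ccontr)
      assume "\<not> ?thesis"
      then obtain z where z: "z \<in> path_image h" "z \<in> path_image (closing_path \<gamma> R (\<sigma> * R))" by auto
      have "\<bar>Re z\<bar> \<le> B" "\<bar>Im z\<bar> \<le> B"
        using B[OF z(1)] abs_Re_le_cmod[of z] abs_Im_le_cmod[of z] by linarith+
      thus False using cl[OF z(2)] R' \<sigma> by auto
    qed
    have pi: "path_image ?C = path_image (contour_segment L R) \<union> path_image (closing_path \<gamma> R (\<sigma> * R))"
      using st by (simp add: path_image_join)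
    have seg: "path_image (contour_segment L R) \<subseteq> range L"
      using R' by (auto simp: path_image_contour_segment)
    have dis2: "path_image h \<inter> path_image ?C = {}"
      using dis seg h(2) unfolding pi by blast
    have "winding_number ?C p = winding_number ?C (of_real x)"
      by (rule winding_number_eq[OF pC ends _ dis2]) (use h(1) in \<open>simp add: connected_path_image\<close>)
    also have "\<dots> = 0"
    proof (rule winding_number_zero_outside[OF pC(1) _ pC(2)])
      show "convex {z. - K \<le> \<sigma> * Re z}"
      proof -
        have "{z. - K \<le> \<sigma> * Re z} = {z. complex_of_real \<sigma> \<bullet> z \<ge> - K}"
          by (simp add: inner_complex_def)
        thus ?thesis by (simp only: convex_halfspace_ge)
      qed
      show "of_real x \<notin> {z. - K \<le> \<sigma> * Re z}" using x by simp
      show "path_image ?C \<subseteq> {z. - K \<le> \<sigma> * Re z}"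
      proof
        fix z assume "z \<in> path_image ?C"
        thus "z \<in> {z. - K \<le> \<sigma> * Re z}"
          unfolding pi
        proof
          assume "z \<in> path_image (contour_segment L R)"
          then obtain t where "z = L t" using seg by auto
          thus ?thesis using K[of t] \<sigma> by auto
        qed (use cl in auto)
      qed
    qed
    finally show ?thesis using dis ends by auto
  qed
  thus ?thesis by (auto intro!: eventually_mono[OF eventually_gt_at_top[of "max (max T B) (max K 0)"]])
qed

text \<open>The degenerate triangle lies on a horizontal line, a convex set without p, so its
  winding number is 0.\<close>

lemma winding_number_triangle_horizontal:
  assumes "Im p \<noteq> y"
  shows "winding_number (linepath (Complex a y) (Complex b y)) p + winding_number (linepath (Complex b y) (Complex c y)) p
       = winding_number (linepath (Complex a y) (Complex c y)) p"
proof -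
  have seg: "closed_segment (Complex a' y) (Complex b' y) \<subseteq> {z. Im z = y}" for a' b'
    by (auto simp: closed_segment_same_Im)
  hence n: "p \<notin> closed_segment (Complex a' y) (Complex b' y)" for a' b'
    using assms by blast
  let ?l = "\<lambda>a b. linepath (Complex a y) (Complex b y)"
  have conv: "convex {z. Im z = y}"
  proof -
    have "{z. Im z = y} = {z. \<i> \<bullet> z = y}" by (simp add: inner_complex_def)
    thus ?thesis by (simp only: convex_hyperplane)
  qed
  have "winding_number (?l a b +++ ?l b c +++ ?l c a) p = 0"
    by (rule winding_number_zero_outside[OF _ conv]) (use assms seg in \<open>auto simp: path_image_join\<close>)
  hence "winding_number (?l a b) p + winding_number (?l b c) p + winding_number (?l c a) p = 0"
    using n by (simp add: winding_number_join path_image_join add.assoc)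
  moreover have "winding_number (?l c a) p = - winding_number (?l a c) p"
    using winding_number_reversepath[of "?l a c" p] n by simp
  ultimately show ?thesis by (simp add: algebra_simps)
qed

text \<open>Up along \<open>L1\<close> and down along \<open>L2\<close>: its contour integral is the
  difference of the two truncated integrals plus two horizontal pieces, which vanish in the
  limit.\<close>

definition contour_loop :: "(real \<Rightarrow> complex) \<Rightarrow> real \<Rightarrow> (real \<Rightarrow> complex) \<Rightarrow> real \<Rightarrow> real \<Rightarrow> real \<Rightarrow> complex" where
  "contour_loop L1 \<gamma>1 L2 \<gamma>2 R = contour_segment L1 R +++ linepath (Complex \<gamma>1 R) (Complex \<gamma>2 R) +++
     reversepath (contour_segment L2 R) +++ linepath (Complex \<gamma>2 (-R)) (Complex \<gamma>1 (-R))"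

text \<open>Both closing paths share the side Re = X, which cancels, and their horizontal pieces
  combine by the degenerate triangle. So the winding number of the loop is the difference of those
  of the two closed contours.\<close>

lemma winding_number_contour_loop_zero:
  assumes path: "path (contour_segment L1 R)" "path (contour_segment L2 R)"
    and ends: "pathstart (contour_segment L1 R) = Complex \<gamma>1 (-R)" "pathfinish (contour_segment L1 R) = Complex \<gamma>1 R"
      "pathstart (contour_segment L2 R) = Complex \<gamma>2 (-R)" "pathfinish (contour_segment L2 R) = Complex \<gamma>2 R"
    and p: "Im p \<noteq> R" "Im p \<noteq> - R" "p \<notin> path_image (contour_segment L1 R)" "p \<notin> path_image (contour_segment L2 R)"
      "p \<notin> path_image (closing_path \<gamma>1 R X)" "p \<notin> path_image (closing_path \<gamma>2 R X)"
    and w: "winding_number (contour_segment L1 R +++ closing_path \<gamma>1 R X) p = 0"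
      "winding_number (contour_segment L2 R +++ closing_path \<gamma>2 R X) p = 0"
  shows "winding_number (contour_loop L1 \<gamma>1 L2 \<gamma>2 R) p = 0"
proof -
  let ?w = "\<lambda>a b. winding_number (linepath a b) p"
  have seg: "closed_segment (Complex a' y) (Complex b' y) \<subseteq> {z. Im z = y}" for a' b' y
    by (auto simp: closed_segment_same_Im)
  hence n: "p \<notin> closed_segment (Complex a' R) (Complex b' R)" "p \<notin> closed_segment (Complex a' (-R)) (Complex b' (-R))" for a' b'
    using p by blast+
  have exp: "winding_number (contour_segment L R) p + (?w (Complex \<gamma> R) (Complex X R) + (?w (Complex X R) (Complex X (-R))
      + ?w (Complex X (-R)) (Complex \<gamma> (-R)))) = 0"
    if "path (contour_segment L R)" "pathfinish (contour_segment L R) = Complex \<gamma> R" "p \<notin> path_image (contour_segment L R)"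
       "p \<notin> path_image (closing_path \<gamma> R X)" "winding_number (contour_segment L R +++ closing_path \<gamma> R X) p = 0" for L \<gamma>
    using that unfolding path_image_closing_path
    by (simp add: winding_number_join path_image_closing_path) (simp add: closing_path_def winding_number_join path_image_join)
  note e1 = exp[OF path(1) ends(2) p(3,5) w(1)] and e2 = exp[OF path(2) ends(4) p(4,6) w(2)]
  have t1: "?w (Complex \<gamma>1 R) (Complex \<gamma>2 R) + ?w (Complex \<gamma>2 R) (Complex X R) = ?w (Complex \<gamma>1 R) (Complex X R)"
    using p by (intro winding_number_triangle_horizontal) auto
  have t2: "?w (Complex X (-R)) (Complex \<gamma>2 (-R)) + ?w (Complex \<gamma>2 (-R)) (Complex \<gamma>1 (-R)) = ?w (Complex X (-R)) (Complex \<gamma>1 (-R))"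
    using p by (intro winding_number_triangle_horizontal) auto
  have "winding_number (contour_loop L1 \<gamma>1 L2 \<gamma>2 R) p =
      winding_number (contour_segment L1 R) p + (?w (Complex \<gamma>1 R) (Complex \<gamma>2 R)
       + (- winding_number (contour_segment L2 R) p + ?w (Complex \<gamma>2 (-R)) (Complex \<gamma>1 (-R))))"
    unfolding contour_loop_def using path ends p n
    by (simp add: winding_number_join path_image_join winding_number_reversepath)
  also have "\<dots> = 0"
  proof -
    have a1: "winding_number (contour_segment L1 R) p = - (?w (Complex \<gamma>1 R) (Complex X R) + (?w (Complex X R) (Complex X (-R))
      + ?w (Complex X (-R)) (Complex \<gamma>1 (-R))))" using e1 by (simp only: add_eq_0_iff2)
    have a2: "winding_number (contour_segment L2 R) p = - (?w (Complex \<gamma>2 R) (Complex X R) + (?w (Complex X R) (Complex X (-R))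
      + ?w (Complex X (-R)) (Complex \<gamma>2 (-R))))" using e2 by (simp only: add_eq_0_iff2)
    show ?thesis unfolding a1 a2 t1[symmetric] t2[symmetric] by (simp add: algebra_simps)
  qed
  finally show ?thesis .
qed

text \<open>The homology form of Cauchy's theorem on \<open>contour_loop\<close>. Singularities with
  |Re p| \<le> K have winding number 0 by the hypothesis on sides, the others because the loop stays
  in that strip. Only truncated integrals are compared, so conditional convergence is
  enough.\<close>

lemma vertical_contour_integral_unique:
  fixes F :: "complex \<Rightarrow> complex"
  assumes L1: "vertical_contour \<gamma>1 L1" and L2: "vertical_contour \<gamma>2 L2"
    and hol: "F holomorphic_on - P" and "closed P"
    and real: "\<And>p. p \<in> P \<Longrightarrow> Im p = 0"
    and fin: "\<And>K. finite {p \<in> P. \<bar>Re p\<bar> \<le> K}"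
    and sides: "\<And>p. p \<in> P \<Longrightarrow> left_of_contour L1 p \<and> left_of_contour L2 p \<or> right_of_contour L1 p \<and> right_of_contour L2 p"
    and decay: "\<And>K e. e > 0 \<Longrightarrow> \<forall>\<^sub>F R in at_top. \<forall>s. \<bar>Re s\<bar> \<le> K \<and> \<bar>Im s\<bar> = R \<longrightarrow> norm (F s) \<le> e"
    and I1: "((\<lambda>t. F (L1 t) * vector_derivative L1 (at t)) has_integral I1) UNIV"
    and I2: "((\<lambda>t. F (L2 t) * vector_derivative L2 (at t)) has_integral I2) UNIV"
  shows "I1 = I2"
proof -
  obtain T1 where T1: "T1 \<ge> 0" "\<And>t. \<bar>t\<bar> \<ge> T1 \<Longrightarrow> L1 t = Complex \<gamma>1 t"
      "\<And>R. R \<ge> T1 \<Longrightarrow> L1 piecewise_C1_differentiable_on {-R..R}"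
    using vertical_contourE[OF L1] by blast
  obtain T2 where T2: "T2 \<ge> 0" "\<And>t. \<bar>t\<bar> \<ge> T2 \<Longrightarrow> L2 t = Complex \<gamma>2 t"
      "\<And>R. R \<ge> T2 \<Longrightarrow> L2 piecewise_C1_differentiable_on {-R..R}"
    using vertical_contourE[OF L2] by blast
  obtain K1 where K1: "K1 > 0" "\<And>t. \<bar>Re (L1 t)\<bar> \<le> K1" using vertical_contour_bounded_Re[OF L1] by blast
  obtain K2 where K2: "K2 > 0" "\<And>t. \<bar>Re (L2 t)\<bar> \<le> K2" using vertical_contour_bounded_Re[OF L2] by blast
  define K where "K = max K1 K2"
  have K: "\<bar>Re (L1 t)\<bar> \<le> K" "\<bar>Re (L2 t)\<bar> \<le> K" for t
    using K1(2)[of t] K2(2)[of t] by (auto simp: K_def)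
  have \<gamma>: "\<bar>\<gamma>1\<bar> \<le> K" "\<bar>\<gamma>2\<bar> \<le> K"
    using K(1)[of T1] K(2)[of T2] T1(1) T2(1) by (simp_all add: T1(2) T2(2))
  \<comment> \<open>Having a side means lying in a component of the complement, hence not on the
    contour.\<close>
  have off: "p \<notin> range L1 \<and> p \<notin> range L2" if "p \<in> P" for p
  proof -
    have "L t \<noteq> p" if "left_of_contour L p \<or> right_of_contour L p" for L t
    proof -
      have "\<exists>x. connected_component (- range L) p (complex_of_real x)"
        using that eventually_happens[of _ at_bot] eventually_happens[of _ at_top]
        unfolding left_of_contour_def right_of_contour_def by (metis trivial_limit_at_bot_linorder trivial_limit_at_top_linorder)
      thus ?thesis using connected_component_in by fastforce
    qed
    thus ?thesis using sides[OF that] by blast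
  qed
  define ok where "ok = (\<lambda>\<sigma> R \<gamma> L p. p \<notin> path_image (closing_path \<gamma> R (\<sigma> * R)) \<and>
           winding_number (contour_segment L R +++ closing_path \<gamma> R (\<sigma> * R)) p = 0)"
  have left: "\<forall>\<^sub>F R in at_top. ok 1 R \<gamma> L p"
    if "vertical_contour \<gamma> L" "\<And>t. \<bar>Re (L t)\<bar> \<le> K" "left_of_contour L p" for \<gamma> L p
  proof -
    have "\<forall>\<^sub>F x in at_bot. connected_component (- range L) p (complex_of_real x) \<and> x < - K"
      using that(3) eventually_gt_at_bot[of "- K"] unfolding left_of_contour_def by (rule eventually_conj)
    then obtain x where "connected_component (- range L) p (complex_of_real x)" "1 * x < - K"
      using eventually_happens[of _ at_bot] by fastforce
    thus ?thesis unfolding ok_def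
      by (intro winding_number_closed_contour[where K = K]) (use that(1,2) in auto)
  qed
  have right: "\<forall>\<^sub>F R in at_top. ok (-1) R \<gamma> L p"
    if "vertical_contour \<gamma> L" "\<And>t. \<bar>Re (L t)\<bar> \<le> K" "right_of_contour L p" for \<gamma> L p
  proof -
    have "\<forall>\<^sub>F x in at_top. connected_component (- range L) p (complex_of_real x) \<and> K < x"
      using that(3) eventually_gt_at_top[of K] unfolding right_of_contour_def by (rule eventually_conj)
    then obtain x where "connected_component (- range L) p (complex_of_real x)" "- 1 * x < - K"
      using eventually_happens[of _ at_top] by fastforce
    thus ?thesis unfolding ok_def
      by (intro winding_number_closed_contour[where K = K]) (use that(1,2) in auto)
  qed
  have "\<forall>\<^sub>F R in at_top. \<exists>\<sigma>. ok \<sigma> R \<gamma>1 L1 p \<and> ok \<sigma> R \<gamma>2 L2 p" if "p \<in> P" for p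
    using sides[OF that]
  proof
    assume "left_of_contour L1 p \<and> left_of_contour L2 p"
    hence "\<forall>\<^sub>F R in at_top. ok 1 R \<gamma>1 L1 p \<and> ok 1 R \<gamma>2 L2 p"
      using L1 L2 K by (intro eventually_conj left) auto
    thus ?thesis by (rule eventually_mono) blast
  next
    assume "right_of_contour L1 p \<and> right_of_contour L2 p"
    hence "\<forall>\<^sub>F R in at_top. ok (-1) R \<gamma>1 L1 p \<and> ok (-1) R \<gamma>2 L2 p"
      using L1 L2 K by (intro eventually_conj right) auto
    thus ?thesis by (rule eventually_mono) blast
  qed
  \<comment> \<open>Each singularity has its own threshold for R; finiteness within the strip gives
    a common one.\<close>
  hence ev_ok: "\<forall>\<^sub>F R in at_top. \<forall>p\<in>{p \<in> P. \<bar>Re p\<bar> \<le> K}. \<exists>\<sigma>. ok \<sigma> R \<gamma>1 L1 p \<and> ok \<sigma> R \<gamma>2 L2 p"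
    by (intro eventually_ball_finite fin) auto
  define J1 where "J1 = (\<lambda>R. integral {-R..R} (\<lambda>t. F (L1 t) * vector_derivative L1 (at t)))"
  define J2 where "J2 = (\<lambda>R. integral {-R..R} (\<lambda>t. F (L2 t) * vector_derivative L2 (at t)))"
  have J: "(J1 \<longlongrightarrow> I1) at_top" "(J2 \<longlongrightarrow> I2) at_top"
    unfolding J1_def J2_def using I1 I2 by (auto intro: has_integral_UNIV_tendsto)
  have bound: "norm (J1 R - J2 R) \<le> 2 * (e * (\<bar>\<gamma>1\<bar> + \<bar>\<gamma>2\<bar>))"
    if R: "R > max (max T1 T2) 0" and okR: "\<forall>p\<in>{p \<in> P. \<bar>Re p\<bar> \<le> K}. \<exists>\<sigma>. ok \<sigma> R \<gamma>1 L1 p \<and> ok \<sigma> R \<gamma>2 L2 p"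
      and dec: "\<forall>s. \<bar>Re s\<bar> \<le> K \<and> \<bar>Im s\<bar> = R \<longrightarrow> norm (F s) \<le> e" and "e > 0" for R e
  proof -
    have R': "R > 0" "R \<ge> T1" "R \<ge> T2" using R by auto
    let ?A1 = "contour_segment L1 R" and ?A2 = "contour_segment L2 R"
    let ?t = "linepath (Complex \<gamma>1 R) (Complex \<gamma>2 R)" and ?b = "linepath (Complex \<gamma>2 (-R)) (Complex \<gamma>1 (-R))"
    have vp: "valid_path ?A1" "valid_path ?A2"
      using valid_path_contour_segment T1(3)[OF R'(2)] T2(3)[OF R'(3)] R'(1) by blast+
    have st: "pathstart ?A1 = Complex \<gamma>1 (-R)" "pathfinish ?A1 = Complex \<gamma>1 R"
      "pathstart ?A2 = Complex \<gamma>2 (-R)" "pathfinish ?A2 = Complex \<gamma>2 R"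
      using T1(2)[of R] T1(2)[of "-R"] T2(2)[of R] T2(2)[of "-R"] R'
      by (simp_all add: contour_segment_def pathstart_def pathfinish_def)
    have i: "(\<lambda>t. F (L1 t) * vector_derivative L1 (at t)) integrable_on {-R..R}"
      "(\<lambda>t. F (L2 t) * vector_derivative L2 (at t)) integrable_on {-R..R}"
      using I1 I2 by (auto intro: integrable_on_subinterval has_integral_integrable)
    have c12: "(F has_contour_integral J1 R) ?A1" "(F has_contour_integral J2 R) ?A2"
      unfolding J1_def J2_def
      by (rule has_contour_integral_contour_segment[OF T1(3)[OF R'(2)] R'(1) integrable_integral[OF i(1)]],
          rule has_contour_integral_contour_segment[OF T2(3)[OF R'(3)] R'(1) integrable_integral[OF i(2)]])
    have s1: "path_image ?t \<subseteq> {z. \<bar>Re z\<bar> \<le> K \<and> \<bar>Im z\<bar> = R}" "path_image ?b \<subseteq> {z. \<bar>Re z\<bar> \<le> K \<and> \<bar>Im z\<bar> = R}"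
      using \<gamma> R' by (auto simp: closed_segment_same_Im closed_segment_eq_real_ivl split: if_splits)
    have s2: "path_image ?A1 \<subseteq> range L1" "path_image ?A2 \<subseteq> range L2"
      using R' by (auto simp: path_image_contour_segment)
    have nP: "{z. \<bar>Re z\<bar> \<le> K \<and> \<bar>Im z\<bar> = R} \<subseteq> - P" "range L1 \<subseteq> - P" "range L2 \<subseteq> - P"
      using real off R' by fastforce+
    have cF: "continuous_on (- P) F" using hol by (rule holomorphic_on_imp_continuous_on)
    have it: "F contour_integrable_on ?t" "F contour_integrable_on ?b"
      using s1 nP by (auto intro!: contour_integrable_continuous_linepath continuous_on_subset[OF cF])
    let ?C = "contour_loop L1 \<gamma>1 L2 \<gamma>2 R"
    have vC: "valid_path ?C" unfolding contour_loop_def using vp st by (auto intro!: valid_path_join)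
    have lC: "pathfinish ?C = pathstart ?C" unfolding contour_loop_def using st by simp
    have piC: "path_image ?C = path_image ?A1 \<union> (path_image ?t \<union> (path_image ?A2 \<union> path_image ?b))"
      unfolding contour_loop_def using st by (simp add: path_image_join del: path_image_linepath)
    have zero: "winding_number ?C p = 0" if "p \<notin> - P" for p
    proof (cases "\<bar>Re p\<bar> \<le> K")
      case True
      moreover have "p \<in> P" using that by simp
      ultimately obtain \<sigma> where o: "ok \<sigma> R \<gamma>1 L1 p" "ok \<sigma> R \<gamma>2 L2 p" using okR by blast
      have "Im p = 0" using that real by auto
      moreover have "p \<notin> path_image ?A1" "p \<notin> path_image ?A2" using that off[of p] s2 by auto
      ultimately show ?thesis using o R' vp st unfolding ok_def
        by (intro winding_number_contour_loop_zero[where X = "\<sigma> * R"] valid_path_imp_path) auto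
    next
      case False
      have "{z. \<bar>Re z\<bar> \<le> K} = {z. Re z \<le> K} \<inter> {z. Re z \<ge> - K}" by auto
      hence conv: "convex {z. \<bar>Re z\<bar> \<le> K}"
        by (simp only: convex_Int convex_halfspace_Re_le convex_halfspace_Re_ge)
      show ?thesis
      proof (rule winding_number_zero_outside[OF valid_path_imp_path[OF vC] conv lC])
        show "p \<notin> {z. \<bar>Re z\<bar> \<le> K}" using False by simp
        show "path_image ?C \<subseteq> {z. \<bar>Re z\<bar> \<le> K}"
          unfolding piC using s1 s2 K by (intro Un_least) auto
      qed
    qed
    have "(F has_contour_integral 0) ?C"
    proof (rule Cauchy_theorem_global[OF _ hol vC lC _ zero])
      show "open (- P)" using \<open>closed P\<close> by (rule open_Compl)
      show "path_image ?C \<subseteq> - P" unfolding piC using s1 s2 nP by (intro Un_least) auto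
    qed
    moreover have "(F has_contour_integral (J1 R + (contour_integral ?t F + (- J2 R + contour_integral ?b F)))) ?C"
      unfolding contour_loop_def using st vp it c12
      by (intro has_contour_integral_join has_contour_integral_reversepath has_contour_integral_integral)
         (auto intro!: valid_path_join)
    ultimately have "J1 R + (contour_integral ?t F + (- J2 R + contour_integral ?b F)) = 0"
      by (metis has_contour_integral_unique)
    hence "J1 R - J2 R = - (contour_integral ?t F + contour_integral ?b F)"
      by (simp add: algebra_simps add_eq_0_iff2)
    hence "norm (J1 R - J2 R) \<le> norm (contour_integral ?t F) + norm (contour_integral ?b F)"
      by (metis norm_minus_cancel norm_triangle_ineq)
    also have "\<dots> \<le> e * norm (Complex \<gamma>2 R - Complex \<gamma>1 R) + e * norm (Complex \<gamma>1 (-R) - Complex \<gamma>2 (-R))"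
      using it s1 dec \<open>e > 0\<close> by (intro add_mono contour_integral_bound_linepath) auto
    also have "norm (Complex \<gamma>2 R - Complex \<gamma>1 R) = \<bar>\<gamma>2 - \<gamma>1\<bar>" by (simp add: cmod_def)
    also have "norm (Complex \<gamma>1 (-R) - Complex \<gamma>2 (-R)) = \<bar>\<gamma>1 - \<gamma>2\<bar>" by (simp add: cmod_def)
    also have "e * \<bar>\<gamma>2 - \<gamma>1\<bar> + e * \<bar>\<gamma>1 - \<gamma>2\<bar> \<le> e * (\<bar>\<gamma>1\<bar> + \<bar>\<gamma>2\<bar>) + e * (\<bar>\<gamma>1\<bar> + \<bar>\<gamma>2\<bar>)"
      using \<open>e > 0\<close> by (intro add_mono mult_left_mono) auto
    finally show ?thesis by simp
  qed
  have "((\<lambda>R. J1 R - J2 R) \<longlongrightarrow> 0) at_top"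
  proof (rule tendstoI)
    fix d :: real assume "d > 0"
    \<comment> \<open>Makes 2 e (|\<gamma>1| + |\<gamma>2|) smaller than d; the summand 1 guards
      against \<gamma>1 = \<gamma>2 = 0.\<close>
    define e where "e = d / (4 * (\<bar>\<gamma>1\<bar> + \<bar>\<gamma>2\<bar> + 1))"
    have e: "e > 0" using \<open>d > 0\<close> by (auto simp: e_def intro!: divide_pos_pos)
    have "2 * (e * (\<bar>\<gamma>1\<bar> + \<bar>\<gamma>2\<bar>)) < d"
    proof -
      have "e * (\<bar>\<gamma>1\<bar> + \<bar>\<gamma>2\<bar> + 1) = d / 4"
      proof -
        have "\<bar>\<gamma>1\<bar> + \<bar>\<gamma>2\<bar> + 1 \<noteq> 0" by linarith
        thus ?thesis unfolding e_def by (simp add: field_simps)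
      qed
      hence "e * (\<bar>\<gamma>1\<bar> + \<bar>\<gamma>2\<bar>) + e = d / 4" by (simp add: distrib_left)
      thus ?thesis using e \<open>d > 0\<close> by linarith
    qed
    note e2 = this
    show "\<forall>\<^sub>F R in at_top. dist (J1 R - J2 R) 0 < d"
      using eventually_gt_at_top[of "max (max T1 T2) 0"] ev_ok decay[OF e, of K]
    proof eventually_elim
      case (elim R)
      have "norm (J1 R - J2 R) \<le> 2 * (e * (\<bar>\<gamma>1\<bar> + \<bar>\<gamma>2\<bar>))" by (rule bound[OF elim e])
      thus ?case using e2 by simp
    qed
  qed
  moreover have "((\<lambda>R. J1 R - J2 R) \<longlongrightarrow> I1 - I2) at_top" using J by (intro tendsto_intros)
  ultimately have "I1 - I2 = 0" by (intro tendsto_unique[OF trivial_limit_at_top_linorder])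
  thus ?thesis by simp
qed

section \<open>The H-function of the claim\<close>

text \<open>The strip may now contain poles, but |Im s| \<ge> 1 keeps away from them. Shifting by N
  into the right half-plane divides by a Pochhammer symbol of modulus at least |Im s|^N \<ge> |Im
  s|.\<close>

lemma norm_Gamma_strip_decay:
  obtains C where "C > 0" "\<And>s. \<bar>Re s\<bar> \<le> K \<Longrightarrow> \<bar>Im s\<bar> \<ge> 1 \<Longrightarrow> norm (Gamma s) \<le> C / \<bar>Im s\<bar>"
proof -
  define N where "N = Suc (nat \<lceil>K\<rceil>)"
  have N: "K < real N" unfolding N_def by linarith
  have N0: "N > 0" by (simp add: N_def)
  obtain C where C: "C > 0" "\<And>z. real N - K \<le> Re z \<Longrightarrow> Re z \<le> real N + K \<Longrightarrow> norm (Gamma z) \<le> C"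
    using norm_Gamma_strip_le[of "real N - K" "real N + K"] N by auto
  have "norm (Gamma s) \<le> C / \<bar>Im s\<bar>" if s: "\<bar>Re s\<bar> \<le> K" "\<bar>Im s\<bar> \<ge> 1" for s
  proof -
    have "s \<notin> \<int>\<^sub>\<le>\<^sub>0" using s by (auto elim!: nonpos_Ints_cases)
    hence "norm (Gamma s) = norm (Gamma (s + of_nat N)) / norm (pochhammer s N)"
      by (subst pochhammer_Gamma_shift[of s N]) (auto simp: norm_divide)
    also have "\<dots> \<le> C / \<bar>Im s\<bar>"
    proof (rule frac_le)
      show "norm (Gamma (s + of_nat N)) \<le> C" using s by (intro C(2)) auto
      have "\<bar>Im s\<bar> \<le> \<bar>Im s\<bar> ^ N" using s N0 by (intro self_le_power) auto
      also have "\<dots> = (\<Prod>j\<in>{0..<N}. \<bar>Im s\<bar>)" by simp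
      also have "\<dots> \<le> (\<Prod>j\<in>{0..<N}. norm (s + of_nat j))"
      proof (rule prod_mono)
        show "0 \<le> \<bar>Im s\<bar> \<and> \<bar>Im s\<bar> \<le> norm (s + of_nat j)" for j
          using abs_Im_le_cmod[of "s + of_nat j"] by simp
      qed
      also have "\<dots> = norm (pochhammer s N)" by (simp add: pochhammer_prod prod_norm)
      finally show "\<bar>Im s\<bar> \<le> norm (pochhammer s N)" .
    qed (use C s in auto)
    finally show ?thesis .
  qed
  thus ?thesis using that C(1) by blast
qed

text \<open>The same shift in both Gamma values leaves a quotient bounded by
  \<open>norm_Gamma_scaled_le\<close>, times factors |\<nu> w + j| / |w + j|. Each of these is at
  most 1 + 2j, because |w + j| \<ge> 1.\<close>

lemma norm_Gamma_quotient_strip_bounded: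
  assumes \<nu>: "0 < \<nu>" "\<nu> \<le> 1"
  obtains C where "C > 0" "\<And>w. \<bar>Re w\<bar> \<le> K \<Longrightarrow> \<bar>Im w\<bar> \<ge> 1 \<Longrightarrow>
    norm (Gamma w * rGamma (of_real \<nu> * w)) \<le> C"
proof -
  define N where "N = Suc (nat \<lceil>K\<rceil>)"
  have N: "K < real N" unfolding N_def by linarith
  have "continuous_on {-K..K} (\<lambda>x::real. Gamma (x + real N) * rGamma (\<nu> * x + real N))"
    using N by (intro continuous_intros continuous_on_compose2[OF continuous_on_Gamma[of "{0<..}"]]
          continuous_on_compose2[OF continuous_on_rGamma[of UNIV]]) (auto elim!: nonpos_Ints_cases)
  then obtain C where C: "\<And>x. x \<in> {-K..K} \<Longrightarrow> norm (Gamma (x + real N) * rGamma (\<nu> * x + real N)) \<le> C"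
    by (metis (no_types, lifting) compact_Icc compact_continuous_image compact_imp_bounded bounded_iff imageI)
  define D where "D = (\<Prod>j\<in>{0..<N}. 1 + 2 * real j)"
  have D: "D > 0" unfolding D_def by (intro prod_pos) auto
  have "norm (Gamma w * rGamma (of_real \<nu> * w)) \<le> D * max C 1" if w: "\<bar>Re w\<bar> \<le> K" "\<bar>Im w\<bar> \<ge> 1" for w
  proof -
    have "w \<notin> \<int>\<^sub>\<le>\<^sub>0" using w by (auto elim!: nonpos_Ints_cases)
    hence "Gamma w = Gamma (w + of_nat N) / pochhammer w N" by (rule pochhammer_Gamma_shift)
    moreover have "rGamma (of_real \<nu> * w) = pochhammer (of_real \<nu> * w) N * rGamma (of_real \<nu> * w + of_nat N)"
      by (rule pochhammer_rGamma)
    ultimately have "norm (Gamma w * rGamma (of_real \<nu> * w)) =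
        (norm (pochhammer (of_real \<nu> * w) N) / norm (pochhammer w N)) *
        (norm (Gamma (w + of_nat N)) * norm (rGamma (of_real \<nu> * w + of_nat N)))"
      by (simp add: norm_mult norm_divide)
    also have "\<dots> \<le> D * max C 1"
    proof (rule mult_mono)
      have "norm (pochhammer (of_real \<nu> * w) N) / norm (pochhammer w N)
          = (\<Prod>j\<in>{0..<N}. norm (of_real \<nu> * w + of_nat j) / norm (w + of_nat j))"
        by (simp add: pochhammer_prod prod_norm prod_dividef)
      also have "\<dots> \<le> D" unfolding D_def
      proof (rule prod_mono)
        fix j
        have n1: "1 \<le> norm (w + of_nat j)" using abs_Im_le_cmod[of "w + of_nat j"] w by simp
        have "norm w \<le> norm (w + of_nat j) + real j"
          using norm_triangle_ineq4[of "w + of_nat j" "of_nat j"] by simp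
        moreover have "norm (of_real \<nu> * w + of_nat j) \<le> norm w + real j"
          using norm_triangle_ineq[of "of_real \<nu> * w" "of_nat j"] \<nu> mult_left_le_one_le[of "norm w" \<nu>]
          by (simp add: norm_mult)
        moreover have "real j \<le> real j * norm (w + of_nat j)" using n1 by (simp add: mult_le_cancel_left1)
        ultimately have "norm (of_real \<nu> * w + of_nat j) \<le> (1 + 2 * real j) * norm (w + of_nat j)"
          by (simp add: distrib_right)
        thus "0 \<le> norm (of_real \<nu> * w + of_nat j) / norm (w + of_nat j) \<and>
            norm (of_real \<nu> * w + of_nat j) / norm (w + of_nat j) \<le> 1 + 2 * real j"
          using n1 by (auto simp: divide_le_eq)
      qed
      finally show "norm (pochhammer (of_real \<nu> * w) N) / norm (pochhammer w N) \<le> D" .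
      have "norm (Gamma (w + of_nat N)) * norm (rGamma (of_real \<nu> * w + of_nat N))
          \<le> Gamma (Re w + real N) * rGamma (\<nu> * Re w + real N)"
        using norm_Gamma_scaled_le[OF \<nu>, of "real N" w] w N by simp
      also have "\<dots> \<le> C" using C[of "Re w"] w by (simp add: abs_le_iff)
      finally show "norm (Gamma (w + of_nat N)) * norm (rGamma (of_real \<nu> * w + of_nat N)) \<le> max C 1" by simp
    qed (use D in auto)
    finally show ?thesis .
  qed
  moreover have "D * max C 1 > 0" using D by (intro mult_pos_pos) auto
  ultimately show ?thesis using that by blast
qed

section \<open>Location of the poles, and straight lines as contours\<close>

text \<open>\<sigma> = 1 describes a sequence of poles running to the left, \<sigma> = -1 one
  running to the right.\<close>

lemma finite_nonpos_Ints_strip: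
  fixes d \<sigma> :: real
  assumes "\<sigma> = 1 \<or> \<sigma> = -1"
  shows "finite {s :: complex. of_real d + of_real \<sigma> * s \<in> \<int>\<^sub>\<le>\<^sub>0 \<and> \<bar>Re s\<bar> \<le> K}"
proof (rule finite_subset)
  define N where "N = nat \<lceil>\<bar>d\<bar> + K\<rceil>"
  show "{s :: complex. of_real d + of_real \<sigma> * s \<in> \<int>\<^sub>\<le>\<^sub>0 \<and> \<bar>Re s\<bar> \<le> K}
      \<subseteq> (\<lambda>m. of_real (\<sigma> * (- real m - d))) ` {..N}"
  proof
    fix s :: complex assume s: "s \<in> {s. of_real d + of_real \<sigma> * s \<in> \<int>\<^sub>\<le>\<^sub>0 \<and> \<bar>Re s\<bar> \<le> K}"
    then obtain m where m: "of_real d + of_real \<sigma> * s = - of_nat m" by (auto elim!: nonpos_Ints_cases')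
    hence r: "d + \<sigma> * Re s = - real m" "\<sigma> * Im s = 0" by (auto simp: complex_eq_iff)
    have "s = of_real (\<sigma> * (- real m - d))" using r assms by (auto simp: complex_eq_iff)
    moreover have "real m \<le> \<bar>d\<bar> + K" using r s assms by (auto simp: abs_if split: if_splits)
    hence "m \<le> N" unfolding N_def by linarith
    ultimately show "s \<in> (\<lambda>m. of_real (\<sigma> * (- real m - d))) ` {..N}" by blast
  qed
qed simp

lemma closed_nonpos_Ints_affine:
  "closed {s :: complex. of_real d + of_real \<sigma> * s \<in> \<int>\<^sub>\<le>\<^sub>0}"
proof -
  have "closed ((\<lambda>s. of_real d + of_real \<sigma> * s) -` (\<int>\<^sub>\<le>\<^sub>0 :: complex set))"
    by (intro closed_vimage closed_nonpos_Ints continuous_intros)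
  thus ?thesis by (simp add: vimage_def)
qed

lemma Im_nonpos_Ints_affine:
  fixes s :: complex
  assumes "\<sigma> = 1 \<or> \<sigma> = -1" "of_real d + of_real \<sigma> * s \<in> \<int>\<^sub>\<le>\<^sub>0"
  shows "Im s = 0" "d + \<sigma> * Re s \<le> 0"
proof -
  obtain m where "of_real d + of_real \<sigma> * s = - of_nat m"
    using assms(2) by (auto elim!: nonpos_Ints_cases')
  hence "d + \<sigma> * Re s = - real m" "\<sigma> * Im s = 0" by (auto simp: complex_eq_iff)
  thus "Im s = 0" "d + \<sigma> * Re s \<le> 0" using assms(1) by auto
qed

lemma vertical_contour_line: "vertical_contour \<gamma> (\<lambda>t. Complex \<gamma> t)"
  unfolding vertical_contour_def
  using C1_differentiable_imp_piecewise[OF vertical_line_C1] by blast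

lemma left_of_vertical_line:
  assumes "Re s < \<gamma>"
  shows "left_of_contour (\<lambda>t. Complex \<gamma> t) s"
  unfolding left_of_contour_def
proof (rule eventually_mono[OF eventually_gt_at_bot[of \<gamma>]])
  fix x :: real assume "x < \<gamma>"
  moreover have "connected {z. Re z < \<gamma>}" by (intro convex_connected convex_halfspace_Re_lt)
  ultimately show "connected_component (- range (\<lambda>t. Complex \<gamma> t)) s (complex_of_real x)"
    using assms unfolding connected_component_def by (intro exI[of _ "{z. Re z < \<gamma>}"]) auto
qed

lemma right_of_vertical_line:
  assumes "Re s > \<gamma>"
  shows "right_of_contour (\<lambda>t. Complex \<gamma> t) s"
  unfolding right_of_contour_def
proof (rule eventually_mono[OF eventually_gt_at_top[of \<gamma>]])
  fix x :: real assume "x > \<gamma>"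
  moreover have "connected {z. Re z > \<gamma>}" by (intro convex_connected convex_halfspace_Re_gt)
  ultimately show "connected_component (- range (\<lambda>t. Complex \<gamma> t)) s (complex_of_real x)"
    using assms unfolding connected_component_def by (intro exI[of _ "{z. Re z > \<gamma>}"]) auto
qed

text \<open>The integrand of the H-function on the line \<open>Re s = a - \<delta>\<close>, for \<open>\<epsilon> = 2\<delta>\<close>.\<close>

definition dirichlet_integrand :: "real \<Rightarrow> real \<Rightarrow> real \<Rightarrow> real \<Rightarrow> real \<Rightarrow> real \<Rightarrow> complex" where
  "dirichlet_integrand \<nu> a b z \<delta> t = Gamma (Complex (a - \<delta>) t) * Gamma (Complex (b - \<delta>) (- t)) *
     gamma_quot \<nu> (Complex \<delta> t) * gamma_quot \<nu> (Complex \<delta> (- t)) * of_real z powr (- Complex (a - \<delta>) t)"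

lemma continuous_gamma_quot: "continuous_on {w. Re w > -1} (gamma_quot \<nu>)"
  by (intro holomorphic_on_imp_continuous_on holomorphic_gamma_quot)

text \<open>Both arguments may vary: variable \<open>u\<close> gives measurability in t, variable
  \<open>d\<close> the limit \<delta> \<rightarrow> 0. The range of \<open>d\<close> reaches below 0
  because \<open>gamma_quot\<close> is continued.\<close>

lemma continuous_on_dirichlet_integrand:
  assumes "continuous_on S d" "continuous_on S u" "z > 0"
    and "\<And>x. x \<in> S \<Longrightarrow> - 1 < d x \<and> d x < a \<and> d x < b"
  shows "continuous_on S (\<lambda>x. dirichlet_integrand \<nu> a b z (d x) (u x))"
proof -
  have G: "continuous_on {w. Re w > 0} (Gamma :: complex \<Rightarrow> complex)"
    by (intro continuous_on_Gamma) (auto elim!: nonpos_Ints_cases)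
  have "continuous_on UNIV (\<lambda>w :: complex. of_real z powr w)"
    using \<open>z > 0\<close> by (intro continuous_intros) auto
  note P = continuous_on_compose2[OF this]
  have nz: "complex_of_real z \<noteq> 0" using \<open>z > 0\<close> by simp
  show ?thesis
    unfolding dirichlet_integrand_def
    by (intro continuous_intros P continuous_on_compose2[OF G] continuous_on_compose2[OF continuous_gamma_quot] assms(1,2))
       (use assms(4) nz in fastforce)+
qed

text \<open>Uniformity down to \<delta> = 0 is the point: the factors whose poles collide appear as
  \<open>gamma_quot\<close> on a strip 0 \<le> Re w \<le> m, hence stay bounded, and the decay of
  the first Gamma factor alone is enough. This is the dominating function of the limit.\<close>

lemma dirichlet_integrand_bound:
  assumes \<nu>: "0 < \<nu>" "\<nu> \<le> 1" and "a > 0" "b > 0" "z > 0"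
  obtains C where "\<And>\<delta> t. 0 \<le> \<delta> \<Longrightarrow> \<delta> \<le> min a b / 2 \<Longrightarrow> norm (dirichlet_integrand \<nu> a b z \<delta> t) \<le> C / (1 + t\<^sup>2)"
proof -
  \<comment> \<open>Keeps a - \<delta> \<ge> a/2 and b - \<delta> \<ge> b/2, away from the pole of
    \<Gamma> at 0.\<close>
  define m where "m = min a b / 2"
  have m: "m > 0" "m \<le> a / 2" "m \<le> b / 2" using assms by (auto simp: m_def)
  obtain C1 where C1: "C1 > 0" "\<And>s. a / 2 \<le> Re s \<Longrightarrow> Re s \<le> a \<Longrightarrow> norm (Gamma s) \<le> C1 / (1 + (Im s)\<^sup>2)"
    using norm_Gamma_decay[of "a / 2" a] \<open>a > 0\<close> by auto
  obtain C2 where C2: "C2 > 0" "\<And>s. b / 2 \<le> Re s \<Longrightarrow> Re s \<le> b \<Longrightarrow> norm (Gamma s) \<le> C2"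
    using norm_Gamma_strip_le[of "b / 2" b] \<open>b > 0\<close> by auto
  obtain C3 where C3: "C3 > 0" "\<And>w. 0 \<le> Re w \<Longrightarrow> Re w \<le> m \<Longrightarrow> norm (gamma_quot \<nu> w) \<le> C3"
    using norm_gamma_quot_strip_le[OF \<nu>, of 0 m] by auto
  have "continuous_on {0..m} (\<lambda>\<delta>. z powr (- (a - \<delta>)))"
    using \<open>z > 0\<close> by (intro continuous_intros) auto
  hence "bounded ((\<lambda>\<delta>. z powr (- (a - \<delta>))) ` {0..m})"
    by (intro compact_imp_bounded compact_continuous_image) auto
  then obtain C4 where C4: "\<And>\<delta>. \<delta> \<in> {0..m} \<Longrightarrow> norm (z powr (- (a - \<delta>))) \<le> C4"
    unfolding bounded_iff by (metis (no_types, lifting) imageI)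
  have "norm (dirichlet_integrand \<nu> a b z \<delta> t) \<le> (C1 * C2 * C3 * C3 * C4) / (1 + t\<^sup>2)"
    if \<delta>: "0 \<le> \<delta>" "\<delta> \<le> m" for \<delta> t
  proof -
    have "norm (dirichlet_integrand \<nu> a b z \<delta> t) \<le> C1 / (1 + t\<^sup>2) * C2 * C3 * C3 * C4"
      unfolding dirichlet_integrand_def norm_mult norm_of_real_powr[OF \<open>z > 0\<close>]
      using C1(1) C1(2)[of "Complex (a - \<delta>) t"] C2(1) C2(2)[of "Complex (b - \<delta>) (-t)"] C3(1) C3(2)[of "Complex \<delta> t"]
        C3(2)[of "Complex \<delta> (-t)"] C4[of \<delta>] \<delta> m
      by (intro mult_mono) (auto intro!: divide_nonneg_nonneg mult_nonneg_nonneg)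
    thus ?thesis by simp
  qed
  thus ?thesis using that unfolding m_def by blast
qed

lemma dirichlet_integrand_integrable:
  assumes "0 < \<nu>" "\<nu> \<le> 1" "a > 0" "b > 0" "z > 0" "0 \<le> \<delta>" "\<delta> \<le> min a b / 2"
  shows "integrable lborel (dirichlet_integrand \<nu> a b z \<delta>)"
proof -
  obtain C where C: "\<And>\<delta> t. 0 \<le> \<delta> \<Longrightarrow> \<delta> \<le> min a b / 2 \<Longrightarrow> norm (dirichlet_integrand \<nu> a b z \<delta> t) \<le> C / (1 + t\<^sup>2)"
    using dirichlet_integrand_bound[OF assms(1-5)] by blast
  show ?thesis
  proof (rule integrable_lborel_inverse_square_bound[where C = C])
    have "\<delta> < a" "\<delta> < b" using assms by (auto simp: min_def field_simps split: if_splits)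
    hence "continuous_on UNIV (\<lambda>t. dirichlet_integrand \<nu> a b z \<delta> t)"
      using assms by (intro continuous_on_dirichlet_integrand continuous_intros) auto
    thus "dirichlet_integrand \<nu> a b z \<delta> \<in> borel_measurable borel"
      by (rule borel_measurable_continuous_onI)
  qed (use C assms in auto)
qed

lemma dirichlet_integrand_tendsto:
  assumes "0 < \<nu>" "\<nu> \<le> 1" "a > 0" "b > 0" "z > 0"
  shows "((\<lambda>\<epsilon>. \<integral>t. dirichlet_integrand \<nu> a b z (\<epsilon> / 2) t \<partial>lborel) \<longlongrightarrow>
          (\<integral>t. dirichlet_integrand \<nu> a b z 0 t \<partial>lborel)) (at_right 0)"
proof (rule tendsto_at_right_sequentially)
  show "0 < min a b" using assms by simp
  fix S :: "nat \<Rightarrow> real" assume S: "\<And>n. 0 < S n" "\<And>n. S n < min a b" "S \<longlonglongrightarrow> 0"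
  obtain C where C: "\<And>\<delta> t. 0 \<le> \<delta> \<Longrightarrow> \<delta> \<le> min a b / 2 \<Longrightarrow> norm (dirichlet_integrand \<nu> a b z \<delta> t) \<le> C / (1 + t\<^sup>2)"
    using dirichlet_integrand_bound[OF assms] by blast
  have S2: "0 \<le> S n / 2" "S n / 2 \<le> min a b / 2" for n using S(1,2)[of n] by auto
  show "(\<lambda>n. \<integral>t. dirichlet_integrand \<nu> a b z (S n / 2) t \<partial>lborel) \<longlonglongrightarrow> (\<integral>t. dirichlet_integrand \<nu> a b z 0 t \<partial>lborel)"
  proof (rule integral_dominated_convergence[where w = "\<lambda>t. C / (1 + t\<^sup>2)"])
    show "dirichlet_integrand \<nu> a b z 0 \<in> borel_measurable lborel"
      using dirichlet_integrand_integrable[OF assms, of 0] assms by auto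
    show "dirichlet_integrand \<nu> a b z (S n / 2) \<in> borel_measurable lborel" for n
      using dirichlet_integrand_integrable[OF assms S2[of n]] by auto
    show "integrable lborel (\<lambda>t::real. C / (1 + t\<^sup>2))" by (rule integrable_inverse_1_plus_square')
    show "AE t in lborel. (\<lambda>n. dirichlet_integrand \<nu> a b z (S n / 2) t) \<longlonglongrightarrow> dirichlet_integrand \<nu> a b z 0 t"
    proof (rule AE_I2)
      fix t :: real
      have c: "continuous_on {0..min a b / 2} (\<lambda>\<delta>. dirichlet_integrand \<nu> a b z \<delta> t)"
        using assms by (intro continuous_on_dirichlet_integrand continuous_intros) (auto simp: min_def field_simps split: if_splits)
      have l: "(\<lambda>n. S n / 2) \<longlonglongrightarrow> 0" using tendsto_divide_zero[OF S(3), of 2] .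
      show "(\<lambda>n. dirichlet_integrand \<nu> a b z (S n / 2) t) \<longlonglongrightarrow> dirichlet_integrand \<nu> a b z 0 t"
        by (rule continuous_on_tendsto_compose[OF c l]) (use S2 assms in \<open>auto intro!: always_eventually\<close>)
    qed
    show "AE t in lborel. norm (dirichlet_integrand \<nu> a b z (S n / 2) t) \<le> C / (1 + t\<^sup>2)" for n
      by (rule AE_I2) (rule C[OF S2])
  qed
qed

section \<open>Evaluation of the H-function\<close>

text \<open>The denominator arguments \<nu> (\<epsilon> - a + s) and \<nu> (a - s) are \<nu> times
  the arguments of two numerator factors, which produces two quotients of the kind studied above.
  \<open>rGamma\<close> agrees with division by \<open>Gamma\<close> also at poles, where
  \<open>Gamma\<close> is 0.\<close>

lemma fox_H_kernel_dirichlet: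
  "fox_H_kernel 2 2
     [(of_real (1 - a), 1), (of_real (1 - (a + b) + \<epsilon>), 1), (of_real (\<nu> * (\<epsilon> - a)), \<nu>)]
     [(0, 1), (of_real (\<epsilon> - a), 1), (of_real (1 - \<nu> * a), \<nu>)] s
   = Gamma s * Gamma (of_real (a + b - \<epsilon>) - s)
      * (Gamma (of_real (\<epsilon> - a) + s) * rGamma (of_real \<nu> * (of_real (\<epsilon> - a) + s)))
      * (Gamma (of_real a - s) * rGamma (of_real \<nu> * (of_real a - s)))"
  by (simp add: fox_H_kernel_def rGamma_inverse_Gamma numeral_2_eq_2 algebra_simps divide_inverse)

text \<open>The line halfway between the poles a - \<epsilon> and a separates the two families,
  since \<epsilon> < min a b keeps 0 to its left and a + b - \<epsilon> to its right. Independence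
  of the contour then evaluates the definite description.\<close>

lemma fox_H_dirichlet:
  assumes \<nu>: "0 < \<nu>" "\<nu> \<le> 1" and ab: "a > 0" "b > 0" and "z > 0" and \<epsilon>: "0 < \<epsilon>" "\<epsilon> < min a b"
  shows "fox_H 2 2
     [(of_real (1 - a), 1), (of_real (1 - (a + b) + \<epsilon>), 1), (of_real (\<nu> * (\<epsilon> - a)), \<nu>)]
     [(0, 1), (of_real (\<epsilon> - a), 1), (of_real (1 - \<nu> * a), \<nu>)] (of_real z)
   = 1 / (2 * pi) * (\<integral>t. dirichlet_integrand \<nu> a b z (\<epsilon> / 2) t \<partial>lborel)"
proof -
  define as where "as = [(complex_of_real (1 - a), 1::real), (of_real (1 - (a + b) + \<epsilon>), 1), (of_real (\<nu> * (\<epsilon> - a)), \<nu>)]"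
  define bs where "bs = [(0, 1), (complex_of_real (\<epsilon> - a), 1::real), (of_real (1 - \<nu> * a), \<nu>)]"
  define F where "F = (\<lambda>s. fox_H_kernel 2 2 as bs s * of_real z powr (-s))"
  have F: "F s = Gamma s * Gamma (of_real (a + b - \<epsilon>) - s)
      * (Gamma (of_real (\<epsilon> - a) + s) * rGamma (of_real \<nu> * (of_real (\<epsilon> - a) + s)))
      * (Gamma (of_real a - s) * rGamma (of_real \<nu> * (of_real a - s))) * of_real z powr (-s)" for s
    unfolding F_def as_def bs_def fox_H_kernel_dirichlet ..
  define A where "A = (\<lambda>d \<sigma>. {s :: complex. of_real d + of_real \<sigma> * s \<in> \<int>\<^sub>\<le>\<^sub>0})"
  have lp: "fox_H_left_poles 2 bs = A 0 1 \<union> A (\<epsilon> - a) 1"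
    by (auto simp: fox_H_left_poles_def bs_def A_def numeral_2_eq_2)
  have rp: "fox_H_right_poles 2 as = A a (-1) \<union> A (a + b - \<epsilon>) (-1)"
    by (auto simp: fox_H_right_poles_def as_def A_def numeral_2_eq_2 algebra_simps)
  \<comment> \<open>Only the numerator has singularities; the denominators contribute entire factors
    \<open>rGamma\<close>.\<close>
  define P where "P = (A 0 1 \<union> A (\<epsilon> - a) 1) \<union> (A a (-1) \<union> A (a + b - \<epsilon>) (-1))"
  have PIm: "Im p = 0" if "p \<in> P" for p
    using that Im_nonpos_Ints_affine(1)[of 1 _ p] Im_nonpos_Ints_affine(1)[of "-1" _ p] unfolding P_def A_def by blast
  have closed: "closed P"
    unfolding P_def A_def by (intro closed_Un closed_nonpos_Ints_affine)
  have fin: "finite {p \<in> P. \<bar>Re p\<bar> \<le> K}" for K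
  proof -
    have fA: "finite {p \<in> A d \<sigma>. \<bar>Re p\<bar> \<le> K}" if "\<sigma> = 1 \<or> \<sigma> = -1" for d \<sigma>
      using finite_nonpos_Ints_strip[OF that, of d K] by (simp add: A_def)
    have "{p \<in> P. \<bar>Re p\<bar> \<le> K} = ({p \<in> A 0 1. \<bar>Re p\<bar> \<le> K} \<union> {p \<in> A (\<epsilon> - a) 1. \<bar>Re p\<bar> \<le> K})
        \<union> ({p \<in> A a (-1). \<bar>Re p\<bar> \<le> K} \<union> {p \<in> A (a + b - \<epsilon>) (-1). \<bar>Re p\<bar> \<le> K})"
      by (auto simp: P_def)
    thus ?thesis by (simp only: finite_Un fA simp_thms)
  qed
  have hol: "F holomorphic_on - P"
    unfolding F using \<open>z > 0\<close>
    by (intro holomorphic_intros) (auto simp: P_def A_def)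
  have decay: "\<forall>\<^sub>F R in at_top. \<forall>s. \<bar>Re s\<bar> \<le> K \<and> \<bar>Im s\<bar> = R \<longrightarrow> norm (F s) \<le> e" if "e > 0" for K e
  proof -
    \<comment> \<open>Bounds the real parts of all four numerator arguments at once.\<close>
    define K' where "K' = \<bar>K\<bar> + a + b"
    obtain C1 where C1: "C1 > 0" "\<And>s. \<bar>Re s\<bar> \<le> K' \<Longrightarrow> \<bar>Im s\<bar> \<ge> 1 \<Longrightarrow> norm (Gamma s) \<le> C1 / \<bar>Im s\<bar>"
      using norm_Gamma_strip_decay by blast
    obtain C2 where C2: "C2 > 0" "\<And>w. \<bar>Re w\<bar> \<le> K' \<Longrightarrow> \<bar>Im w\<bar> \<ge> 1 \<Longrightarrow> norm (Gamma w * rGamma (of_real \<nu> * w)) \<le> C2"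
      using norm_Gamma_quotient_strip_bounded[OF \<nu>] by blast
    have "continuous_on {-K..K} (\<lambda>x. z powr (- x))" using \<open>z > 0\<close> by (intro continuous_intros) auto
    hence "bounded ((\<lambda>x. z powr (- x)) ` {-K..K})" by (intro compact_imp_bounded compact_continuous_image) auto
    then obtain C3 where C3: "\<And>x. x \<in> {-K..K} \<Longrightarrow> norm (z powr (- x)) \<le> C3"
      unfolding bounded_iff by (metis (no_types, lifting) imageI)
    define D where "D = C1 * C1 * C2 * C2 * C3"
    have le: "norm (F s) \<le> D / R" if s: "\<bar>Re s\<bar> \<le> K" "\<bar>Im s\<bar> = R" and R: "R \<ge> 1" for s R
    proof -
      have 1: "norm (Gamma s) \<le> C1 / R" using C1(2)[of s] s R ab by (simp add: K'_def)
      have "\<epsilon> < a" "\<epsilon> < b" using \<epsilon> by auto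
      hence b: "\<bar>a + b - \<epsilon> - Re s\<bar> \<le> K'" "\<bar>\<epsilon> - a + Re s\<bar> \<le> K'" "\<bar>a - Re s\<bar> \<le> K'"
        using s(1) ab \<epsilon>(1) unfolding K'_def by linarith+
      have "norm (Gamma (of_real (a + b - \<epsilon>) - s)) \<le> C1 / R"
        using C1(2)[of "of_real (a + b - \<epsilon>) - s"] b(1) s R by simp
      \<comment> \<open>A single factor 1/R is enough for the decay, so this Gamma value is merely
        bounded.\<close>
      also have "\<dots> \<le> C1 / 1" using C1(1) R by (intro divide_left_mono) auto
      finally have 2: "norm (Gamma (of_real (a + b - \<epsilon>) - s)) \<le> C1" by simp
      have 3: "norm (Gamma (of_real (\<epsilon> - a) + s) * rGamma (of_real \<nu> * (of_real (\<epsilon> - a) + s))) \<le> C2"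
        using b s R by (intro C2(2)) simp_all
      have 4: "norm (Gamma (of_real a - s) * rGamma (of_real \<nu> * (of_real a - s))) \<le> C2"
        using b s R by (intro C2(2)) simp_all
      have 5: "norm (of_real z powr (-s) :: complex) \<le> C3"
        using C3[of "Re s"] s \<open>z > 0\<close> by (simp add: norm_of_real_powr abs_le_iff)
      have "norm (F s) \<le> C1 / R * C1 * C2 * C2 * C3"
        unfolding F norm_mult[of _ "of_real z powr _"] norm_mult[of _ "Gamma (of_real a - s) * _"]
          norm_mult[of _ "Gamma (of_real (\<epsilon> - a) + s) * _"] norm_mult[of "Gamma s" "Gamma _"]
        using C1(1) C2(1) R
        by (intro mult_mono[OF mult_mono[OF mult_mono[OF mult_mono[OF 1 2] 3] 4] 5])
           (auto intro!: mult_nonneg_nonneg divide_nonneg_nonneg)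
      thus ?thesis by (simp add: D_def)
    qed
    have "((\<lambda>R. D / R) \<longlongrightarrow> 0) at_top" by real_asymp
    hence "\<forall>\<^sub>F R in at_top. D / R < e" using \<open>e > 0\<close> by (rule order_tendstoD)
    thus ?thesis using eventually_ge_at_top[of 1]
    proof eventually_elim
      case (elim R)
      thus ?case using le by (meson order.strict_implies_order order.trans)
    qed
  qed
  define \<gamma> where "\<gamma> = a - \<epsilon> / 2"
  have \<gamma>: "\<gamma> > 0" using ab \<epsilon> unfolding \<gamma>_def by simp
  have contour: "fox_H_contour 2 2 as bs (\<lambda>t. Complex \<gamma> t)"
    unfolding fox_H_contour_def lp rp
  proof (intro conjI ballI)
    show "\<exists>\<gamma>'. vertical_contour \<gamma>' (\<lambda>t. Complex \<gamma> t)" using vertical_contour_line by blast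
    fix s assume "s \<in> A 0 1 \<union> A (\<epsilon> - a) 1"
    hence "Re s \<le> 0 \<or> Re s \<le> a - \<epsilon>"
      using Im_nonpos_Ints_affine(2)[of 1 0 s] Im_nonpos_Ints_affine(2)[of 1 "\<epsilon> - a" s] by (auto simp: A_def)
    hence "Re s < \<gamma>" using \<gamma> \<epsilon> by (auto simp: \<gamma>_def)
    thus "left_of_contour (\<lambda>t. Complex \<gamma> t) s" by (rule left_of_vertical_line)
  next
    fix s assume "s \<in> A a (-1) \<union> A (a + b - \<epsilon>) (-1)"
    hence "Re s \<ge> a \<or> Re s \<ge> a + b - \<epsilon>"
      using Im_nonpos_Ints_affine(2)[of "-1" a s] Im_nonpos_Ints_affine(2)[of "-1" "a + b - \<epsilon>" s] by (auto simp: A_def)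
    hence "Re s > \<gamma>" using ab \<epsilon> by (auto simp: \<gamma>_def)
    thus "right_of_contour (\<lambda>t. Complex \<gamma> t) s" by (rule right_of_vertical_line)
  qed
  define I where "I = \<i> * (\<integral>t. dirichlet_integrand \<nu> a b z (\<epsilon> / 2) t \<partial>lborel)"
  \<comment> \<open>On this line both quotients are taken at real part \<epsilon>/2 > 0, where the
    continuation coincides with the plain quotient.\<close>
  have line: "F (Complex \<gamma> t) = dirichlet_integrand \<nu> a b z (\<epsilon> / 2) t" for t
  proof -
    have e: "of_real (a + b - \<epsilon>) - Complex \<gamma> t = Complex (b - \<epsilon> / 2) (-t)"
      "of_real (\<epsilon> - a) + Complex \<gamma> t = Complex (\<epsilon> / 2) t"
      "of_real a - Complex \<gamma> t = Complex (\<epsilon> / 2) (-t)"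
      by (simp_all add: \<gamma>_def complex_eq_iff field_simps)
    show ?thesis
      unfolding F dirichlet_integrand_def e using \<epsilon> by (simp add: gamma_quot_eq \<gamma>_def)
  qed
  have int: "((\<lambda>t. F (Complex \<gamma> t) * vector_derivative (\<lambda>t. Complex \<gamma> t) (at t)) has_integral I) UNIV"
  proof -
    have vd: "vector_derivative (\<lambda>t. Complex \<gamma> t) (at t) = \<i>" for t
    proof (rule vector_derivative_at)
      have "((\<lambda>t. of_real \<gamma> + \<i> * of_real t) has_vector_derivative \<i>) (at t)"
        by (auto intro!: derivative_eq_intros)
      thus "((\<lambda>t. Complex \<gamma> t) has_vector_derivative \<i>) (at t)" by (simp add: Complex_eq)
    qed
    have "(dirichlet_integrand \<nu> a b z (\<epsilon> / 2) has_integral (\<integral>t. dirichlet_integrand \<nu> a b z (\<epsilon> / 2) t \<partial>lborel)) UNIV"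
      using \<epsilon> by (intro has_integral_integral_lborel dirichlet_integrand_integrable \<nu> ab \<open>z > 0\<close>) auto
    from has_integral_mult_right[OF this, of \<i>] show ?thesis
      by (simp add: vd line I_def mult.commute)
  qed
  have "fox_H 2 2 as bs (of_real z) = 1 / (2 * of_real pi * \<i>) * I"
    unfolding fox_H_def
  proof (rule the_equality)
    show "\<exists>L Ia. fox_H_contour 2 2 as bs L \<and>
        ((\<lambda>t. fox_H_kernel 2 2 as bs (L t) * of_real z powr (- L t) * vector_derivative L (at t)) has_integral Ia) UNIV \<and>
        1 / (2 * of_real pi * \<i>) * I = 1 / (2 * of_real pi * \<i>) * Ia"
      using contour int unfolding F_def by blast
  next
    fix v
    assume "\<exists>L Ia. fox_H_contour 2 2 as bs L \<and>
        ((\<lambda>t. fox_H_kernel 2 2 as bs (L t) * of_real z powr (- L t) * vector_derivative L (at t)) has_integral Ia) UNIV \<and>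
        v = 1 / (2 * of_real pi * \<i>) * Ia"
    then obtain L I' where L: "fox_H_contour 2 2 as bs L"
      and I': "((\<lambda>t. F (L t) * vector_derivative L (at t)) has_integral I') UNIV"
      and v: "v = 1 / (2 * of_real pi * \<i>) * I'"
      unfolding F_def by blast
    obtain \<gamma>' where L': "vertical_contour \<gamma>' L" using L unfolding fox_H_contour_def by blast
    have "I' = I"
    proof (rule vertical_contour_integral_unique[OF L' vertical_contour_line hol closed PIm fin _ decay I' int])
      fix p assume "p \<in> P"
      thus "left_of_contour L p \<and> left_of_contour (\<lambda>t. Complex \<gamma> t) p \<or> right_of_contour L p \<and> right_of_contour (\<lambda>t. Complex \<gamma> t) p"
        using L contour unfolding fox_H_contour_def lp rp P_def by blast
    qed
    thus "v = 1 / (2 * of_real pi * \<i>) * I" using v by simp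
  qed
  also have "\<dots> = 1 / (2 * pi) * (\<integral>t. dirichlet_integrand \<nu> a b z (\<epsilon> / 2) t \<partial>lborel)"
    unfolding I_def by simp
  finally show ?thesis unfolding as_def bs_def .
qed

section \<open>The density as an integral over the line Re s = a\<close>

text \<open>With s = a + \<i> t the powers combine as q^(-\<nu> s) r^(-\<nu> (a+b-s)) = r^(-\<nu>
  (a+b)) ((q/r)^\<nu>)^(-s), the origin of the argument of the H-function. Both kernels evaluate the
  continued quotient at Re w = 0, that is at \<delta> = 0.\<close>

lemma dirichlet_marginal:
  assumes \<nu>: "0 < \<nu>" "\<nu> \<le> 1" and ab: "a > 0" "b > 0" and qr: "q > 0" "r > 0"
  shows "complex_of_real (LINT y:{0<..}|lborel. y powr (\<nu> * (a + b) - 1)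
            * mittag_leffler3 \<nu> (\<nu> * a) a (- ((y * q) powr \<nu>))
            * mittag_leffler3 \<nu> (\<nu> * b) b (- ((y * r) powr \<nu>)))
      = of_real (r powr (- (\<nu> * (a + b))) / (\<nu> * Gamma a * Gamma b)) *
        (1 / (2 * pi) * (\<integral>t. dirichlet_integrand \<nu> a b ((q / r) powr \<nu>) 0 t \<partial>lborel))"
proof -
  have eq: "mb_kernel \<nu> a (Complex a t) * mb_kernel \<nu> b (Complex b (-t)) *
          (of_real q powr (- (of_real \<nu> * Complex a t)) * of_real r powr (- (of_real \<nu> * Complex b (-t))))
      = of_real (r powr (- (\<nu> * (a + b)))) * dirichlet_integrand \<nu> a b ((q / r) powr \<nu>) 0 t" for t
  proof -
    have e: "of_real a - Complex a t = Complex 0 (-t)" "of_real b - Complex b (-t) = Complex 0 t"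
      by (simp_all add: complex_eq_iff)
    have z: "(q / r) powr \<nu> > 0" using qr by simp
    have ln: "ln ((q / r) powr \<nu>) = \<nu> * (ln q - ln r)" using qr by (simp add: ln_powr ln_div)
    have c: "Complex b (-t) = of_real (a + b) - Complex a t" by (simp add: complex_eq_iff)
    have rr: "complex_of_real (r powr (- (\<nu> * (a + b)))) = exp (- (of_real \<nu> * of_real (a + b)) * of_real (ln r))"
      using qr by (simp add: powr_def exp_of_real[symmetric])
    have "of_real q powr (- (of_real \<nu> * Complex a t)) * of_real r powr (- (of_real \<nu> * Complex b (-t)))
       = of_real (r powr (- (\<nu> * (a + b)))) * of_real ((q / r) powr \<nu>) powr (- Complex a t)"
      unfolding of_real_powr_exp[OF qr(1)] of_real_powr_exp[OF qr(2)] of_real_powr_exp[OF z] ln c rr exp_add[symmetric]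
      by (rule arg_cong[of _ _ exp]) (simp add: algebra_simps)
    thus ?thesis
      unfolding mb_kernel_def dirichlet_integrand_def e by (simp add: mult_ac)
  qed
  show ?thesis
    unfolding mittag_leffler3_product_integral[OF \<nu> ab qr] eq integral_mult_right_zero
    by (simp add: field_simps)
qed

theorem proposition2p3:
  fixes n i :: nat and \<nu> \<beta>bar :: real and \<beta> :: "nat \<Rightarrow> real"
    and M :: "'a measure" and Q :: "'a \<Rightarrow> real" and f :: "real \<Rightarrow> real"
  assumes "n \<ge> 2"
    and "0 < \<nu>" and "\<nu> \<le> 1"
    and "\<And>j. j \<in> {1..n} \<Longrightarrow> \<beta> j > 0"
    and "\<beta>bar = (\<Sum>j=1..n. \<beta> j)"
    and "i \<in> {1..n-1}"
    and "\<And>q. q \<in> {0<..<1} \<Longrightarrow>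
           f q = q powr (\<nu> * \<beta> i - 1) * (1 - q) powr (\<nu> * (\<beta>bar - \<beta> i) - 1) *
             (LBINT y:{0<..}. y powr (\<nu> * \<beta>bar - 1) *
                mittag_leffler3 \<nu> (\<nu> * \<beta> i) (\<beta> i) (- ((y * q) powr \<nu>)) *
                mittag_leffler3 \<nu> (\<nu> * (\<beta>bar - \<beta> i)) (\<beta>bar - \<beta> i) (- ((y * (1 - q)) powr \<nu>)))"
    and "prob_space M"
    and "distributed M lborel Q (\<lambda>q. ennreal (f q * indicator {0<..<1} q))"
  shows "\<forall>q\<in>{0<..<1}. \<exists>l.
           ((\<lambda>\<epsilon>. fox_H 2 2
               [(of_real (1 - \<beta> i), 1), (of_real (1 - \<beta>bar + \<epsilon>), 1), (of_real (\<nu> * (\<epsilon> - \<beta> i)), \<nu>)]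
               [(0, 1), (of_real (\<epsilon> - \<beta> i), 1), (of_real (1 - \<nu> * \<beta> i), \<nu>)]
               (of_real ((q / (1 - q)) powr \<nu>))) \<longlongrightarrow> l) (at_right 0) \<and>
           complex_of_real (f q) =
             of_real (1 / (\<nu> * Gamma (\<beta> i) * Gamma (\<beta>bar - \<beta> i)) *
                q powr (\<nu> * \<beta> i - 1) * (1 - q) powr (- (\<nu> * \<beta> i + 1))) * l"
proof
  fix q :: real assume q: "q \<in> {0<..<1}"
  define a where "a = \<beta> i"
  define b where "b = \<beta>bar - \<beta> i"
  have \<nu>: "0 < \<nu>" "\<nu> \<le> 1" by fact+
  have a: "a > 0" using assms(4)[of i] assms(6) by (auto simp: a_def)
  have b: "b > 0"
  proof -
    have "b = (\<Sum>j\<in>{1..n} - {i}. \<beta> j)"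
      unfolding b_def assms(5) using assms(6) by (subst sum.remove[of _ i]) auto
    also have "\<dots> > 0"
    proof (rule sum_pos)
      \<comment> \<open>As i \<le> n - 1, the index n survives the removal of i, so the sum is not
        empty.\<close>
      have "n \<in> {1..n} - {i}" using assms(1,6) by auto
      thus "{1..n} - {i} \<noteq> {}" by blast
    qed (use assms(4) in auto)
    finally show ?thesis .
  qed
  have \<beta>bar: "\<beta>bar = a + b" by (simp add: a_def b_def)
  define z where "z = (q / (1 - q)) powr \<nu>"
  have z: "z > 0" using q by (simp add: z_def)
  \<comment> \<open>The integral at \<epsilon> = 0, where s = a would be a pole of both families and
    no contour could separate them.\<close>
  define l where "l = 1 / (2 * pi) * (\<integral>t. dirichlet_integrand \<nu> a b z 0 t \<partial>lborel)"
  have "((\<lambda>\<epsilon>. fox_H 2 2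
               [(of_real (1 - a), 1), (of_real (1 - (a + b) + \<epsilon>), 1), (of_real (\<nu> * (\<epsilon> - a)), \<nu>)]
               [(0, 1), (of_real (\<epsilon> - a), 1), (of_real (1 - \<nu> * a), \<nu>)] (of_real z)) \<longlongrightarrow> l) (at_right 0)"
  proof (rule Lim_transform_eventually)
    show "((\<lambda>\<epsilon>. 1 / (2 * pi) * (\<integral>t. dirichlet_integrand \<nu> a b z (\<epsilon> / 2) t \<partial>lborel)) \<longlongrightarrow> l) (at_right 0)"
      unfolding l_def by (intro tendsto_mult tendsto_const dirichlet_integrand_tendsto \<nu> a b z)
    \<comment> \<open>The H-function is evaluated only for \<epsilon> < min a b, which is enough for
      the one-sided limit.\<close>
    have "\<forall>\<^sub>F \<epsilon> in at_right 0. \<epsilon> \<in> {0<..<min a b}"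
      using a b by (intro eventually_at_right_real) auto
    thus "\<forall>\<^sub>F \<epsilon> in at_right 0. 1 / (2 * pi) * (\<integral>t. dirichlet_integrand \<nu> a b z (\<epsilon> / 2) t \<partial>lborel) =
        fox_H 2 2
               [(of_real (1 - a), 1), (of_real (1 - (a + b) + \<epsilon>), 1), (of_real (\<nu> * (\<epsilon> - a)), \<nu>)]
               [(0, 1), (of_real (\<epsilon> - a), 1), (of_real (1 - \<nu> * a), \<nu>)] (of_real z)"
    proof eventually_elim
      case (elim \<epsilon>)
      thus ?case using fox_H_dirichlet[OF \<nu> a b z, of \<epsilon>] by simp
    qed
  qed
  moreover have "complex_of_real (f q) = of_real (1 / (\<nu> * Gamma a * Gamma b) *
                q powr (\<nu> * a - 1) * (1 - q) powr (- (\<nu> * a + 1))) * l"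
  proof -
    have fq: "complex_of_real (f q) = of_real (q powr (\<nu> * a - 1) * (1 - q) powr (\<nu> * b - 1)) *
        (of_real ((1 - q) powr (- (\<nu> * (a + b))) / (\<nu> * Gamma a * Gamma b)) * l)"
      using dirichlet_marginal[OF \<nu> a b, of q "1 - q"] q
      unfolding assms(7)[OF q] \<beta>bar l_def z_def a_def[symmetric] by simp
    \<comment> \<open>The exponents add up: \<nu> b - 1 - \<nu> (a + b) = -(\<nu> a + 1).\<close>
    have "(1 - q) powr (- (\<nu> * a + 1)) = (1 - q) powr (\<nu> * b - 1) * (1 - q) powr (- (\<nu> * (a + b)))"
      by (simp add: powr_add[symmetric] algebra_simps)
    thus ?thesis unfolding fq by (simp add: mult_ac)
  qed
  ultimately show "\<exists>l.
           ((\<lambda>\<epsilon>. fox_H 2 2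
               [(of_real (1 - \<beta> i), 1), (of_real (1 - \<beta>bar + \<epsilon>), 1), (of_real (\<nu> * (\<epsilon> - \<beta> i)), \<nu>)]
               [(0, 1), (of_real (\<epsilon> - \<beta> i), 1), (of_real (1 - \<nu> * \<beta> i), \<nu>)]
               (of_real ((q / (1 - q)) powr \<nu>))) \<longlongrightarrow> l) (at_right 0) \<and>
           complex_of_real (f q) =
             of_real (1 / (\<nu> * Gamma (\<beta> i) * Gamma (\<beta>bar - \<beta> i)) *
                q powr (\<nu> * \<beta> i - 1) * (1 - q) powr (- (\<nu> * \<beta> i + 1))) * l"
    unfolding \<beta>bar a_def[symmetric] z_def by (intro exI[of _ l]) simp
qed

end
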